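(* Let $K=\mathbb{Q}_2(\sqrt{5})$ and let $d=2m$ with $m\ge 3$ odd. Then: (1) if $3\nmid d$, then $\Gamma^*(d,K)=\frac{3}{2}d+1$; (2) if $3\mid d$, then $3d+1\le \Gamma^*(d,K)\le 4d+1$.
   Context: For a field $K$ and integer $d\ge1$, an additive form of degree $d$ over $K$ in $s$ variables is $a_1x_1^d+\dots+a_sx_s^d$ with $a_i\in K$; a nontrivial zero is a point $(x_1,\dots,x_s)\in K^s\setminus\{0\}$ at which the form vanishes. $\Gamma^*(d,K)$ denotes the least integer $N$ such that every additive form of degree $d$ over $K$ in at least $N$ variables has a nontrivial zero in $K$. *)

theory Defs
  imports
    Complex_Main
    "HOL-Library.Extended_Nat"
    "HOL-Computational_Algebra.Fraction_Field"
    "HOL-Computational_Algebra.Primes"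
begin

text \<open>The 2-adic integers, as the inverse limit of the rings \<open>Z/2^n\<close>: coherent sequences
  of least nonnegative residues.\<close>

typedef z2 = "{x :: nat \<Rightarrow> int. \<forall>n. 0 \<le> x n \<and> x n < 2 ^ n \<and> x (Suc n) mod 2 ^ n = x n}"
  morphisms z2_res Abs_z2
  by (rule exI[of _ "\<lambda>_. 0"]) auto

setup_lifting type_definition_z2

lemma z2_res_bounds: "0 \<le> z2_res x n" "z2_res x n < 2 ^ n"
  using z2_res[of x] by auto

lemma z2_res_mod_self: "z2_res x n mod 2 ^ n = z2_res x n"
  by (rule mod_pos_pos_trivial) (rule z2_res_bounds)+

lemma z2_eq_iff: "x = y \<longleftrightarrow> (\<forall>n. z2_res x n = z2_res y n)"
  by (metis ext z2_res_inject)

lemma coherent_mod: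
  assumes "x mod 2 ^ n = (y :: int) mod 2 ^ n"
  shows "0 \<le> y mod 2 ^ n \<and> y mod 2 ^ n < 2 ^ n \<and> x mod 2 ^ Suc n mod 2 ^ n = y mod 2 ^ n"
  using assms by (simp add: mod_mod_cancel)

instantiation z2 :: comm_ring_1
begin

lift_definition zero_z2 :: z2 is "\<lambda>_. 0"
  by simp

lift_definition one_z2 :: z2 is "\<lambda>n. 1 mod 2 ^ n"
  by (intro allI coherent_mod) (rule refl)

lift_definition plus_z2 :: "z2 \<Rightarrow> z2 \<Rightarrow> z2" is "\<lambda>x y n. (x n + y n) mod 2 ^ n"
  by (intro allI coherent_mod) (metis mod_add_eq)

lift_definition minus_z2 :: "z2 \<Rightarrow> z2 \<Rightarrow> z2" is "\<lambda>x y n. (x n - y n) mod 2 ^ n"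
  by (intro allI coherent_mod) (metis mod_diff_eq)

lift_definition uminus_z2 :: "z2 \<Rightarrow> z2" is "\<lambda>x n. (- x n) mod 2 ^ n"
  by (intro allI coherent_mod) (metis mod_minus_eq)

lift_definition times_z2 :: "z2 \<Rightarrow> z2 \<Rightarrow> z2" is "\<lambda>x y n. (x n * y n) mod 2 ^ n"
  by (intro allI coherent_mod) (metis mod_mult_eq)

instance
proof
  fix a b c :: z2
  show "a * b * c = a * (b * c)"
    by transfer (simp add: fun_eq_iff mod_simps mult.assoc)
  show "a * b = b * a"
    by transfer (simp add: fun_eq_iff mult.commute)
  show "1 * a = a"
    by (simp only: z2_eq_iff times_z2.rep_eq one_z2.rep_eq mod_mult_left_eq mult_1
        z2_res_mod_self simp_thms)
  show "a + b + c = a + (b + c)"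
    by transfer (simp add: fun_eq_iff mod_simps add.assoc)
  show "a + b = b + a"
    by transfer (simp add: fun_eq_iff add.commute)
  show "0 + a = a"
    by (simp only: z2_eq_iff plus_z2.rep_eq zero_z2.rep_eq add_0 z2_res_mod_self simp_thms)
  show "- a + a = 0"
    by transfer (simp add: fun_eq_iff mod_simps)
  show "a - b = a + - b"
    by transfer (simp add: fun_eq_iff mod_simps)
  show "(a + b) * c = a * c + b * c"
    by transfer (simp add: fun_eq_iff mod_simps distrib_right)
  show "(0 :: z2) \<noteq> 1"
    by transfer (auto simp: fun_eq_iff intro!: exI[of _ 1])
qed

end

lemma z2_res_Suc: "z2_res x (Suc n) mod 2 ^ n = z2_res x n"
  using z2_res[of x] by auto

lemma z2_res_mod: "z2_res x (n + k) mod 2 ^ n = z2_res x n"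
proof (induction k)
  case 0
  show ?case by (simp add: z2_res_bounds)
next
  case (Suc k)
  have "z2_res x (n + Suc k) mod 2 ^ n = z2_res x (Suc (n + k)) mod 2 ^ (n + k) mod 2 ^ n"
    by (simp add: mod_mod_cancel le_imp_power_dvd)
  with Suc show ?case by (simp add: z2_res_Suc)
qed

lemma z2_res_dvd_iff: "2 ^ n dvd z2_res x (n + k) \<longleftrightarrow> z2_res x n = 0"
  by (simp add: dvd_eq_mod_eq_0 z2_res_mod)

lemma pow2_dvd_mult:
  assumes "\<not> 2 ^ m dvd (a :: int)" "\<not> 2 ^ n dvd b"
  shows "\<not> 2 ^ (m + n) dvd a * b"
proof
  assume *: "2 ^ (m + n) dvd a * b"
  have nz: "a \<noteq> 0" "b \<noteq> 0" using assms by auto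
  have "multiplicity 2 a < m" "multiplicity 2 b < n"
    using assms nz by (simp_all add: power_dvd_iff_le_multiplicity not_le)
  moreover have "m + n \<le> multiplicity 2 (a * b)"
    using * nz by (simp add: power_dvd_iff_le_multiplicity)
  moreover have "multiplicity 2 (a * b) = multiplicity 2 a + multiplicity 2 b"
    using nz by (intro prime_elem_multiplicity_mult_distrib) auto
  ultimately show False by linarith
qed

instance z2 :: idom
proof
  fix a b :: z2
  assume "a \<noteq> 0" "b \<noteq> 0"
  then obtain m n where mn: "z2_res a m \<noteq> 0" "z2_res b n \<noteq> 0"
    by (auto simp: z2_eq_iff zero_z2.rep_eq)
  have "\<not> 2 ^ (m + n) dvd z2_res a (m + n) * z2_res b (m + n)"
    using mn z2_res_dvd_iff[of m a n] z2_res_dvd_iff[of n b m]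
    by (intro pow2_dvd_mult) (simp_all add: add.commute)
  then have "z2_res (a * b) (m + n) \<noteq> 0"
    by (simp add: times_z2.rep_eq dvd_eq_mod_eq_0)
  then show "a * b \<noteq> 0"
    by (auto simp: zero_z2.rep_eq)
qed

text \<open>The field of 2-adic numbers.\<close>

type_synonym q2 = "z2 fract"

lemma z2_res_numeral: "z2_res (numeral k) n = numeral k mod 2 ^ n"
proof -
  have "z2_res (of_nat j) n = int j mod 2 ^ n" for j
    by (induction j) (simp_all add: zero_z2.rep_eq one_z2.rep_eq plus_z2.rep_eq mod_simps)
  from this[of "numeral k"] show ?thesis by simp
qed

lemma z2_even_iff: "2 dvd x \<longleftrightarrow> z2_res x 1 = 0"
proof
  assume "2 dvd x"
  then obtain y where "x = 2 * y" by (elim dvdE)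
  then show "z2_res x 1 = 0" by (simp add: times_z2.rep_eq z2_res_numeral)
next
  assume x1: "z2_res x 1 = 0"
  have ev: "2 dvd z2_res x (Suc n)" for n
    using z2_res_dvd_iff[of 1 x n] x1 by simp
  define f where "f n = z2_res x (Suc n) div 2" for n
  have f2: "z2_res x (Suc n) = 2 * f n" for n
    using ev[of n] by (simp add: f_def)
  have "0 \<le> f n \<and> f n < 2 ^ n \<and> f (Suc n) mod 2 ^ n = f n" for n
  proof -
    have "2 * f (Suc n) mod (2 * 2 ^ n) = 2 * f n"
      using z2_res_Suc[of x "Suc n"] by (simp add: f2)
    then have "f (Suc n) mod 2 ^ n = f n"
      by (simp add: mult_mod_right [symmetric])
    moreover have "0 \<le> 2 * f n" "2 * f n < 2 * 2 ^ n"
      using z2_res_bounds[of x "Suc n"] by (simp_all add: f2)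
    ultimately show ?thesis by simp
  qed
  then have res: "z2_res (Abs_z2 f) n = f n" for n
    by (simp add: Abs_z2_inverse)
  have "x = 2 * Abs_z2 f"
    unfolding z2_eq_iff
  proof
    fix n
    have "z2_res (2 * Abs_z2 f) n = 2 * f n mod 2 ^ n"
      by (simp add: times_z2.rep_eq z2_res_numeral res mod_simps)
    also have "\<dots> = z2_res x n"
      using z2_res_Suc[of x n] by (simp add: f2)
    finally show "z2_res x n = z2_res (2 * Abs_z2 f) n" ..
  qed
  then show "2 dvd x" by simp
qed

lemma int_odd_sq_5: "odd a \<or> odd b \<Longrightarrow> (a * a :: int) mod 8 \<noteq> 5 * (b * b) mod 8"
proof
  assume odd: "odd a \<or> odd b" and eq: "a * a mod 8 = 5 * (b * b) mod 8"
  have "a mod 8 \<in> {0, 1, 2, 3, 4, 5, 6, 7}" "b mod 8 \<in> {0, 1, 2, 3, 4, 5, 6, 7}" by auto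
  moreover have "(a mod 8) * (a mod 8) mod 8 = 5 * ((b mod 8) * (b mod 8)) mod 8"
    using eq by (metis mod_mult_eq mod_mult_right_eq)
  moreover have "odd (a mod 8) \<or> odd (b mod 8)"
    using odd by (simp add: dvd_mod_iff)
  ultimately show False by auto
qed

lemma z2_sq_5_even:
  assumes "x * x = 5 * (y * y)"
  shows "2 dvd x \<and> 2 dvd (y :: z2)"
proof (rule ccontr)
  assume "\<not> (2 dvd x \<and> 2 dvd y)"
  then have "odd (z2_res x 3) \<or> odd (z2_res y 3)"
    using z2_res_dvd_iff[of 1 x 2] z2_res_dvd_iff[of 1 y 2]
    by (simp add: z2_even_iff numeral_3_eq_3 numeral_2_eq_2)
  moreover have "z2_res (x * x) 3 = z2_res (5 * (y * y)) 3"
    by (simp only: assms)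
  then have "z2_res x 3 * z2_res x 3 mod 8 = 5 * (z2_res y 3 * z2_res y 3) mod 8"
    by (simp add: times_z2.rep_eq z2_res_numeral mod_simps)
  ultimately show False using int_odd_sq_5 by blast
qed

lemma z2_sq_5_zero:
  assumes "x * x = 5 * (y * y)"
  shows "y = (0 :: z2)"
proof -
  have two: "(2 :: z2) \<noteq> 0"
    by (auto simp: z2_eq_iff z2_res_numeral zero_z2.rep_eq intro!: exI[of _ 2])
  have "z2_res y n = 0" for n
    using assms
  proof (induction n arbitrary: x y)
    case 0
    show ?case using z2_res_bounds[of y 0] by simp
  next
    case (Suc n)
    from z2_sq_5_even[OF Suc.prems] obtain u v where uv: "x = 2 * u" "y = 2 * v"
      by (auto elim!: dvdE)
    have "(2 * 2) * (u * u) = (2 * 2) * (5 * (v * v))"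
      using Suc.prems unfolding uv by (simp only: mult_ac)
    then have "u * u = 5 * (v * v)"
      by (metis two mult_left_cancel no_zero_divisors)
    from Suc.IH[OF this] have "z2_res v n = 0" .
    then have "2 ^ n dvd z2_res v (Suc n)" using z2_res_dvd_iff[of n v 1] by simp
    then have "2 ^ Suc n dvd 2 * z2_res v (Suc n)" by simp
    then show ?case
      by (simp add: uv times_z2.rep_eq z2_res_numeral mod_simps)
  qed
  then show ?thesis by (simp add: z2_eq_iff zero_z2.rep_eq)
qed

lemma q2_sq_5_zero:
  assumes "x * x = 5 * (y * y)"
  shows "y = (0 :: q2)"
proof -
  obtain a b where x: "x = Fract a b" "b \<noteq> 0" by (cases x) auto
  obtain c e where y: "y = Fract c e" "e \<noteq> 0" by (cases y) auto
  have five: "(5 :: q2) = Fract 5 1"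
    by (metis fract_collapse(2) of_nat_fract of_nat_numeral)
  have "(a * a) * (e * e) = (5 * (c * c)) * (b * b)"
    using assms x y by (simp add: five eq_fract)
  then have "(a * e) * (a * e) = 5 * ((c * b) * (c * b))"
    by (simp only: mult_ac)
  from z2_sq_5_zero[OF this] x have "c = 0" by simp
  then show ?thesis by (simp add: y fract_collapse)
qed

text \<open>\<open>Q2_sqrt5 a b\<close> represents \<open>a + b * sqrt 5\<close>; by \<open>q2_sq_5_zero\<close>, 5 is not a square in \<open>q2\<close>.\<close>

datatype q2_sqrt5 = Q2_sqrt5 (q2_fst: q2) (q2_snd: q2)

lemma q2_sqrt5_eq_iff: "x = y \<longleftrightarrow> q2_fst x = q2_fst y \<and> q2_snd x = q2_snd y"
  by (auto intro: q2_sqrt5.expand)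

lemma q2_norm_eq_0:
  assumes "q2_fst x * q2_fst x - 5 * (q2_snd x * q2_snd x) = 0"
  shows "q2_fst x = 0 \<and> q2_snd x = 0"
  using assms q2_sq_5_zero[of "q2_fst x" "q2_snd x"] by auto

lemma inverse_by_norm:
  fixes a b c N :: "'a :: field"
  assumes N: "N = a * a - c * (b * b)" "N \<noteq> 0"
  shows "a / N * a + c * (- b / N * b) = 1" "a / N * b + - b / N * a = 0"
proof -
  have "a / N * a + c * (- b / N * b) = (a * a - c * (b * b)) / N"
    by (simp add: diff_divide_distrib)
  with N show "a / N * a + c * (- b / N * b) = 1" by simp
qed simp

instantiation q2_sqrt5 :: field
begin

definition "0 = Q2_sqrt5 0 0"

definition "1 = Q2_sqrt5 1 0"

definition "x + y = Q2_sqrt5 (q2_fst x + q2_fst y) (q2_snd x + q2_snd y)"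

definition "x - y = Q2_sqrt5 (q2_fst x - q2_fst y) (q2_snd x - q2_snd y)"

definition "- x = Q2_sqrt5 (- q2_fst x) (- q2_snd x)"

definition "x * y = Q2_sqrt5 (q2_fst x * q2_fst y + 5 * (q2_snd x * q2_snd y))
                             (q2_fst x * q2_snd y + q2_snd x * q2_fst y)"

definition "inverse x =
  (let N = q2_fst x * q2_fst x - 5 * (q2_snd x * q2_snd x)
   in Q2_sqrt5 (q2_fst x / N) (- q2_snd x / N))"

definition "x div y = x * inverse (y :: q2_sqrt5)"

instance
proof
  fix a b c :: q2_sqrt5
  show "a * b * c = a * (b * c)"
    unfolding times_q2_sqrt5_def q2_sqrt5.sel q2_sqrt5.inject
    by (simp only: ring_distribs ac_simps simp_thms)
  show "a * b = b * a"
    unfolding times_q2_sqrt5_def by (simp only: ac_simps)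
  show "1 * a = a"
    by (simp add: times_q2_sqrt5_def one_q2_sqrt5_def)
  show "(a + b) * c = a * c + b * c"
    unfolding times_q2_sqrt5_def plus_q2_sqrt5_def q2_sqrt5.sel q2_sqrt5.inject
    by (simp only: ring_distribs ac_simps simp_thms)
  show "a + b + c = a + (b + c)" "a + b = b + a" "0 + a = a" "- a + a = 0" "a - b = a + - b"
    by (simp_all add: plus_q2_sqrt5_def minus_q2_sqrt5_def uminus_q2_sqrt5_def
        zero_q2_sqrt5_def algebra_simps)
  show "(0 :: q2_sqrt5) \<noteq> 1" "inverse (0 :: q2_sqrt5) = 0"
    by (simp_all add: zero_q2_sqrt5_def one_q2_sqrt5_def inverse_q2_sqrt5_def)
  show "a div b = a * inverse b"
    by (rule divide_q2_sqrt5_def)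
  assume "a \<noteq> 0"
  define N where "N = q2_fst a * q2_fst a - 5 * (q2_snd a * q2_snd a)"
  have "N \<noteq> 0"
  proof
    assume "N = 0"
    then have "q2_fst a = 0 \<and> q2_snd a = 0"
      unfolding N_def by (rule q2_norm_eq_0)
    with \<open>a \<noteq> 0\<close> show False by (simp add: q2_sqrt5_eq_iff zero_q2_sqrt5_def)
  qed
  from inverse_by_norm[OF N_def this] show "inverse a * a = 1"
    by (simp only: times_q2_sqrt5_def one_q2_sqrt5_def inverse_q2_sqrt5_def Let_def
        N_def [symmetric] q2_sqrt5.sel)
qed

end

lemma q2_sqrt5_square: "(Q2_sqrt5 0 1)\<^sup>2 = 5"
proof -
  have "of_nat n = Q2_sqrt5 (of_nat n) 0" for n
    by (induction n) (simp_all add: zero_q2_sqrt5_def one_q2_sqrt5_def plus_q2_sqrt5_def)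
  from this[of 5] show ?thesis
    by (simp add: power2_eq_square times_q2_sqrt5_def)
qed

definition additive_form :: "nat \<Rightarrow> nat \<Rightarrow> (nat \<Rightarrow> 'a :: field) \<Rightarrow> (nat \<Rightarrow> 'a) \<Rightarrow> 'a" where
  "additive_form d s a x = (\<Sum>i<s. a i * x i ^ d)"

definition has_nontrivial_zero :: "nat \<Rightarrow> nat \<Rightarrow> (nat \<Rightarrow> 'a :: field) \<Rightarrow> bool" where
  "has_nontrivial_zero d s a \<longleftrightarrow>
     (\<exists>x. (\<exists>i<s. x i \<noteq> 0) \<and> additive_form d s a x = 0)"

text \<open>The infimum is attained if it is finite; it is \<open>\<infinity>\<close> if no such \<open>N\<close> exists.\<close>

definition Gamma_star :: "nat \<Rightarrow> 'a :: field itself \<Rightarrow> enat" where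
  "Gamma_star d K =
     (INF N \<in> {N. \<forall>s\<ge>N. \<forall>a :: nat \<Rightarrow> 'a. has_nontrivial_zero d s a}. enat N)"

end

(*
  K is the unramified quadratic extension of Q_2, with ring of integers O = Z_2[phi] (type o2) and
  residue field F_4 (type f4). By Hensel's lemma a form has a zero as soon as it has a zero modulo 8
  involving a unit coefficient and a unit variable. The d-th powers of units are, modulo 8,
  {1, 5} if 3 | d, and these times the three cube roots of unity otherwise.

  Scaling variables by powers of 2 makes every coefficient 2^l times a unit with 0 <= l < d, and the
  levels l may be rotated cyclically. A cycle lemma gives a rotation for which the first t levels
  contain more than the average share of variables, for all t. It remains to find zero sums modulo 8
  among few coefficients on the first three or four levels. If 3 does not divide d, the coefficients
  may be taken to be 1 modulo 2 and a short case analysis suffices. If 3 | d, one needs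
  zero sums over subsets, where a sum divisible by 4 is good if it involves units of two residue
  classes, and a sum involving units of one residue class c only is good if it is 4 x with x in {0, c}
  modulo 2. Both are zero-sum problems in small groups, mostly solved with the Davenport
  constants of (Z/2)^2 and Z/4 x Z/2.

  The lower bounds come from forms on the even levels, three or six variables each, without
  nontrivial zero modulo 4.
*)
theory Submission imports Defs "HOL-Number_Theory.Cong" begin

text \<open>The degree is twice an odd number, so the derivative loses one factor 2 and lifting
  starts at 8. The power 5 is what keeps the search modulo 8 small: since 5 v = v + 4 v, each
  coefficient of a sum may contribute another 4 v at will. A sum 4 y is therefore good when the
  residue of y is a subset sum of the residues of the units involved. Units of two residue classes
  span F_4, but a single class c yields only {0, c}. This is the obstacle for 3 | d, where d-th
  powers cannot move a unit to another class; for other d the cube roots of unity do that. The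
  stubborn configurations for 3 | d have all variables of a level in one class and in one set Z a +
  4 O. They leave no room for variety on the next levels either, so the search passes from level to
  level and ends only with the fourth one. The forms for the lower bounds use even levels only, so
  that terms of different valuation are separated by a factor 4 and a zero would leave a zero modulo
  4 inside a single level.\<close>

section \<open>Divisibility by powers of 2, completeness and units in the 2-adic integers\<close>

lemma z2_pow2_dvd_iff: "2 ^ n dvd x \<longleftrightarrow> z2_res x n = 0"
proof (induction n arbitrary: x)
  case 0
  show ?case using z2_res_bounds[of x 0] by simp
next
  case (Suc n)
  show ?case
  proof
    assume "2 ^ Suc n dvd x"
    then obtain y where "x = 2 ^ Suc n * y" by (rule dvdE)
    moreover define t where "t = 2 ^ n * y"
    ultimately have y: "x = 2 * t" and "2 ^ n dvd t" by (simp_all only: power_Suc mult.assoc dvd_triv_left)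
    then have "z2_res t n = 0" using Suc.IH[of t] by simp
    then have "2 ^ n dvd z2_res t (Suc n)" using z2_res_dvd_iff[of n t 1] by simp
    then show "z2_res x (Suc n) = 0" by (simp add: y times_z2.rep_eq z2_res_numeral mod_simps)
  next
    assume 0: "z2_res x (Suc n) = 0"
    then have "z2_res x 1 = 0" using z2_res_mod[of x 1 n] by simp
    then obtain y where y: "x = 2 * y" using z2_even_iff by (auto elim!: dvdE)
    have "2 * z2_res y (Suc n) mod (2 * 2 ^ n) = 0"
      using 0 by (simp add: y times_z2.rep_eq z2_res_numeral mod_simps)
    then have "2 ^ n dvd z2_res y (Suc n)" by (simp add: dvd_eq_mod_eq_0)
    then have "z2_res y n = 0" using z2_res_dvd_iff[of n y 1] by simp
    then show "2 ^ Suc n dvd x" using Suc.IH[of y] y by simp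
  qed
qed

lemma z2_separated:
  assumes "\<And>n. 2 ^ n dvd (x :: z2)"
  shows "x = 0"
  using assms by (simp add: z2_pow2_dvd_iff z2_eq_iff zero_z2.rep_eq)

lemma z2_res_eq_iff: "z2_res x n = z2_res y n \<longleftrightarrow> 2 ^ n dvd (x - y)"
proof -
  have "z2_res x n = z2_res y n \<longleftrightarrow> z2_res x n mod 2 ^ n = z2_res y n mod 2 ^ n"
    by (simp only: z2_res_mod_self)
  then show ?thesis
    by (simp add: z2_pow2_dvd_iff minus_z2.rep_eq mod_eq_dvd_iff dvd_eq_mod_eq_0)
qed

text \<open>The diagonal residues \<open>z2_res (X n) n\<close> are coherent because the increments
  are divisible by 2^n; they define the limit.\<close>

lemma z2_complete:
  fixes X :: "nat \<Rightarrow> z2"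
  assumes "\<And>n. 2 ^ n dvd X (Suc n) - X n"
  shows "\<exists>x. \<forall>n. 2 ^ n dvd x - X n"
proof -
  define f where "f n = z2_res (X n) n" for n
  have "0 \<le> f n \<and> f n < 2 ^ n \<and> f (Suc n) mod 2 ^ n = f n" for n
  proof -
    have "z2_res (X (Suc n)) n = z2_res (X n) n" using assms z2_res_eq_iff by blast
    then show ?thesis by (simp add: f_def z2_res_bounds z2_res_Suc)
  qed
  then have "z2_res (Abs_z2 f) n = f n" for n by (simp add: Abs_z2_inverse)
  then show ?thesis by (metis f_def z2_res_eq_iff)
qed

lemma z2_res_of_int: "z2_res (of_int k) n = k mod 2 ^ n"
proof -
  have nat: "z2_res (of_nat j) n = int j mod 2 ^ n" for j
    by (induction j) (simp_all add: zero_z2.rep_eq one_z2.rep_eq plus_z2.rep_eq mod_simps)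
  show ?thesis
    by (cases k) (simp_all add: nat uminus_z2.rep_eq minus_z2.rep_eq one_z2.rep_eq mod_simps)
qed

text \<open>Inverses modulo 2^n exist for every n and are unique modulo 2^n, so they form a Cauchy
  sequence whose limit is the inverse.\<close>

lemma z2_odd_inverse:
  assumes "\<not> 2 dvd (b :: z2)"
  shows "\<exists>y. b * y = 1"
proof -
  have "\<exists>v. 2 ^ n dvd b * of_int v - 1" for n
  proof -
    have "odd (z2_res b (Suc n))"
      using assms z2_res_dvd_iff[of 1 b n] by (simp add: z2_even_iff)
    then have "coprime (z2_res b (Suc n)) (2 ^ n)" by simp
    then obtain v where "[z2_res b (Suc n) * v = 1] (mod 2 ^ n)"
      using cong_solve_coprime_int by blast
    then have "z2_res b n * v mod 2 ^ n = 1 mod 2 ^ n"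
      by (metis cong_def mod_mult_left_eq z2_res_Suc)
    then have "z2_res (b * of_int v) n = z2_res 1 n"
      by (simp add: times_z2.rep_eq z2_res_of_int one_z2.rep_eq mod_simps)
    then show ?thesis using z2_res_eq_iff by blast
  qed
  then obtain v where v: "\<And>n. 2 ^ n dvd b * of_int (v n) - 1" by metis
  have odd_cancel: "2 ^ n dvd y" if "2 ^ n dvd b * y" for n y
  proof -
    have "y = of_int (v n) * (b * y) - (b * of_int (v n) - 1) * y"
      by (simp add: algebra_simps)
    then show ?thesis using that v[of n] by (metis dvd_diff dvd_mult dvd_mult2)
  qed
  have "2 ^ n dvd (of_int (v (Suc n)) - of_int (v n) :: z2)" for n
  proof (rule odd_cancel)
    have "(2::z2) ^ n dvd 2 ^ Suc n" by simp
    then have "2 ^ n dvd b * of_int (v (Suc n)) - 1" using v[of "Suc n"] dvd_trans by blast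
    from dvd_diff[OF this v[of n]]
    show "2 ^ n dvd b * (of_int (v (Suc n)) - of_int (v n))" by (simp add: algebra_simps)
  qed
  then obtain y :: z2 where y: "\<And>n. 2 ^ n dvd y - of_int (v n)"
    using z2_complete[of "\<lambda>n. of_int (v n)"] by blast
  have "2 ^ n dvd b * y - 1" for n
  proof -
    have "b * y - 1 = b * (y - of_int (v n)) + (b * of_int (v n) - 1)" by (simp add: algebra_simps)
    then show ?thesis using y v by (metis dvd_add dvd_mult)
  qed
  then have "b * y - 1 = 0" by (rule z2_separated)
  then show ?thesis by auto
qed

section \<open>The ring of integers and its residue field\<close>

text \<open>The field F_4, with \<open>FW\<close> the residue of \<open>phi\<close> and
  \<open>FV = FW + 1\<close> its square. An explicit four-element type turns statements over F_4
  into finite case checks.\<close>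

datatype f4 = F0 | F1 | FW | FV

instantiation f4 :: field
begin
definition "0 = F0"
definition "1 = F1"
fun plus_f4 :: "f4 \<Rightarrow> f4 \<Rightarrow> f4" where
  "F0 + x = x" | "x + F0 = x" | "F1 + F1 = F0" | "F1 + FW = FV" | "F1 + FV = FW"
| "FW + F1 = FV" | "FW + FW = F0" | "FW + FV = F1" | "FV + F1 = FW" | "FV + FW = F1" | "FV + FV = F0"
fun times_f4 :: "f4 \<Rightarrow> f4 \<Rightarrow> f4" where
  "F0 * x = F0" | "x * F0 = F0" | "F1 * x = x" | "x * F1 = x"
| "FW * FW = FV" | "FW * FV = F1" | "FV * FW = F1" | "FV * FV = FW"
definition "- x = (x :: f4)"
definition "x - y = x + (y :: f4)"
fun inverse_f4 :: "f4 \<Rightarrow> f4" where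
  "inverse F0 = F0" | "inverse F1 = F1" | "inverse FW = FV" | "inverse FV = FW"
definition "x div y = x * inverse (y :: f4)"
instance
proof
  fix a b c :: f4
  show "a * b * c = a * (b * c)" by (cases a; cases b; cases c) simp_all
  show "a * b = b * a" by (cases a; cases b) simp_all
  show "1 * a = a" by (cases a) (simp_all add: one_f4_def)
  show "(a + b) * c = a * c + b * c" by (cases a; cases b; cases c) simp_all
  show "a + b + c = a + (b + c)" by (cases a; cases b; cases c) simp_all
  show "a + b = b + a" by (cases a; cases b) simp_all
  show "0 + a = a" by (simp add: zero_f4_def)
  show "- a + a = 0" by (cases a) (simp_all add: zero_f4_def uminus_f4_def)
  show "a - b = a + - b" by (simp add: minus_f4_def uminus_f4_def)
  show "(0::f4) \<noteq> 1" by (simp add: zero_f4_def one_f4_def)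
  show "a \<noteq> 0 \<Longrightarrow> inverse a * a = 1" by (cases a) (simp_all add: zero_f4_def one_f4_def)
  show "a div b = a * inverse b" by (rule divide_f4_def)
  show "inverse (0::f4) = 0" by (simp add: zero_f4_def)
qed
end

lemma f4_double [simp]: "x + x = (0::f4)"
  by (cases x) (simp_all add: zero_f4_def)

lemma f4_add_eq_0_iff: "x + y = 0 \<longleftrightarrow> x = (y::f4)"
  by (cases x; cases y) (simp_all add: zero_f4_def)

lemma f4_two [simp]: "2 = (0::f4)"
  using f4_double[of 1] by (simp only: one_add_one)

datatype o2 = O2 (o2_fst: z2) (o2_snd: z2)

lemma o2_eq_iff: "x = y \<longleftrightarrow> o2_fst x = o2_fst y \<and> o2_snd x = o2_snd y"
  by (auto intro: o2.expand)

text \<open>\<open>O2 a b\<close> is \<open>a + b \<phi>\<close> with \<open>\<phi> = (1 + sqrt 5) / 2\<close>, so \<open>\<phi>\<^sup>2 = \<phi> + 1\<close>.\<close>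

instantiation o2 :: comm_ring_1
begin
definition "0 = O2 0 0"
definition "1 = O2 1 0"
definition "x + y = O2 (o2_fst x + o2_fst y) (o2_snd x + o2_snd y)"
definition "x - y = O2 (o2_fst x - o2_fst y) (o2_snd x - o2_snd y)"
definition "- x = O2 (- o2_fst x) (- o2_snd x)"
definition "x * y = O2 (o2_fst x * o2_fst y + o2_snd x * o2_snd y)
                       (o2_fst x * o2_snd y + o2_snd x * o2_fst y + o2_snd x * o2_snd y)"
instance
  by standard
    (simp_all add: zero_o2_def one_o2_def plus_o2_def minus_o2_def uminus_o2_def times_o2_def
      algebra_simps)
end

lemma o2_mult_two_power: "2 ^ n * x = O2 (2 ^ n * o2_fst x) (2 ^ n * o2_snd x)"
proof (induction n)
  case (Suc n)
  have double: "(2::o2) * y = O2 (2 * o2_fst y) (2 * o2_snd y)" for y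
    unfolding mult_2 plus_o2_def by simp
  show ?case by (simp only: power_Suc mult.assoc double[of "2 ^ n * x"]) (simp add: Suc)
qed simp

lemma o2_pow2_dvd_iff: "2 ^ n dvd x \<longleftrightarrow> 2 ^ n dvd o2_fst x \<and> 2 ^ n dvd o2_snd x"
proof
  assume "2 ^ n dvd o2_fst x \<and> 2 ^ n dvd o2_snd x"
  then obtain a b where "o2_fst x = 2 ^ n * a" "o2_snd x = 2 ^ n * b" by (auto elim!: dvdE)
  then have "x = 2 ^ n * O2 a b" by (simp add: o2_mult_two_power o2_eq_iff)
  then show "2 ^ n dvd x" by simp
qed (auto simp: o2_mult_two_power elim!: dvdE)

lemma o2_separated: "(\<And>n. 2 ^ n dvd (x :: o2)) \<Longrightarrow> x = 0"
  using z2_separated[of "o2_fst x"] z2_separated[of "o2_snd x"]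
  by (simp add: o2_pow2_dvd_iff o2_eq_iff zero_o2_def)

lemma o2_complete:
  fixes X :: "nat \<Rightarrow> o2"
  assumes "\<And>n. 2 ^ n dvd X (Suc n) - X n"
  shows "\<exists>x. \<forall>n. 2 ^ n dvd x - X n"
proof -
  obtain a where a: "\<forall>n. 2 ^ n dvd a - o2_fst (X n)"
    using z2_complete[of "\<lambda>n. o2_fst (X n)"] assms by (auto simp: o2_pow2_dvd_iff minus_o2_def)
  obtain b where b: "\<forall>n. 2 ^ n dvd b - o2_snd (X n)"
    using z2_complete[of "\<lambda>n. o2_snd (X n)"] assms by (auto simp: o2_pow2_dvd_iff minus_o2_def)
  show ?thesis using a b
    by (intro exI[of _ "O2 a b"]) (simp add: o2_pow2_dvd_iff minus_o2_def)
qed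

lemma z2_two_nonzero: "(2::z2) \<noteq> 0"
  by (auto simp: z2_eq_iff z2_res_numeral zero_z2.rep_eq intro!: exI[of _ 2])

lemma o2_two_power_cancel [simp]: "2 ^ n * x = 2 ^ n * y \<longleftrightarrow> x = (y::o2)"
  using z2_two_nonzero by (auto simp: o2_mult_two_power o2_eq_iff)

lemma o2_two_cancel [simp]: "2 * x = 2 * y \<longleftrightarrow> x = (y::o2)"
  using o2_two_power_cancel[of 1] by simp

lemma o2_four_cancel [simp]: "4 * x = 4 * y \<longleftrightarrow> x = (y::o2)"
  using o2_two_power_cancel[of 2] by simp

text \<open>Reduction modulo 2. Since 2 is inert in K, this is the residue map of O onto F_4, and
  \<open>par x \<noteq> 0\<close> says that x is a unit.\<close>

definition par :: "o2 \<Rightarrow> f4" where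
  "par x = (if 2 dvd o2_fst x then (if 2 dvd o2_snd x then F0 else FW)
            else (if 2 dvd o2_snd x then F1 else FV))"

lemma z2_odd_add: "\<not> 2 dvd x \<Longrightarrow> \<not> 2 dvd y \<Longrightarrow> 2 dvd (x + y :: z2)"
proof -
  have res1: "z2_res z 1 = 0 \<or> z2_res z 1 = 1" for z using z2_res_bounds[of z 1] by auto
  show "\<not> 2 dvd x \<Longrightarrow> \<not> 2 dvd y \<Longrightarrow> 2 dvd x + y"
    using res1[of x] res1[of y] by (auto simp: z2_even_iff plus_z2.rep_eq)
qed

lemma z2_dvd_add_iff: "2 dvd (x + y :: z2) \<longleftrightarrow> (2 dvd x \<longleftrightarrow> 2 dvd y)"
  using z2_odd_add by (metis dvd_add dvd_add_left_iff dvd_add_right_iff)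

lemma z2_dvd_mult_iff: "2 dvd (x * y :: z2) \<longleftrightarrow> 2 dvd x \<or> 2 dvd y"
proof -
  have res1: "z2_res z 1 = 0 \<or> z2_res z 1 = 1" for z using z2_res_bounds[of z 1] by auto
  show ?thesis using res1[of x] res1[of y] by (auto simp: z2_even_iff times_z2.rep_eq)
qed

lemma par_add [simp]: "par (x + y) = par x + par y"
  by (simp add: par_def plus_o2_def z2_dvd_add_iff zero_f4_def)

lemma par_mult [simp]: "par (x * y) = par x * par y"
  by (simp add: par_def times_o2_def z2_dvd_add_iff z2_dvd_mult_iff zero_f4_def one_f4_def)

lemma par_eq_0_iff: "par x = 0 \<longleftrightarrow> 2 dvd x"
  using o2_pow2_dvd_iff[of 1 x] by (simp add: par_def zero_f4_def)

lemma par_0 [simp]: "par 0 = 0" by (simp add: par_eq_0_iff)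
lemma z2_one_odd: "\<not> 2 dvd (1::z2)" by (simp add: z2_even_iff one_z2.rep_eq)
lemma par_1 [simp]: "par 1 = 1" by (simp add: par_def one_o2_def one_f4_def z2_one_odd)
lemma par_minus [simp]: "par (- x) = par x"
  using par_add[of x "- x"] by (simp add: f4_add_eq_0_iff del: par_add)
lemma par_diff [simp]: "par (x - y) = par x + par y"
  by (metis diff_conv_add_uminus par_add par_minus)
lemma par_power [simp]: "par (x ^ n) = par x ^ n" by (induction n) simp_all
lemma par_sum [simp]: "par (sum f S) = (\<Sum>i\<in>S. par (f i))"
  by (induction S rule: infinite_finite_induct) simp_all
lemma par_two [simp]: "par 2 = 0" by (simp add: par_eq_0_iff)
lemma par_four [simp]: "par 4 = 0" using par_mult[of 2 2] by simp

lemma par_surj: "\<exists>x. par x = c"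
proof -
  have "par (O2 0 0) = F0" "par (O2 1 0) = F1" "par (O2 0 1) = FW" "par (O2 1 1) = FV"
    by (simp_all add: par_def z2_one_odd)
  then show ?thesis by (cases c) blast+
qed

abbreviation phi :: o2 where "phi \<equiv> O2 0 1"

lemma phi_square: "phi * phi = phi + 1"
  by (simp add: times_o2_def plus_o2_def one_o2_def)

lemma par_phi [simp]: "par phi = FW"
  by (simp add: par_def z2_one_odd)

section \<open>Hensel lifting in degree 2 m with m odd\<close>

lemma f4_linear_solvable: "p \<noteq> 0 \<Longrightarrow> \<exists>t. q + p * t = (0::f4)"
  by (rule exI[of _ "- q / p"]) simp

lemma pow2_dvd_of_double:
  assumes "(2::o2) dvd y" shows "2 ^ Suc n dvd 2 ^ n * y"
  using assms by (auto simp: ac_simps elim!: dvdE)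

text \<open>First-order Taylor expansion: the remainder contains h^2 with h = 2^n y, and 2 n >= n +
  1.\<close>

lemma power_perturb:
  fixes X y :: o2
  assumes "n \<ge> 1"
  shows "2 ^ Suc n dvd (X + 2 ^ n * y) ^ Suc m - X ^ Suc m - of_nat (Suc m) * X ^ m * (2 ^ n * y)"
proof (induction m)
  case (Suc m)
  obtain k where k: "n = Suc k" using assms by (cases n) auto
  let ?h = "2 ^ n * y"
  have "(X + ?h) ^ Suc (Suc m) - X ^ Suc (Suc m) - of_nat (Suc (Suc m)) * X ^ Suc m * ?h
      = (X + ?h) * ((X + ?h) ^ Suc m - X ^ Suc m - of_nat (Suc m) * X ^ m * ?h)
        + of_nat (Suc m) * X ^ m * ?h * ?h"
    by (simp add: algebra_simps)
  moreover have "?h * ?h = 2 ^ Suc n * (2 ^ k * (y * y))"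
    by (simp add: k ac_simps)
  then have "2 ^ Suc n dvd of_nat (Suc m) * X ^ m * ?h * ?h"
    by (metis dvd_mult dvd_triv_left mult.assoc)
  ultimately show ?case using Suc by (simp only: dvd_add dvd_mult)
qed simp

text \<open>Squaring first exposes the loss of one power of 2: (x + 2^n t)^2 = x^2 + 2^(n+1) (x t +
  2^(n-1) t^2), where n >= 2 makes the last summand even. As m is odd, the value divided by 2^(n+1)
  changes modulo 2 by the unit a x^(2m-1) times t, so t comes from a linear equation over
  F_4.\<close>

lemma hensel_step:
  fixes a x r :: o2
  assumes m: "odd m" and n: "n \<ge> 2" and a: "par a \<noteq> 0" and x: "par x \<noteq> 0"
    and dvd: "2 ^ Suc n dvd a * x ^ (2 * m) + r"
  shows "\<exists>t. 2 ^ Suc (Suc n) dvd a * (x + 2 ^ n * t) ^ (2 * m) + r"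
proof -
  obtain f where f: "a * x ^ (2 * m) + r = 2 ^ Suc n * f" using dvd by (rule dvdE)
  obtain k where k: "n = Suc (Suc k)" using n by (metis add_2_eq_Suc le_Suc_ex)
  obtain j where j: "m = Suc j" using m by (cases m) auto
  have "par (a * (x\<^sup>2) ^ j * x) \<noteq> 0" using a x by simp
  then obtain s where "par f + par (a * (x\<^sup>2) ^ j * x) * s = 0" using f4_linear_solvable by blast
  then obtain t where t: "par f + par (a * (x\<^sup>2) ^ j * x) * par t = 0" using par_surj by metis
  define y where "y = x * t + 2 * (2 ^ k * (t * t))"
  have sq: "(x + 2 ^ n * t)\<^sup>2 = x\<^sup>2 + 2 ^ Suc n * y"
    by (simp add: y_def k power2_eq_square algebra_simps)
  let ?R = "(x\<^sup>2 + 2 ^ Suc n * y) ^ m - (x\<^sup>2) ^ m - of_nat m * (x\<^sup>2) ^ j * (2 ^ Suc n * y)"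
  have R: "2 ^ Suc (Suc n) dvd ?R"
    using power_perturb[of "Suc n" "x\<^sup>2" y j] j by simp
  have "a * (x + 2 ^ n * t) ^ (2 * m) + r = a * ?R + 2 ^ Suc n * (f + a * of_nat m * (x\<^sup>2) ^ j * y)"
    using f unfolding power_mult sq by (simp add: algebra_simps)
  moreover have "2 dvd f + a * of_nat m * (x\<^sup>2) ^ j * y"
  proof -
    have "par (of_nat m) = 1" using m by (auto elim!: oddE)
    then have "par (f + a * of_nat m * (x\<^sup>2) ^ j * y) = 0"
      using t by (simp add: y_def ac_simps)
    then show ?thesis by (simp only: par_eq_0_iff)
  qed
  ultimately show ?thesis using R pow2_dvd_of_double by (metis dvd_add dvd_mult)
qed

lemma dvd_power_diff: "(x - y :: o2) dvd x ^ n - y ^ n"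
  by (metis power_diff_sumr2 dvd_triv_left)

lemma hensel:
  fixes a x r :: o2
  assumes m: "odd m" and a: "par a \<noteq> 0" and x: "par x \<noteq> 0"
    and dvd: "8 dvd a * x ^ (2 * m) + r"
  shows "\<exists>z. a * z ^ (2 * m) + r = 0 \<and> par z \<noteq> 0"
proof -
  \<comment> \<open>Precision 2^(n+3) of the value goes with precision 2^(n+2) of the
    variable.\<close>
  let ?P = "\<lambda>n z. 2 ^ (n + 3) dvd a * z ^ (2 * m) + r \<and> par z \<noteq> 0"
  have "\<exists>X. \<forall>n. ?P n (X n) \<and> 2 ^ (n + 2) dvd X (Suc n) - X n"
  proof (rule dependent_nat_choice)
    show "\<exists>z. ?P 0 z" using dvd x by auto
  next
    fix z n assume P: "?P n z"
    have "\<exists>t. 2 ^ Suc (Suc (n + 2)) dvd a * (z + 2 ^ (n + 2) * t) ^ (2 * m) + r"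
      using P by (intro hensel_step[OF m _ a]) (simp_all add: eval_nat_numeral)
    then obtain t where "2 ^ Suc (Suc (n + 2)) dvd a * (z + 2 ^ (n + 2) * t) ^ (2 * m) + r" ..
    with P show "\<exists>w. ?P (Suc n) w \<and> 2 ^ (n + 2) dvd w - z"
      by (intro exI[of _ "z + 2 ^ (n + 2) * t"]) (simp_all add: eval_nat_numeral)
  qed
  then obtain X where X: "\<And>n. 2 ^ (n + 3) dvd a * X n ^ (2 * m) + r" "\<And>n. par (X n) \<noteq> 0"
    "\<And>n. 2 ^ (n + 2) dvd X (Suc n) - X n" by blast
  have "2 ^ n dvd X (Suc n) - X n" for n
    using X(3)[of n] by (meson dvd_trans le_add1 le_imp_power_dvd)
  then obtain z where z: "\<And>n. 2 ^ n dvd z - X n" using o2_complete by blast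
  have "2 ^ n dvd a * z ^ (2 * m) + r" for n
  proof -
    have "2 ^ n dvd a * X n ^ (2 * m) + r"
      using X(1)[of n] by (meson dvd_trans le_add1 le_imp_power_dvd)
    moreover have "2 ^ n dvd z ^ (2 * m) - X n ^ (2 * m)"
      using z dvd_power_diff dvd_trans by blast
    moreover have "a * z ^ (2 * m) + r = a * (z ^ (2 * m) - X n ^ (2 * m)) + (a * X n ^ (2 * m) + r)"
      by (simp add: algebra_simps)
    ultimately show ?thesis by (metis dvd_add dvd_mult)
  qed
  then have "a * z ^ (2 * m) + r = 0" by (rule o2_separated)
  moreover have "par z \<noteq> 0"
  proof -
    have "par (z - X 1) = 0" unfolding par_eq_0_iff using z[of 1] by simp
    then show ?thesis using X(2)[of 1] by (simp add: f4_add_eq_0_iff)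
  qed
  ultimately show ?thesis by blast
qed

section \<open>Zeros of forms over O: lifting, restriction and scaling\<close>

text \<open>The index set is arbitrary, so that a zero of a subform extends by zeros without
  renumbering.\<close>

definition form_zero :: "nat \<Rightarrow> 'i set \<Rightarrow> ('i \<Rightarrow> 'a :: comm_ring_1) \<Rightarrow> bool" where
  "form_zero d S c \<longleftrightarrow> (\<exists>x. (\<exists>i\<in>S. x i \<noteq> 0) \<and> (\<Sum>i\<in>S. c i * x i ^ d) = 0)"

text \<open>All variables but the j-th are frozen; their contribution is the constant r of
  \<open>hensel\<close>.\<close>

lemma form_zero_hensel:
  fixes c x :: "'i \<Rightarrow> o2"
  assumes "odd m" "finite S" "j \<in> S" "par (c j) \<noteq> 0" "par (x j) \<noteq> 0"
    and "8 dvd (\<Sum>i\<in>S. c i * x i ^ (2 * m))"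
  shows "form_zero (2 * m) S c"
proof -
  define r where "r = (\<Sum>i\<in>S - {j}. c i * x i ^ (2 * m))"
  have "(\<Sum>i\<in>S. c i * x i ^ (2 * m)) = c j * x j ^ (2 * m) + r"
    using assms by (simp add: r_def sum.remove[of S j])
  then obtain z where z: "c j * z ^ (2 * m) + r = 0" "par z \<noteq> 0"
    using hensel[of m "c j" "x j" r] assms by auto
  have "(\<Sum>i\<in>S. c i * (x(j := z)) i ^ (2 * m)) = c j * z ^ (2 * m) + r"
    using assms by (simp add: r_def sum.remove[of S j])
  with z assms(3) show ?thesis
    unfolding form_zero_def by (intro exI[of _ "x(j := z)"]) auto
qed

lemma form_zero_mono:
  assumes "form_zero d J c" "J \<subseteq> S" "finite S" "d > 0"
  shows "form_zero d S c"
proof -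
  obtain x where x: "\<exists>i\<in>J. x i \<noteq> 0" "(\<Sum>i\<in>J. c i * x i ^ d) = 0"
    using assms(1) by (auto simp: form_zero_def)
  have "(\<Sum>i\<in>S. c i * (if i \<in> J then x i else 0) ^ d) = (\<Sum>i\<in>J. c i * x i ^ d)"
    using assms by (intro sum.mono_neutral_cong_right) (auto simp: power_0_left)
  with x assms(2) show ?thesis
    unfolding form_zero_def by (intro exI[of _ "\<lambda>i. if i \<in> J then x i else 0"]) auto
qed

lemma form_zero_scale:
  assumes "form_zero d S c" "\<And>i. i \<in> S \<Longrightarrow> c' i = k * c i"
  shows "form_zero d S c'"
proof -
  obtain x where x: "\<exists>i\<in>S. x i \<noteq> 0" "(\<Sum>i\<in>S. c i * x i ^ d) = 0"
    using assms(1) by (auto simp: form_zero_def)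
  have "(\<Sum>i\<in>S. c' i * x i ^ d) = k * (\<Sum>i\<in>S. c i * x i ^ d)"
    by (simp add: assms(2) sum_distrib_left mult.assoc)
  with x show ?thesis unfolding form_zero_def by auto
qed

section \<open>The embedding into the field\<close>

definition emb :: "z2 \<Rightarrow> q2_sqrt5" where "emb a = Q2_sqrt5 (Fract a 1) 0"

definition gold :: q2_sqrt5 where "gold = Q2_sqrt5 (1 / 2) (1 / 2)"

definition incl :: "o2 \<Rightarrow> q2_sqrt5" where "incl x = emb (o2_fst x) + emb (o2_snd x) * gold"

lemma emb_hom: "emb 0 = 0" "emb 1 = 1" "emb (a + b) = emb a + emb b" "emb (a * b) = emb a * emb b"
  by (simp_all add: emb_def zero_q2_sqrt5_def one_q2_sqrt5_def plus_q2_sqrt5_def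
      times_q2_sqrt5_def fract_collapse)

lemma fract_two: "(2::q2) = Fract 2 1"
  by (metis of_nat_fract of_nat_numeral)

lemma q2_two_nonzero: "(2::q2) \<noteq> 0"
  unfolding fract_two Zero_fract_def using z2_two_nonzero by (subst eq_fract) auto

lemma q2_half: "1 / 2 + 1 / 2 = (1 :: q2)"
  using q2_two_nonzero by (metis add_divide_distrib divide_self one_add_one)

lemma gold_square: "gold * gold = gold + 1"
proof -
  \<comment> \<open>\<open>h\<close> stands for 1/2 and is used only through h + h = 1; the two
    identities are the coordinates of the claim.\<close>
  have *: "h * h + 5 * (h * h) = h + 1 \<and> h * h + h * h = h" if "h + h = 1" for h :: q2
  proof -
    have "h * h + h * h = h" using that by (metis distrib_left mult.right_neutral)
    moreover have "h * h + 5 * (h * h) = (h * h + h * h) + 2 * (h * h + h * h)"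
      by (simp add: algebra_simps)
    ultimately show ?thesis using that by (simp only: mult_2 simp_thms)
  qed
  show ?thesis
    using *[OF q2_half] by (simp only: gold_def times_q2_sqrt5_def plus_q2_sqrt5_def
        one_q2_sqrt5_def q2_sqrt5.sel add_0_right)
qed

lemma incl_0 [simp]: "incl 0 = 0" by (simp add: incl_def zero_o2_def emb_hom)
lemma incl_1 [simp]: "incl 1 = 1" by (simp add: incl_def one_o2_def emb_hom)
lemma incl_add [simp]: "incl (x + y) = incl x + incl y"
  by (simp add: incl_def plus_o2_def emb_hom algebra_simps)
lemma incl_mult [simp]: "incl (x * y) = incl x * incl y"
proof -
  have "incl x * incl y = emb (o2_fst x) * emb (o2_fst y) + emb (o2_snd x) * emb (o2_snd y) * (gold * gold)
      + (emb (o2_fst x) * emb (o2_snd y) + emb (o2_snd x) * emb (o2_fst y)) * gold"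
    by (simp add: incl_def algebra_simps)
  also have "\<dots> = incl (x * y)"
    unfolding gold_square by (simp add: incl_def times_o2_def emb_hom algebra_simps)
  finally show ?thesis ..
qed
lemma incl_power [simp]: "incl (x ^ n) = incl x ^ n" by (induction n) simp_all
lemma incl_sum [simp]: "incl (sum f S) = (\<Sum>i\<in>S. incl (f i))"
  by (induction S rule: infinite_finite_induct) simp_all
lemma incl_two [simp]: "incl 2 = 2"
  using incl_add[of 1 1] by (simp del: incl_add)

lemma Fract_eq_0_iff: "Fract a 1 = 0 \<longleftrightarrow> a = (0::z2)"
  unfolding Zero_fract_def by (subst eq_fract) auto

lemma incl_eq_0_iff [simp]: "incl x = 0 \<longleftrightarrow> x = 0"
proof
  assume "incl x = 0"
  then have "Fract (o2_snd x) 1 * (1/2) = 0" "Fract (o2_fst x) 1 + Fract (o2_snd x) 1 * (1/2) = 0"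
    by (simp_all add: incl_def emb_def gold_def plus_q2_sqrt5_def times_q2_sqrt5_def zero_q2_sqrt5_def)
  then show "x = 0"
    using q2_two_nonzero by (auto simp: o2_eq_iff zero_o2_def Fract_eq_0_iff fract_collapse)
qed simp

lemma K_two_nonzero: "(2::q2_sqrt5) \<noteq> 0"
  using incl_two incl_eq_0_iff[of 2] o2_two_cancel[of 1 0] by auto

lemma extract_power_of_two:
  fixes x :: "'a :: comm_ring_1"
  assumes ex: "\<exists>n. \<not> 2 ^ n dvd x"
  shows "\<exists>n u. x = 2 ^ n * u \<and> \<not> 2 dvd u"
proof -
  define n where "n = (LEAST n. \<not> 2 ^ n dvd x)"
  have n: "\<not> 2 ^ n dvd x" using LeastI_ex[OF ex] by (simp add: n_def)
  then obtain k where k: "n = Suc k" by (cases n) auto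
  have "2 ^ k dvd x" using not_less_Least[of k "\<lambda>n. \<not> 2 ^ n dvd x"] k by (auto simp: n_def)
  then obtain u where u: "x = 2 ^ k * u" by (rule dvdE)
  moreover have "\<not> 2 dvd u" using n u k by (metis mult.commute mult_dvd_mono dvd_refl power_Suc)
  ultimately show ?thesis by blast
qed

lemma z2_decompose: "(x::z2) \<noteq> 0 \<Longrightarrow> \<exists>n u. x = 2 ^ n * u \<and> \<not> 2 dvd u"
  using z2_separated by (intro extract_power_of_two) blast

lemma o2_decompose: "(x::o2) \<noteq> 0 \<Longrightarrow> \<exists>n u. x = 2 ^ n * u \<and> par u \<noteq> 0"
  unfolding par_eq_0_iff using o2_separated by (intro extract_power_of_two) blast

lemma q2_denominator: "\<exists>n a. 2 ^ n * x = Fract a 1" for x :: q2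
proof -
  obtain a b where x: "x = Fract a b" "b \<noteq> 0" by (cases x) auto
  obtain n u where u: "b = 2 ^ n * u" "\<not> 2 dvd u" using z2_decompose[OF x(2)] by blast
  obtain v where v: "u * v = 1" using z2_odd_inverse[OF u(2)] by blast
  have two: "(2::q2) ^ n = Fract (2 ^ n) 1"
    by (induction n) (simp_all add: fract_collapse fract_two)
  have "2 ^ n * x = Fract (a * v) 1"
  proof -
    have "2 ^ n * a = a * v * (2 ^ n * u)"
      using v by (metis mult.assoc mult.commute mult.right_neutral)
    then show ?thesis using x u by (simp add: two eq_fract)
  qed
  then show ?thesis by blast
qed

lemma K_denominator: "\<exists>n y. 2 ^ n * x = incl y"
proof -
  \<comment> \<open>Coordinates in the basis \<open>1\<close>, \<open>gold\<close>: a + b sqrt 5 =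
    (a - b) + 2 b \<open>gold\<close>.\<close>
  define p q where "p = q2_fst x - q2_snd x" and "q = 2 * q2_snd x"
  obtain i a where a: "2 ^ i * p = Fract a 1" using q2_denominator by blast
  obtain j b where b: "2 ^ j * q = Fract b 1" using q2_denominator by blast
  have two: "(2 :: q2_sqrt5) = Q2_sqrt5 2 0"
    using one_add_one[where 'a=q2_sqrt5] one_add_one[where 'a=q2]
    by (simp only: one_q2_sqrt5_def plus_q2_sqrt5_def q2_sqrt5.sel add_0_right)
  have pow: "2 ^ n * Q2_sqrt5 u v = Q2_sqrt5 (2 ^ n * u) (2 ^ n * v)" for n u v
  proof (induction n)
    case (Suc n)
    show ?case unfolding power_Suc mult.assoc Suc
      by (simp add: two times_q2_sqrt5_def)
  qed simp
  have fr: "(2::q2) ^ n * Fract c 1 = Fract (2 ^ n * c) 1" for n c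
    by (induction n) (simp_all add: fract_two mult.assoc)
  have A: "Fract (2 ^ j * a) 1 = 2 ^ (i + j) * p"
  proof -
    have "2 ^ (i + j) * p = 2 ^ j * (2 ^ i * p)" by (simp only: power_add mult_ac)
    then show ?thesis by (simp only: a fr)
  qed
  have B: "Fract (2 ^ i * b) 1 = 2 ^ (i + j) * q"
  proof -
    have "2 ^ (i + j) * q = 2 ^ i * (2 ^ j * q)" by (simp only: power_add mult_ac)
    then show ?thesis by (simp only: b fr)
  qed
  have "incl (O2 (2 ^ j * a) (2 ^ i * b))
      = Q2_sqrt5 (2 ^ (i + j) * p + 2 ^ (i + j) * q * (1 / 2)) (2 ^ (i + j) * q * (1 / 2))"
    by (simp only: incl_def emb_def gold_def A B o2.sel)
       (simp add: plus_q2_sqrt5_def times_q2_sqrt5_def)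
  also have "\<dots> = 2 ^ (i + j) * Q2_sqrt5 (p + q * (1 / 2)) (q * (1 / 2))"
    by (simp only: pow distrib_left mult.assoc)
  also have "q * (1 / 2) = q2_snd x" using q2_two_nonzero by (simp add: q_def)
  finally show ?thesis by (metis diff_add_cancel p_def q2_sqrt5.collapse)
qed

text \<open>The element 2 is a uniformizer: clear the denominator, then split off the power of 2
  inside O.\<close>

lemma K_decompose:
  assumes "(x::q2_sqrt5) \<noteq> 0"
  shows "\<exists>k u. x = 2 powi k * incl u \<and> par u \<noteq> 0"
proof -
  obtain n y where y: "2 ^ n * x = incl y" using K_denominator by blast
  then have "y \<noteq> 0" using assms K_two_nonzero by auto
  then obtain j u where u: "y = 2 ^ j * u" "par u \<noteq> 0" using o2_decompose by blast
  have "x = 2 powi (int j - int n) * incl u"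
    using y u K_two_nonzero by (simp add: power_int_diff field_simps)
  with u show ?thesis by blast
qed

section \<open>Distribution of the coefficients over the levels\<close>

text \<open>The cycle lemma. The start b is the last minimum of the partial sums within a period:
  before the period ends later partial sums are strictly larger, and after that the positive total
  of a whole period is added.\<close>

lemma cyclic_positive_start:
  fixes w :: "nat \<Rightarrow> int"
  assumes "(\<Sum>j<d. w j) > 0"
  shows "\<exists>b<d. \<forall>t. 1 \<le> t \<and> t \<le> d \<longrightarrow> (\<Sum>j<t. w ((b + j) mod d)) > 0"
proof -
  have d: "d > 0" using assms by (cases d) auto
  define S where "S k = (\<Sum>j<k. w (j mod d))" for k
  have S_add: "S (b + t) = S b + (\<Sum>j<t. w ((b + j) mod d))" for b t
    by (induction t) (simp_all add: S_def)
  have tot: "S d > 0" using assms by (simp add: S_def)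
  have period: "S (k + d) = S k + S d" for k
    using S_add[of d k] by (simp add: add.commute) (simp add: S_def)
  define M where "M = Min (S ` {..<d})"
  have "M \<in> S ` {..<d}" unfolding M_def using d by (intro Min_in) auto
  then have ne: "{k. k < d \<and> S k = M} \<noteq> {}" by auto
  define b where "b = Max {k. k < d \<and> S k = M}"
  have b: "b < d" "S b = M" using Max_in[OF _ ne] by (simp_all add: b_def)
  have minimal: "S k \<ge> M" if "k < d" for k unfolding M_def using that by (intro Min_le) auto
  have last: "k \<le> b" if "k < d" "S k = M" for k unfolding b_def using that by (intro Max_ge) auto
  have "(\<Sum>j<t. w ((b + j) mod d)) > 0" if t: "1 \<le> t" "t \<le> d" for t
  proof -
    have "S (b + t) > S b"
    proof (cases "b + t < d")
      case True
      then show ?thesis using minimal[of "b + t"] last[of "b + t"] b t by fastforce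
    next
      case False
      then have "S (b + t) = S (b + t - d) + S d" using period[of "b + t - d"] by simp
      moreover have "S (b + t - d) \<ge> M" using b t by (intro minimal) linarith
      ultimately show ?thesis using b tot by simp
    qed
    then show ?thesis by (simp add: S_add)
  qed
  with b show ?thesis by blast
qed

lemma o2_mult_nonzero: "x \<noteq> 0 \<Longrightarrow> y \<noteq> 0 \<Longrightarrow> x * y \<noteq> (0::o2)"
  by (metis incl_eq_0_iff incl_mult mult_eq_0_iff)

lemma form_zero_twist:
  fixes c g :: "'i \<Rightarrow> o2"
  assumes "form_zero d S (\<lambda>i. c i * g i ^ d)" "\<And>i. i \<in> S \<Longrightarrow> g i \<noteq> 0"
  shows "form_zero d S c"
proof -
  obtain x where x: "\<exists>i\<in>S. x i \<noteq> 0" "(\<Sum>i\<in>S. c i * g i ^ d * x i ^ d) = 0"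
    using assms(1) by (auto simp: form_zero_def)
  have "\<exists>i\<in>S. g i * x i \<noteq> 0" using x(1) assms(2) o2_mult_nonzero by blast
  with x(2) show ?thesis
    unfolding form_zero_def by (intro exI[of _ "\<lambda>i. g i * x i"]) (simp add: power_mult_distrib mult.assoc)
qed

text \<open>Division with remainder gives k i - b = q i d + l i. The quotient is absorbed by scaling
  the variable with 2^(- q i), and 2^b is a common factor. Hence levels count modulo d and from any
  origin b.\<close>

lemma form_zero_in_K:
  fixes u :: "nat \<Rightarrow> o2" and k :: "nat \<Rightarrow> int"
  assumes a: "\<And>i. i < s \<Longrightarrow> a i = 2 powi k i * incl (u i)"
    and zero: "form_zero d {..<s} (\<lambda>i. 2 ^ nat ((k i - int b) mod int d) * u i)"
    and d: "d > 0"
  shows "has_nontrivial_zero d s a"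
proof -
  define l where "l i = nat ((k i - int b) mod int d)" for i
  define q where "q i = (k i - int b) div int d" for i
  obtain x where x: "\<exists>i<s. x i \<noteq> 0" "(\<Sum>i<s. 2 ^ l i * u i * x i ^ d) = 0"
    using zero by (auto simp: form_zero_def l_def)
  define y where "y i = 2 powi (- q i) * incl (x i)" for i
  have k: "k i = int b + int (l i) + q i * int d" for i
    using d by (simp add: l_def q_def)
  have "a i * y i ^ d = 2 ^ b * incl (2 ^ l i * u i * x i ^ d)" if "i < s" for i
  proof -
    have "(2 :: q2_sqrt5) powi k i * (2 powi (- q i)) ^ d = 2 powi (k i - q i * int d)"
      using K_two_nonzero by (simp add: power_int_power' power_int_add [symmetric])
    also have "k i - q i * int d = int (b + l i)" using k[of i] by simp
    finally have "(2 :: q2_sqrt5) powi k i * (2 powi (- q i)) ^ d = 2 ^ b * 2 ^ l i"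
      by (simp only: power_int_of_nat power_add)
    then have "2 powi k i * incl (u i) * ((2 powi (- q i)) ^ d * incl (x i) ^ d)
        = 2 ^ b * 2 ^ l i * incl (u i) * incl (x i) ^ d"
      by (metis mult.assoc mult.left_commute)
    then show ?thesis using a[OF that]
      by (simp add: y_def power_mult_distrib mult.assoc)
  qed
  then have "(\<Sum>i<s. a i * y i ^ d) = 2 ^ b * incl (\<Sum>i<s. 2 ^ l i * u i * x i ^ d)"
    by (simp add: sum_distrib_left)
  also have "\<dots> = 0" using x(2) by simp
  finally have "(\<Sum>i<s. a i * y i ^ d) = 0" .
  moreover have "\<exists>i<s. y i \<noteq> 0" using x(1) K_two_nonzero by (auto simp: y_def)
  ultimately show ?thesis by (auto simp: has_nontrivial_zero_def additive_form_def)
qed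

text \<open>The cycle lemma for the weights \<open>\<alpha> n j - \<beta>\<close>, whose sum is
  positive if there are more than \<beta> / \<alpha> variables per level on average. A pair of
  integers replaces this ratio, which will be 3/2 or 4.\<close>

lemma normalized_levels:
  fixes a :: "nat \<Rightarrow> q2_sqrt5" and \<alpha> \<beta> :: nat
  assumes a: "\<And>i. i < s \<Longrightarrow> a i \<noteq> 0" and d: "d > 0" and s: "\<alpha> * s > \<beta> * d"
  obtains l :: "nat \<Rightarrow> nat" and u :: "nat \<Rightarrow> o2"
  where "\<And>i. i < s \<Longrightarrow> par (u i) \<noteq> 0"
    and "\<And>t. 1 \<le> t \<Longrightarrow> t \<le> d \<Longrightarrow> \<alpha> * card {i\<in>{..<s}. l i < t} > \<beta> * t"
    and "form_zero d {..<s} (\<lambda>i. 2 ^ l i * u i) \<Longrightarrow> has_nontrivial_zero d s a"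
proof -
  have "\<forall>i\<in>{..<s}. \<exists>k u. a i = 2 powi k * incl u \<and> par u \<noteq> 0"
    using a K_decompose by auto
  then obtain k u where ku: "\<And>i. i < s \<Longrightarrow> a i = 2 powi k i * incl (u i)" "\<And>i. i < s \<Longrightarrow> par (u i) \<noteq> 0"
    by (metis lessThan_iff)
  define r where "r i = nat (k i mod int d)" for i
  define n where "n j = card {i\<in>{..<s}. r i = j}" for j
  have r: "r i < d" "int (r i) = k i mod int d" for i
    using d by (simp_all add: r_def nat_less_iff)
  have "(\<Sum>j<d. n j) = card (\<Union>j<d. {i\<in>{..<s}. r i = j})"
    unfolding n_def by (subst card_UN_disjoint) auto
  also have "(\<Union>j<d. {i\<in>{..<s}. r i = j}) = {..<s}" using r by auto
  finally have "(\<Sum>j<d. n j) = s" by simp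
  then have "(\<Sum>j<d. int (n j)) = int s" by (metis of_nat_sum)
  then have "(\<Sum>j<d. int \<alpha> * int (n j) - int \<beta>) = int (\<alpha> * s) - int (\<beta> * d)"
    by (simp add: sum_subtractf sum_distrib_left [symmetric])
  then have "(\<Sum>j<d. int \<alpha> * int (n j) - int \<beta>) > 0" using s by linarith
  from cyclic_positive_start[OF this] obtain b where b: "b < d"
    "\<And>t. 1 \<le> t \<Longrightarrow> t \<le> d \<Longrightarrow> (\<Sum>j<t. int \<alpha> * int (n ((b + j) mod d)) - int \<beta>) > 0" by blast
  define l where "l i = nat ((k i - int b) mod int d)" for i
  have l: "l i = j \<longleftrightarrow> r i = (b + j) mod d" if "j < d" for i j
  proof -
    have "l i = j \<longleftrightarrow> (k i - int b) mod int d = int j"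
      using d by (auto simp: l_def)
    also have "\<dots> \<longleftrightarrow> (k i - int b) mod int d = int j mod int d" using that by simp
    also have "\<dots> \<longleftrightarrow> k i mod int d = (int b + int j) mod int d"
      by (simp add: mod_eq_dvd_iff algebra_simps)
    also have "\<dots> \<longleftrightarrow> int (r i) = int ((b + j) mod d)" by (simp add: r zmod_int)
    finally show ?thesis by simp
  qed
  have "\<alpha> * card {i\<in>{..<s}. l i < t} > \<beta> * t" if t: "1 \<le> t" "t \<le> d" for t
  proof -
    have "{i\<in>{..<s}. l i < t} = (\<Union>j<t. {i\<in>{..<s}. l i = j})" by auto
    also have "card \<dots> = (\<Sum>j<t. card {i\<in>{..<s}. l i = j})" by (subst card_UN_disjoint) auto
    also have "\<dots> = (\<Sum>j<t. n ((b + j) mod d))"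
      unfolding n_def using t by (intro sum.cong) (simp_all add: l)
    finally have "int (card {i\<in>{..<s}. l i < t}) = (\<Sum>j<t. int (n ((b + j) mod d)))" by simp
    moreover have "(\<Sum>j<t. int \<alpha> * int (n ((b + j) mod d)) - int \<beta>)
        = int \<alpha> * (\<Sum>j<t. int (n ((b + j) mod d))) - int \<beta> * int t"
      by (simp add: sum_subtractf sum_distrib_left)
    ultimately have "int (\<alpha> * card {i\<in>{..<s}. l i < t}) > int (\<beta> * t)"
      using b(2)[OF t] by simp
    then show ?thesis by linarith
  qed
  moreover have "has_nontrivial_zero d s a" if "form_zero d {..<s} (\<lambda>i. 2 ^ l i * u i)"
    using form_zero_in_K[of s a k u d b] ku(1) that d unfolding l_def by blast
  ultimately show thesis using that ku(2) by blast
qed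

text \<open>A zero coefficient makes the corresponding unit vector a zero, so only forms with
  nonzero coefficients matter.\<close>

lemma Gamma_star_le:
  assumes "\<And>s (a :: nat \<Rightarrow> 'a :: field). s \<ge> N \<Longrightarrow> (\<And>i. i < s \<Longrightarrow> a i \<noteq> 0) \<Longrightarrow> has_nontrivial_zero d s a"
    and "d > 0"
  shows "Gamma_star d TYPE('a) \<le> enat N"
  unfolding Gamma_star_def
proof (rule INF_lower, safe)
  fix s and a :: "nat \<Rightarrow> 'a" assume s: "N \<le> s"
  show "has_nontrivial_zero d s a"
  proof (cases "\<exists>i<s. a i = 0")
    case True
    then obtain i where i: "i < s" "a i = 0" by blast
    have "(\<Sum>j<s. a j * (if j = i then 1 else 0) ^ d) = 0"
      using i assms(2) by (intro sum.neutral) auto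
    then show ?thesis unfolding has_nontrivial_zero_def additive_form_def
      using i by (intro exI[of _ "\<lambda>j. if j = i then 1 else 0"]) auto
  qed (use assms s in blast)
qed

text \<open>The defining set quantifies over all larger numbers of variables, so one form in N
  variables excludes every number up to N.\<close>

lemma Gamma_star_ge:
  assumes "\<not> has_nontrivial_zero d N (a :: nat \<Rightarrow> 'a :: field)"
  shows "enat (N + 1) \<le> Gamma_star d TYPE('a)"
  unfolding Gamma_star_def using assms
  by (intro INF_greatest) (auto simp: not_less_eq_eq [symmetric])

section \<open>Lower bounds\<close>

text \<open>There are m blocks of r variables, on the levels 0, 2, ..., d - 2. The numbers
  \<open>e i\<close> are even, and modulo d they determine the block. After division by the smallest
  power of 2 that occurs, only terms of one block survive modulo 4, and \<open>block\<close>
  excludes that these sum to zero.\<close>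

lemma block_form_no_zero:
  fixes c :: "nat \<Rightarrow> o2"
  assumes m: "m > 0" and r: "r > 0" and d: "d = 2 * m"
    and block: "\<And>J y. J \<subseteq> {..<r} \<Longrightarrow> J \<noteq> {} \<Longrightarrow> (\<And>j. j \<in> J \<Longrightarrow> par (y j) \<noteq> 0)
      \<Longrightarrow> \<not> 4 dvd (\<Sum>j\<in>J. c j * y j ^ d)"
  shows "\<not> has_nontrivial_zero d (r * m) (\<lambda>i. incl (2 ^ (2 * (i div r)) * c (i mod r)))"
proof
  assume "has_nontrivial_zero d (r * m) (\<lambda>i. incl (2 ^ (2 * (i div r)) * c (i mod r)))"
  then obtain x where x: "\<exists>i<r * m. x i \<noteq> 0"
    "(\<Sum>i<r * m. incl (2 ^ (2 * (i div r)) * c (i mod r)) * x i ^ d) = 0"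
    by (auto simp: has_nontrivial_zero_def additive_form_def)
  define I where "I = {i\<in>{..<r * m}. x i \<noteq> 0}"
  have I: "finite I" "I \<noteq> {}" using x(1) by (auto simp: I_def)
  have "\<forall>i\<in>I. \<exists>k u. x i = 2 powi k * incl u \<and> par u \<noteq> 0"
    using K_decompose by (auto simp: I_def)
  then obtain k u where ku: "\<And>i. i \<in> I \<Longrightarrow> x i = 2 powi k i * incl (u i)" "\<And>i. i \<in> I \<Longrightarrow> par (u i) \<noteq> 0"
    by metis
  \<comment> \<open>The valuation of 2^(2 (i div r)) x_i^d.\<close>
  define e where "e i = 2 * (int (i div r) + int m * k i)" for i
  define v where "v = Min (e ` I)"
  have v: "v \<in> e ` I" "\<And>i. i \<in> I \<Longrightarrow> v \<le> e i" using I by (simp_all add: v_def)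
  define t where "t i = 2 ^ nat (e i - v) * (c (i mod r) * u i ^ d)" for i
  have "incl (2 ^ (2 * (i div r)) * c (i mod r)) * x i ^ d = 2 powi v * incl (t i)" if "i \<in> I" for i
  proof -
    have "(2 :: q2_sqrt5) ^ (2 * (i div r)) * (2 powi k i) ^ d = 2 powi (e i)"
    proof -
      have "(2 :: q2_sqrt5) ^ (2 * (i div r)) = 2 powi int (2 * (i div r))"
        by (simp only: power_int_of_nat)
      moreover have "((2 :: q2_sqrt5) powi k i) ^ d = 2 powi (int d * k i)"
        by (simp only: power_int_power' mult.commute)
      ultimately show ?thesis
        using K_two_nonzero d by (simp only: power_int_add [symmetric] simp_thms)
          (simp add: e_def algebra_simps)
    qed
    also have "\<dots> = 2 powi v * 2 powi int (nat (e i - v))"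
      using v(2)[OF that] K_two_nonzero by (simp add: power_int_add [symmetric] del: power_int_of_nat)
    finally have *: "(2 :: q2_sqrt5) ^ (2 * (i div r)) * (2 powi k i) ^ d = 2 powi v * 2 ^ nat (e i - v)"
      by (simp only: power_int_of_nat)
    have "incl (2 ^ (2 * (i div r)) * c (i mod r)) * x i ^ d
        = (2 ^ (2 * (i div r)) * (2 powi k i) ^ d) * (incl (c (i mod r)) * incl (u i) ^ d)"
      using ku(1)[OF that] by (simp add: power_mult_distrib mult_ac)
    then show ?thesis unfolding * by (simp add: t_def mult_ac)
  qed
  then have "(\<Sum>i\<in>I. incl (2 ^ (2 * (i div r)) * c (i mod r)) * x i ^ d) = 2 powi v * incl (sum t I)"
    by (simp add: sum_distrib_left)
  moreover have "(\<Sum>i\<in>I. incl (2 ^ (2 * (i div r)) * c (i mod r)) * x i ^ d) = 0"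
  proof -
    have "(\<Sum>i\<in>I. incl (2 ^ (2 * (i div r)) * c (i mod r)) * x i ^ d)
        = (\<Sum>i<r * m. incl (2 ^ (2 * (i div r)) * c (i mod r)) * x i ^ d)"
      unfolding I_def using m d by (intro sum.mono_neutral_left) auto
    then show ?thesis using x(2) by (simp only:)
  qed
  ultimately have "sum t I = 0" using K_two_nonzero by (metis incl_eq_0_iff mult_eq_0_iff power_int_eq_0_iff)
  define I0 where "I0 = {i\<in>I. e i = v}"
  have "4 dvd t i" if "i \<in> I - I0" for i
  proof -
    obtain z where "v = 2 * z" using v(1) unfolding e_def by blast
    moreover obtain z' where "e i = 2 * z'" unfolding e_def by blast
    ultimately have "2 \<le> e i - v" using v(2)[of i] that by (auto simp: I0_def)
    then have "2 \<le> nat (e i - v)" by linarith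
    then have "(2::o2) ^ 2 dvd 2 ^ nat (e i - v)" by (rule le_imp_power_dvd)
    then show ?thesis by (simp add: t_def)
  qed
  then have "4 dvd sum t (I - I0)" by (rule dvd_sum)
  moreover have "sum t I = sum t I0 + sum t (I - I0)"
    using I by (metis I0_def add.commute mem_Collect_eq subsetI sum.subset_diff)
  ultimately have dvd: "4 dvd sum t I0" using \<open>sum t I = 0\<close> by (metis dvd_0_right dvd_add_left_iff)
  obtain i0 where i0: "i0 \<in> I0" using v(1) by (auto simp: I0_def)
  have same: "i div r = i0 div r" if "i \<in> I0" for i
  proof -
    have "i < r * m" "i0 < r * m" using that i0 by (auto simp: I0_def I_def)
    then have "i div r < m" "i0 div r < m" by (simp_all add: less_mult_imp_div_less mult.commute)
    moreover have "int (i div r) + int m * k i = int (i0 div r) + int m * k i0"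
      using that i0 by (simp add: I0_def e_def)
    then have "(int (i div r) + int m * k i) mod int m = (int (i0 div r) + int m * k i0) mod int m" by simp
    ultimately show ?thesis by simp
  qed
  define q where "q = i0 div r"
  have split: "i = r * q + i mod r" if "i \<in> I0" for i
    using same[OF that] by (metis q_def mult_div_mod_eq)
  have inj: "inj_on (\<lambda>i. i mod r) I0" by (rule inj_onI) (metis split)
  have "sum t I0 = (\<Sum>i\<in>I0. c (i mod r) * u (r * q + i mod r) ^ d)"
    using split by (intro sum.cong) (auto simp: t_def I0_def)
  also have "\<dots> = (\<Sum>j\<in>(\<lambda>i. i mod r) ` I0. c j * u (r * q + j) ^ d)"
    by (simp add: sum.reindex[OF inj])
  finally have "4 dvd (\<Sum>j\<in>(\<lambda>i. i mod r) ` I0. c j * u (r * q + j) ^ d)" using dvd by simp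
  moreover have "\<not> 4 dvd (\<Sum>j\<in>(\<lambda>i. i mod r) ` I0. c j * u (r * q + j) ^ d)"
  proof (rule block)
    fix j assume "j \<in> (\<lambda>i. i mod r) ` I0"
    then obtain i where "i \<in> I0" "j = i mod r" by blast
    then show "par (u (r * q + j)) \<noteq> 0" using split ku(2) by (metis (no_types, lifting) I0_def mem_Collect_eq)
  qed (use r i0 in auto)
  ultimately show False by contradiction
qed

lemma four_dvd_O2_of_int: "4 dvd O2 (of_int a) (of_int b) \<longleftrightarrow> 4 dvd a \<and> 4 dvd b"
proof -
  have "(4::z2) dvd of_int k \<longleftrightarrow> 4 dvd k" for k
    using z2_pow2_dvd_iff[of 2 "of_int k"] by (simp add: z2_res_of_int dvd_eq_mod_eq_0)
  then show ?thesis using o2_pow2_dvd_iff[of 2 "O2 (of_int a) (of_int b)"] by simp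
qed

lemma O2_of_int_add: "O2 (of_int a) (of_int b) + O2 (of_int c) (of_int e) = O2 (of_int (a + c)) (of_int (b + e))"
  by (simp add: plus_o2_def)

lemma O2_of_int_mult:
  "O2 (of_int a) (of_int b) * O2 (of_int c) (of_int e)
    = O2 (of_int (a * c + b * e)) (of_int (a * e + b * c + b * e))"
  by (simp add: times_o2_def)

text \<open>A square modulo 4 depends only on the base modulo 2, and 1, phi, 1 + phi represent the
  units. Their squares 1, 1 + phi, 2 + 3 phi are the cube roots of unity modulo 4.\<close>

lemma unit_square_mod_4:
  assumes "par y \<noteq> 0"
  shows "\<exists>a b. (a, b) \<in> {(1, 0), (1, 1), (2, 3)} \<and> 4 dvd y\<^sup>2 - O2 (of_int a) (of_int b)"
proof -
  have *: ?thesis if e: "par y = par e" "e * e = O2 (of_int a) (of_int b)" "(a, b) \<in> {(1, 0), (1, 1), (2, 3)}"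
    for e a b
  proof -
    have "2 dvd y - e" using e(1) by (simp add: par_eq_0_iff [symmetric])
    then obtain t where "y - e = 2 * t" by (rule dvdE)
    then have y: "y = e + 2 * t" by (simp add: algebra_simps)
    have "y\<^sup>2 - O2 (of_int a) (of_int b) = 4 * (e * t + t * t)"
      unfolding e(2) [symmetric] y by (simp add: power2_eq_square algebra_simps)
    then show ?thesis using e(3) by (metis dvd_triv_left)
  qed
  have "O2 1 0 * O2 1 0 = O2 (of_int 1) (of_int 0)" "O2 0 1 * O2 0 1 = O2 (of_int 1) (of_int 1)"
    "O2 1 1 * O2 1 1 = O2 (of_int 2) (of_int 3)"
    by (simp_all add: times_o2_def)
  moreover have "par (O2 1 0) = F1" "par (O2 0 1) = FW" "par (O2 1 1) = FV"
    by (simp_all add: par_def z2_one_odd)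
  ultimately show ?thesis using assms
    *[of "O2 1 0" 1 0] *[of "O2 0 1" 1 1] *[of "O2 1 1" 2 3]
    by (cases "par y") (auto simp: zero_f4_def)
qed

lemma dvd_iff_of_dvd_diff: "(k::o2) dvd x - y \<Longrightarrow> k dvd x \<longleftrightarrow> k dvd y"
  by (metis diff_add_cancel dvd_add_right_iff)

text \<open>Modulo 4 the powers are cube roots of unity. For the sum to be even, they must be two
  equal ones or all three. Two equal ones give a unit times 2. All three would cancel with
  coefficients 1, since 1 + w + w^2 is 0 modulo 4; the coefficient 1 + 2 phi leaves 2 phi times a
  root of unity instead.\<close>

lemma not_four_dvd_three_squares:
  fixes J :: "nat set"
  assumes J: "J \<subseteq> {..<3}" "J \<noteq> {}" and y: "\<And>j. j \<in> J \<Longrightarrow> par (y j) \<noteq> 0"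
  shows "\<not> 4 dvd (\<Sum>j\<in>J. (if j = 2 then O2 1 2 else 1) * y j ^ (2 * m))"
proof -
  \<comment> \<open>\<open>p\<close> holds the coordinates of the j-th power modulo 4, with (0, 0)
    reserved for indices outside J. This reduces the claim to finitely many cases.\<close>
  have "\<exists>p. p \<in> {(0, 0), (1, 0), (1, 1), (2, 3)} \<and> (p = (0, 0) \<longleftrightarrow> j \<notin> J)
      \<and> 4 dvd (if j \<in> J then y j ^ (2 * m) else 0) - O2 (of_int (fst p)) (of_int (snd p))" for j
  proof (cases "j \<in> J")
    case True
    then have "par (y j ^ m) \<noteq> 0" using y by simp
    from unit_square_mod_4[OF this] obtain a b :: int
      where "(a, b) \<in> {(1, 0), (1, 1), (2, 3)}" "4 dvd y j ^ (2 * m) - O2 (of_int a) (of_int b)"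
      by (auto simp: power_mult [symmetric] mult.commute)
    with True show ?thesis by (intro exI[of _ "(a, b)"]) auto
  next
    case False
    then show ?thesis by (intro exI[of _ "(0, 0)"]) (simp add: zero_o2_def [symmetric])
  qed
  then have "\<exists>p. \<forall>j. p j \<in> {(0, 0), (1, 0), (1, 1), (2, 3)} \<and> (p j = (0, 0) \<longleftrightarrow> j \<notin> J)
      \<and> 4 dvd (if j \<in> J then y j ^ (2 * m) else 0) - O2 (of_int (fst (p j))) (of_int (snd (p j)))"
    by (intro choice allI)
  then obtain p where p: "\<And>j. p j \<in> {(0, 0), (1, 0), (1, 1), (2, 3)}"
    "\<And>j. p j = (0, 0) \<longleftrightarrow> j \<notin> J"
    "\<And>j. 4 dvd (if j \<in> J then y j ^ (2 * m) else 0) - O2 (of_int (fst (p j))) (of_int (snd (p j)))"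
    by blast
  define a b where "a j = fst (p j)" and "b j = snd (p j)" for j
  have ab: "(a j, b j) \<in> {(0, 0), (1, 0), (1, 1), (2, 3)}"
    "(a j, b j) = (0, 0) \<longleftrightarrow> j \<notin> J"
    "4 dvd (if j \<in> J then y j ^ (2 * m) else 0) - O2 (of_int (a j)) (of_int (b j))" for j
    using p unfolding a_def b_def by (simp_all only: prod.collapse)
  define z where "z j = (if j \<in> J then y j ^ (2 * m) else 0)" for j
  define w where "w j = O2 (of_int (a j)) (of_int (b j))" for j
  have "(\<Sum>j\<in>J. (if j = 2 then O2 1 2 else 1) * y j ^ (2 * m)) = (\<Sum>j<3. (if j = 2 then O2 1 2 else 1) * z j)"
    using J by (intro sum.mono_neutral_cong_left) (auto simp: z_def)
  also have "\<dots> = z 0 + z 1 + O2 1 2 * z 2" by (simp add: eval_nat_numeral)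
  finally have sum: "(\<Sum>j\<in>J. (if j = 2 then O2 1 2 else 1) * y j ^ (2 * m)) = z 0 + z 1 + O2 1 2 * z 2" .
  have "4 dvd z j - w j" for j using ab(3)[of j] by (simp only: z_def w_def)
  then have "4 dvd (z 0 - w 0) + (z 1 - w 1) + O2 1 2 * (z 2 - w 2)"
    by (intro dvd_add dvd_mult)
  then have "4 dvd (z 0 + z 1 + O2 1 2 * z 2) - (w 0 + w 1 + O2 1 2 * w 2)" by (simp add: algebra_simps)
  then have "4 dvd z 0 + z 1 + O2 1 2 * z 2 \<longleftrightarrow> 4 dvd w 0 + w 1 + O2 1 2 * w 2"
    by (rule dvd_iff_of_dvd_diff)
  also have "w 0 + w 1 + O2 1 2 * w 2
      = O2 (of_int (a 0 + a 1 + (a 2 + 2 * b 2))) (of_int (b 0 + b 1 + (b 2 + 2 * a 2 + 2 * b 2)))"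
    by (simp add: w_def plus_o2_def times_o2_def)
  finally have "4 dvd z 0 + z 1 + O2 1 2 * z 2 \<longleftrightarrow>
      4 dvd a 0 + a 1 + (a 2 + 2 * b 2) \<and> 4 dvd b 0 + b 1 + (b 2 + 2 * a 2 + 2 * b 2)"
    unfolding four_dvd_O2_of_int .
  moreover have "\<not> ((a 0, b 0) = (0, 0) \<and> (a 1, b 1) = (0, 0) \<and> (a 2, b 2) = (0, 0))"
  proof -
    obtain j where "j \<in> J" using J by blast
    moreover from this have "j = 0 \<or> j = 1 \<or> j = 2" using J(1) by auto
    ultimately show ?thesis using ab(2) by metis
  qed
  then have "\<not> (4 dvd a 0 + a 1 + (a 2 + 2 * b 2) \<and> 4 dvd b 0 + b 1 + (b 2 + 2 * a 2 + 2 * b 2))"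
    using ab(1)[of 0] ab(1)[of 1] ab(1)[of 2] by auto
  ultimately show ?thesis unfolding sum by blast
qed

lemma unit_sixth_power_mod_4:
  assumes "par y \<noteq> 0" shows "4 dvd y ^ 6 - 1"
proof -
  obtain a b where ab: "(a, b) \<in> {(1, 0), (1, 1), (2, 3)}" "4 dvd y\<^sup>2 - O2 (of_int a) (of_int b)"
    using unit_square_mod_4[OF assms] by blast
  define w where "w = O2 (of_int a) (of_int b)"
  have "4 dvd (y\<^sup>2) ^ 3 - w ^ 3" using ab(2) dvd_power_diff dvd_trans unfolding w_def by blast
  moreover have "4 dvd w ^ 3 - 1"
  proof -
    have "w ^ 3 - 1 = O2 (of_int a) (of_int b) * O2 (of_int a) (of_int b) * O2 (of_int a) (of_int b)
        + O2 (of_int (-1)) (of_int 0)"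
      by (simp add: w_def power3_eq_cube one_o2_def plus_o2_def minus_o2_def)
    then have "4 dvd w ^ 3 - 1 \<longleftrightarrow>
        4 dvd (a * a + b * b) * a + (a * b + b * a + b * b) * b + - 1 \<and>
        4 dvd (a * a + b * b) * b + (a * b + b * a + b * b) * a + (a * b + b * a + b * b) * b + 0"
      by (simp only: O2_of_int_mult O2_of_int_add four_dvd_O2_of_int)
    then show ?thesis using ab(1) by auto
  qed
  ultimately have "4 dvd ((y\<^sup>2) ^ 3 - w ^ 3) + (w ^ 3 - 1)" by (rule dvd_add)
  then show ?thesis by (simp add: power_mult [symmetric])
qed

text \<open>Sixth powers of units are 1 modulo 4, so the sum is p + q phi, where p and q count the
  indices of J in each half. Both are at most 3 and not both are zero.\<close>

lemma not_four_dvd_six_sixth_powers: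
  fixes J :: "nat set"
  assumes J: "J \<subseteq> {..<6}" "J \<noteq> {}" and y: "\<And>j. j \<in> J \<Longrightarrow> par (y j) \<noteq> 0"
  shows "\<not> 4 dvd (\<Sum>j\<in>J. (if j < 3 then 1 else phi) * y j ^ (6 * k))"
proof -
  let ?c = "\<lambda>j. if j < (3::nat) then 1 else phi"
  have fin: "finite J" using J finite_subset by blast
  have "4 dvd (\<Sum>j\<in>J. ?c j * (y j ^ (6 * k) - 1))"
  proof (intro dvd_sum dvd_mult)
    fix j assume "j \<in> J"
    then have "par (y j ^ k) \<noteq> 0" using y by simp
    from unit_sixth_power_mod_4[OF this] show "4 dvd y j ^ (6 * k) - 1"
      by (simp add: power_mult [symmetric] mult.commute)
  qed
  then have "4 dvd (\<Sum>j\<in>J. ?c j * y j ^ (6 * k)) - sum ?c J"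
    by (simp only: right_diff_distrib sum_subtractf mult_1_right)
  then have "4 dvd (\<Sum>j\<in>J. ?c j * y j ^ (6 * k)) \<longleftrightarrow> 4 dvd sum ?c J"
    by (rule dvd_iff_of_dvd_diff)
  also have "sum ?c J = O2 (of_int (\<Sum>j\<in>J. of_bool (j < 3))) (of_int (\<Sum>j\<in>J. of_bool (\<not> j < 3)))"
  proof -
    have c: "?c j = O2 (of_int (of_bool (j < 3))) (of_int (of_bool (\<not> j < 3)))" for j
      by (cases "j < 3") (simp_all add: one_o2_def)
    have "(\<Sum>j\<in>J. O2 (of_int (f j)) (of_int (g j))) = O2 (of_int (sum f J)) (of_int (sum g J))" for f g
      using fin by (induction J rule: finite_induct) (simp_all add: zero_o2_def plus_o2_def)
    then show ?thesis by (simp only: c)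
  qed
  finally have dvd: "4 dvd (\<Sum>j\<in>J. ?c j * y j ^ (6 * k)) \<longleftrightarrow>
      4 dvd (\<Sum>j\<in>J. of_bool (j < 3) :: int) \<and> 4 dvd (\<Sum>j\<in>J. of_bool (\<not> j < 3) :: int)"
    unfolding four_dvd_O2_of_int .
  have le: "(\<Sum>j\<in>J. of_bool (P j) :: int) \<le> (\<Sum>j<6. of_bool (P j))" for P
    using J(1) by (intro sum_mono2) auto
  have "(\<Sum>j\<in>J. of_bool (j < 3) :: int) \<le> 3" "(\<Sum>j\<in>J. of_bool (\<not> j < 3) :: int) \<le> 3"
    using le[of "\<lambda>j. j < 3"] le[of "\<lambda>j. \<not> j < 3"] by (simp_all add: eval_nat_numeral)
  moreover have "(\<Sum>j\<in>J. of_bool (j < 3) :: int) \<ge> 0" "(\<Sum>j\<in>J. of_bool (\<not> j < 3) :: int) \<ge> 0"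
    by (simp_all add: sum_nonneg)
  moreover have "(\<Sum>j\<in>J. of_bool (j < 3) :: int) + (\<Sum>j\<in>J. of_bool (\<not> j < 3)) = (\<Sum>j\<in>J. 1)"
    unfolding sum.distrib [symmetric] by (intro sum.cong) auto
  moreover have "(\<Sum>j\<in>J. 1 :: int) > 0" using fin J by (simp add: card_gt_0_iff)
  moreover have "\<not> (4 dvd p \<and> 4 dvd q)" if "p \<le> 3" "q \<le> 3" "p \<ge> 0" "q \<ge> 0" "p + q > 0" for p q :: int
    using that by presburger
  ultimately show ?thesis unfolding dvd by (metis (no_types, lifting))
qed

lemma Gamma_star_lower_bound_1:
  assumes "m > 0"
  shows "enat (3 * m + 1) \<le> Gamma_star (2 * m) TYPE(q2_sqrt5)"
  using block_form_no_zero[of m 3 "2 * m" "\<lambda>j. if j = 2 then O2 1 2 else 1"]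
    not_four_dvd_three_squares assms
  by (intro Gamma_star_ge) auto

lemma Gamma_star_lower_bound_2:
  assumes "m > 0" "3 dvd m"
  shows "enat (6 * m + 1) \<le> Gamma_star (2 * m) TYPE(q2_sqrt5)"
proof -
  obtain k where k: "m = 3 * k" using assms by blast
  show ?thesis
    using block_form_no_zero[of m 6 "2 * m" "\<lambda>j. if j < 3 then 1 else phi"]
      not_four_dvd_six_sixth_powers[of _ _ k] assms
    by (intro Gamma_star_ge) (auto simp: k)
qed

section \<open>Solvability modulo 8\<close>

text \<open>A \<open>d\<close>-th power of \<open>1 + 2 \<phi>\<close> is 5 modulo 8, so replacing a variable
  adds \<open>4 v i\<close> to the sum, for any index in use.\<close>

definition solv :: "o2 \<Rightarrow> ('i \<Rightarrow> o2) \<Rightarrow> 'i set \<Rightarrow> bool" where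
  "solv \<theta> v S \<longleftrightarrow> (\<exists>J e J'. J \<subseteq> S \<and> finite J \<and> J' \<subseteq> J \<and> (\<exists>i\<in>J. par (v i) \<noteq> 0) \<and>
     8 dvd (\<Sum>i\<in>J. v i * \<theta> ^ e i) + 4 * (\<Sum>i\<in>J'. v i * \<theta> ^ e i))"

text \<open>(1 + 2 phi)^2 = 5 + 8 phi, and odd powers of 5 are 5 modulo 8.\<close>

lemma power_one_plus_two_phi:
  assumes "odd m" shows "8 dvd (1 + 2 * phi) ^ (2 * m) - 5"
proof -
  obtain k where k: "m = 2 * k + 1" using assms by (rule oddE)
  have sq: "(1 + 2 * phi)\<^sup>2 = 5 + 8 * phi"
  proof -
    have "(1 + 2 * phi)\<^sup>2 = 1 + 4 * phi + 4 * (phi * phi)"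
      by (simp add: power2_eq_square algebra_simps)
    then show ?thesis unfolding phi_square by simp
  qed
  have "8 dvd (5 + 8 * phi) - 5" by (simp only: add_diff_cancel_left' dvd_triv_left)
  then have "8 dvd (5 + 8 * phi) ^ m - 5 ^ m" by (rule dvd_trans[OF _ dvd_power_diff])
  moreover have "(25 :: o2) - 1 = 8 * 3" by simp
  then have "8 dvd (25 :: o2) - 1" by (simp only: dvd_triv_left)
  then have "8 dvd (25 :: o2) ^ k - 1 ^ k" by (rule dvd_trans[OF _ dvd_power_diff])
  then have "8 dvd 5 * ((25 :: o2) ^ k - 1)" by (intro dvd_mult) (simp only: power_one)
  moreover have "5 * ((25 :: o2) ^ k - 1) = 5 ^ m - 5"
  proof -
    have "(5 :: o2) ^ m = 5 * (5\<^sup>2) ^ k" unfolding k power_mult power_add by (simp only: mult.commute power_one_right)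
    moreover have "(5 :: o2)\<^sup>2 = 25" by simp
    ultimately show ?thesis by (simp only: right_diff_distrib mult_1_right)
  qed
  ultimately have "8 dvd ((5 + 8 * phi) ^ m - 5 ^ m) + (5 ^ m - 5)" by (simp only: dvd_add)
  moreover have "((5 + 8 * phi) ^ m - 5 ^ m) + (5 ^ m - 5) = (5 + 8 * phi) ^ m - 5" by simp
  ultimately show ?thesis by (simp only: power_mult sq)
qed

text \<open>The value g^(e i) of a variable, multiplied by 1 + 2 phi for i in J', realises the
  factors \<open>\<theta> ^ e i\<close> and 5. The choice of g is phi or 1, according to the
  case.\<close>

lemma form_zero_of_solv:
  assumes m: "odd m" and S: "finite S" and solv: "solv (g ^ (2 * m)) v S" and g: "par g \<noteq> 0"
  shows "form_zero (2 * m) S v"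
proof -
  obtain J e J' i where J: "J \<subseteq> S" "finite J" "J' \<subseteq> J" "i \<in> J" "par (v i) \<noteq> 0"
    and dvd: "8 dvd (\<Sum>i\<in>J. v i * (g ^ (2 * m)) ^ e i) + 4 * (\<Sum>i\<in>J'. v i * (g ^ (2 * m)) ^ e i)"
    using solv unfolding solv_def by blast
  define w where "w i = v i * (g ^ (2 * m)) ^ e i" for i
  define x where "x i = g ^ e i * (if i \<in> J' then 1 + 2 * phi else 1)" for i
  have x: "x i ^ (2 * m) = (g ^ (2 * m)) ^ e i * (if i \<in> J' then 1 + 2 * phi else 1) ^ (2 * m)" for i
  proof -
    have "(g ^ e i) ^ (2 * m) = (g ^ (2 * m)) ^ e i" by (simp only: power_mult [symmetric] mult.commute)
    then show ?thesis by (simp only: x_def power_mult_distrib)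
  qed
  have summand: "8 dvd v i * x i ^ (2 * m) - (w i + (if i \<in> J' then 4 * w i else 0))" for i
  proof (cases "i \<in> J'")
    case True
    have "w i * (1 + 2 * phi) ^ (2 * m) - (w i + 4 * w i) = w i * ((1 + 2 * phi) ^ (2 * m) - 5)"
      by (simp add: algebra_simps)
    with power_one_plus_two_phi[OF m] True show ?thesis
      by (simp only: x w_def if_True mult.assoc [symmetric]) (simp only: mult.assoc dvd_mult)
  next
    case False
    then show ?thesis by (simp add: x w_def)
  qed
  have "8 dvd (\<Sum>i\<in>J. v i * x i ^ (2 * m) - (w i + (if i \<in> J' then 4 * w i else 0)))"
    using summand by (rule dvd_sum)
  moreover have "(\<Sum>i\<in>J. if i \<in> J' then 4 * w i else 0) = 4 * (\<Sum>i\<in>J'. w i)"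
    using J by (simp add: sum_distrib_left sum.If_cases Int_absorb1)
  ultimately have "8 dvd (\<Sum>i\<in>J. v i * x i ^ (2 * m)) - (sum w J + 4 * sum w J')"
    by (simp only: sum_subtractf sum.distrib)
  moreover have "8 dvd sum w J + 4 * sum w J'" using dvd by (simp only: w_def [abs_def])
  ultimately have "8 dvd (\<Sum>i\<in>J. v i * x i ^ (2 * m))" by (metis diff_add_cancel dvd_add)
  moreover have "par (x i) \<noteq> 0" using g by (simp add: x_def)
  ultimately have "form_zero (2 * m) J v"
    using form_zero_hensel[of m J i v x] m J(2,4,5) by blast
  moreover have "2 * m > 0" using m by (cases m) auto
  ultimately show ?thesis using form_zero_mono J(1) S by blast
qed

text \<open>Setting the variables below level b to zero and dividing by 2^b lets level b play the
  role of level 0.\<close>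

lemma form_zero_of_solv_at_level:
  assumes m: "odd m" and S: "finite S" and g: "par g \<noteq> 0"
    and solv: "solv (g ^ (2 * m)) (\<lambda>i. 2 ^ (l i - b) * u i) {i\<in>S. b \<le> l i}"
  shows "form_zero (2 * m) S (\<lambda>i. 2 ^ l i * u i)"
proof -
  have "form_zero (2 * m) {i\<in>S. b \<le> l i} (\<lambda>i. 2 ^ (l i - b) * u i)"
    using S by (intro form_zero_of_solv[OF m _ solv g]) simp
  then have "form_zero (2 * m) {i\<in>S. b \<le> l i} (\<lambda>i. 2 ^ l i * u i)"
  proof (rule form_zero_scale[where k = "2 ^ b"])
    fix i assume "i \<in> {i\<in>S. b \<le> l i}"
    then have "(2 :: o2) ^ b * 2 ^ (l i - b) = 2 ^ l i" by (simp only: power_add [symmetric]) simp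
    then show "2 ^ l i * u i = 2 ^ b * (2 ^ (l i - b) * u i)" by (simp only: mult.assoc [symmetric])
  qed
  moreover have "2 * m > 0" using m by (cases m) auto
  ultimately show ?thesis using S form_zero_mono by (metis (no_types, lifting) mem_Collect_eq subsetI)
qed

text \<open>Signs disappear modulo 2, so 4 y and the correction over J' cancel modulo 8 once their
  quarters have the same residue.\<close>

lemma solvI:
  assumes "J \<subseteq> S" "finite J" "J' \<subseteq> J" "i \<in> J" "par (v i) \<noteq> 0"
    and "(\<Sum>i\<in>J. v i * \<theta> ^ e i) = 4 * y" "par y = par (\<Sum>i\<in>J'. v i * \<theta> ^ e i)"
  shows "solv \<theta> v S"
proof -
  have "2 dvd y + (\<Sum>i\<in>J'. v i * \<theta> ^ e i)"
    using assms(7) by (simp only: par_eq_0_iff [symmetric] par_add f4_double)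
  then obtain t where t: "y + (\<Sum>i\<in>J'. v i * \<theta> ^ e i) = 2 * t" by (rule dvdE)
  have "(\<Sum>i\<in>J. v i * \<theta> ^ e i) + 4 * (\<Sum>i\<in>J'. v i * \<theta> ^ e i) = 4 * (2 * t)"
    unfolding assms(6) t [symmetric] by (simp add: distrib_left)
  then have "8 dvd (\<Sum>i\<in>J. v i * \<theta> ^ e i) + 4 * (\<Sum>i\<in>J'. v i * \<theta> ^ e i)" by simp
  with assms(1-5) show ?thesis unfolding solv_def by blast
qed

lemma distinct_elements:
  assumes "n \<le> card A" shows "\<exists>xs. length xs = n \<and> distinct xs \<and> set xs \<subseteq> A"
proof -
  obtain B where B: "B \<subseteq> A" "card B = n" "finite B"
    using obtain_subset_with_card_n[OF assms] by metis
  obtain xs where "set xs = B" "distinct xs" using finite_distinct_list[OF B(3)] by blast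
  then show ?thesis using B distinct_card[of xs] by metis
qed

lemma two_elements: "2 \<le> card A \<Longrightarrow> \<exists>a b. {a, b} \<subseteq> A \<and> distinct [a, b]"
  by (drule distinct_elements) (auto simp: eval_nat_numeral length_Suc_conv; blast)

lemma three_elements: "3 \<le> card A \<Longrightarrow> \<exists>a b c. {a, b, c} \<subseteq> A \<and> distinct [a, b, c]"
  by (drule distinct_elements) (auto simp: eval_nat_numeral length_Suc_conv; blast)

lemma four_elements: "4 \<le> card A \<Longrightarrow> \<exists>a b c e. {a, b, c, e} \<subseteq> A \<and> distinct [a, b, c, e]"
  by (drule distinct_elements) (auto simp: eval_nat_numeral length_Suc_conv; blast)

lemma five_elements: "5 \<le> card A \<Longrightarrow> \<exists>a b c e f. {a, b, c, e, f} \<subseteq> A \<and> distinct [a, b, c, e, f]"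
  by (drule distinct_elements) (auto simp: eval_nat_numeral length_Suc_conv; blast)

section \<open>The case \<open>3 \<nmid> d\<close>\<close>

text \<open>Such a t is a primitive cube root of unity and generates the multiplicative group of
  F_4.\<close>

lemma f4_orbit:
  assumes "t \<notin> {0, 1}" "p \<noteq> 0" "q \<noteq> (0::f4)"
  shows "\<exists>k. p * t ^ k = q"
proof -
  have "p * t ^ 0 = q \<or> p * t ^ 1 = q \<or> p * t ^ 2 = q"
    using assms by (cases t; cases p; cases q) (auto simp: zero_f4_def one_f4_def power2_eq_square)
  then show ?thesis by blast
qed

text \<open>These are the triples for which x + y t + z t^2 vanishes in some order of x, y, z, where
  t is a primitive cube root of unity.\<close>

definition f4_line :: "f4 \<Rightarrow> f4 \<Rightarrow> f4 \<Rightarrow> bool" where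
  "f4_line x y z \<longleftrightarrow> x = y \<and> y = z \<or> x \<noteq> y \<and> y \<noteq> z \<and> x \<noteq> z"

text \<open>To be instantiated with phi^d for 3 not dividing d, a d-th power of a unit that is a
  primitive cube root of unity modulo 4.\<close>

locale cube_root =
  fixes \<theta> :: o2
  assumes four_dvd: "4 dvd 1 + \<theta> + \<theta>\<^sup>2" and par_theta: "par \<theta> \<notin> {0, 1}"
begin

text \<open>In these names A, B, C stand for coefficients of levels 0, 1, 2, and a digit for their
  number. A spare coefficient 4 c, times a suitable power of \<open>\<theta>\<close>, absorbs any
  odd y, so a sum divisible by 4 with a unit suffices.\<close>

lemma solv_with_C:
  assumes J: "J \<subseteq> S" "finite J" "i \<in> J" "par (v i) \<noteq> 0" and sum: "(\<Sum>i\<in>J. v i * \<theta> ^ e i) = 4 * y"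
    and k: "k \<in> S - J" "v k = 4 * c" "par c \<noteq> 0"
  shows "solv \<theta> v S"
proof (cases "par y = 0")
  case True
  then show ?thesis using J sum by (intro solvI[of J S "{}" i v \<theta> e y]) auto
next
  case False
  then obtain n where n: "par c * par \<theta> ^ n = par y" using f4_orbit[OF par_theta k(3)] by blast
  have "(\<Sum>i\<in>insert k J. v i * \<theta> ^ (e(k := n)) i) = v k * \<theta> ^ n + (\<Sum>i\<in>J. v i * \<theta> ^ (e(k := n)) i)"
    using J k by simp
  also have "(\<Sum>i\<in>J. v i * \<theta> ^ (e(k := n)) i) = 4 * y"
    unfolding sum [symmetric] using k by (intro sum.cong) auto
  finally have "(\<Sum>i\<in>insert k J. v i * \<theta> ^ (e(k := n)) i) = 4 * (c * \<theta> ^ n + y)"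
    by (simp add: k distrib_left mult.assoc)
  then show ?thesis
    using J k n by (intro solvI[of "insert k J" S "{}" i v \<theta> "e(k := n)" "c * \<theta> ^ n + y"]) auto
qed

lemma par_theta_cases: "par \<theta> = FW \<or> par \<theta> = FV"
  using par_theta by (cases "par \<theta>") (auto simp: zero_f4_def one_f4_def)

text \<open>The leading parts contribute 1 + \<theta> + \<theta>^2, which vanishes modulo 4, so half
  of the sum is determined modulo 2 by x, y, z.\<close>

lemma three_units:
  assumes "a = 1 + 2 * x" "b = 1 + 2 * y" "c = 1 + 2 * z"
  shows "\<exists>q. a + b * \<theta> + c * \<theta>\<^sup>2 = 2 * q \<and> par q = par x + par y * par \<theta> + par z * par \<theta> ^ 2"
proof -
  obtain r where r: "1 + \<theta> + \<theta>\<^sup>2 = 4 * r" using four_dvd by (rule dvdE)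
  have "a + b * \<theta> + c * \<theta>\<^sup>2 = (1 + \<theta> + \<theta>\<^sup>2) + 2 * (x + y * \<theta> + z * \<theta>\<^sup>2)"
    by (simp add: assms algebra_simps)
  also have "\<dots> = 2 * (2 * r + (x + y * \<theta> + z * \<theta>\<^sup>2))" unfolding r by (simp add: algebra_simps)
  finally show ?thesis by (intro exI conjI) (assumption, simp)
qed

text \<open>If units occur with all three cube roots of unity, every residue of y is 0 or that of
  one summand, and divisibility by 4 suffices.\<close>

lemma solv_three:
  assumes ijk: "i \<in> J" "j \<in> J" "k \<in> J" "distinct [i, j, k]" and J: "J \<subseteq> S" "finite J"
    and unit: "par (v i) = 1" "par (v j) = 1" "par (v k) = 1"
    and e: "e i = 0" "e j = 1" "e k = 2" and sum: "(\<Sum>i\<in>J. v i * \<theta> ^ e i) = 4 * y"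
  shows "solv \<theta> v S"
proof -
  have *: "par y = par (\<Sum>i\<in>J'. v i * \<theta> ^ e i) \<Longrightarrow> J' \<subseteq> J \<Longrightarrow> solv \<theta> v S" for J'
    using J ijk unit sum by (intro solvI[of J S J' i v \<theta> e y]) auto
  have "par y = 0 \<or> par y = 1 \<or> par y = par \<theta> \<or> par y = par \<theta> ^ 2"
    using par_theta_cases by (cases "par y") (auto simp: zero_f4_def one_f4_def power2_eq_square)
  then show ?thesis
    using *[of "{}"] *[of "{i}"] *[of "{j}"] *[of "{k}"] ijk unit e by auto
qed

lemma solv_A3:
  assumes ijk: "i \<in> S" "j \<in> S" "k \<in> S" "distinct [i, j, k]"
    and v: "v i = 1 + 2 * x" "v j = 1 + 2 * y" "v k = 1 + 2 * z"
    and zero: "par x + par y * par \<theta> + par z * par \<theta> ^ 2 = 0"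
  shows "solv \<theta> v S"
proof -
  obtain q where q: "v i + v j * \<theta> + v k * \<theta>\<^sup>2 = 2 * q" "par q = 0"
    using three_units[OF v] zero by auto
  then obtain r where r: "q = 2 * r" by (auto simp: par_eq_0_iff)
  define e where "e = (\<lambda>_. 0 :: nat)(j := 1, k := 2)"
  have "(\<Sum>i\<in>{i, j, k}. v i * \<theta> ^ e i) = v i + v j * \<theta> + v k * \<theta>\<^sup>2"
    using ijk by (auto simp: e_def add.assoc)
  then have "(\<Sum>i\<in>{i, j, k}. v i * \<theta> ^ e i) = 4 * r" using q r by simp
  then show ?thesis
    using ijk by (intro solv_three[of i "{i, j, k}" j k S v e r]) (auto simp: e_def v)
qed

text \<open>If half of the sum of three units is odd, the level-one coefficient, times the right
  power of \<open>\<theta>\<close>, makes it even.\<close>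

lemma solv_A3_B:
  assumes ijk: "i \<in> S" "j \<in> S" "k \<in> S" "b \<in> S" "distinct [i, j, k, b]"
    and v: "v i = 1 + 2 * x" "v j = 1 + 2 * y" "v k = 1 + 2 * z" and b: "v b = 2 * c" "par c \<noteq> 0"
  shows "solv \<theta> v S"
proof -
  obtain q where q: "v i + v j * \<theta> + v k * \<theta>\<^sup>2 = 2 * q"
    and pq: "par q = par x + par y * par \<theta> + par z * par \<theta> ^ 2"
    using three_units[OF v] by auto
  show ?thesis
  proof (cases "par q = 0")
    case True
    then show ?thesis using solv_A3[of i S j k v x y z] ijk v pq by simp
  next
    case False
    then obtain n where n: "par c * par \<theta> ^ n = par q" using f4_orbit[OF par_theta b(2)] by blast
    then have "par (q + c * \<theta> ^ n) = 0" by simp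
    then obtain r where r: "q + c * \<theta> ^ n = 2 * r" unfolding par_eq_0_iff by (rule dvdE)
    define e where "e = (\<lambda>_. 0 :: nat)(j := 1, k := 2, b := n)"
    have "(\<Sum>i\<in>{i, j, k, b}. v i * \<theta> ^ e i) = (v i + v j * \<theta> + v k * \<theta>\<^sup>2) + v b * \<theta> ^ n"
      using ijk by (auto simp: e_def add.assoc)
    also have "\<dots> = 2 * (q + c * \<theta> ^ n)" unfolding q b by (simp add: algebra_simps)
    finally have "(\<Sum>i\<in>{i, j, k, b}. v i * \<theta> ^ e i) = 4 * r" using r by simp
    then show ?thesis
      using ijk by (intro solv_three[of i "{i, j, k, b}" j k S v e r]) (auto simp: e_def v)
  qed
qed

lemma solv_A2_B_C:
  assumes ijk: "i \<in> S" "j \<in> S" "b \<in> S" "k \<in> S" "distinct [i, j, b, k]"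
    and v: "v i = 1 + 2 * x" "v j = 1 + 2 * y" and b: "v b = 2 * c" "par c \<noteq> 0"
    and k: "v k = 4 * t" "par t \<noteq> 0"
  shows "solv \<theta> v S"
proof -
  define q where "q = 1 + x + y"
  have q: "v i + v j = 2 * q" by (simp add: v q_def algebra_simps)
  show ?thesis
  proof (cases "par q = 0")
    case True
    then obtain r where r: "q = 2 * r" by (auto simp: par_eq_0_iff)
    show ?thesis using ijk q r k
      by (intro solv_with_C[of "{i, j}" S i v "\<lambda>_. 0" r k t]) (auto simp: v(1))
  next
    case False
    then obtain n where n: "par c * par \<theta> ^ n = par q" using f4_orbit[OF par_theta b(2)] by blast
    then have "par (q + c * \<theta> ^ n) = 0" by simp
    then obtain r where r: "q + c * \<theta> ^ n = 2 * r" unfolding par_eq_0_iff by (rule dvdE)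
    define e where "e = (\<lambda>_. 0 :: nat)(b := n)"
    have "(\<Sum>i\<in>{i, j, b}. v i * \<theta> ^ e i) = (v i + v j) + v b * \<theta> ^ n"
      using ijk by (auto simp: e_def add.assoc)
    also have "\<dots> = 2 * (q + c * \<theta> ^ n)" unfolding q b by (simp add: algebra_simps)
    finally have "(\<Sum>i\<in>{i, j, b}. v i * \<theta> ^ e i) = 4 * r" using r by simp
    then show ?thesis using ijk k
      by (intro solv_with_C[of "{i, j, b}" S i v e r k t]) (auto simp: v(1))
  qed
qed

lemma f4_triple:
  assumes "f4_line x y z"
  shows "x + y * par \<theta> + z * par \<theta> ^ 2 = 0 \<or> x + z * par \<theta> + y * par \<theta> ^ 2 = 0"
  using par_theta_cases assms unfolding f4_line_def
  by (cases x; cases y; cases z) (auto simp: zero_f4_def power2_eq_square)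

lemma solv_A3':
  assumes ijk: "i \<in> S" "j \<in> S" "k \<in> S" "distinct [i, j, k]"
    and v: "v i = 1 + 2 * x" "v j = 1 + 2 * y" "v k = 1 + 2 * z"
    and "f4_line (par x) (par y) (par z)"
  shows "solv \<theta> v S"
  using f4_triple[OF assms(8)] solv_A3[of i S j k v x y z] solv_A3[of i S k j v x z y] assms by auto

text \<open>Five values are either three distinct ones or at most two, one of which then occurs
  three times.\<close>

lemma f4_five:
  fixes a b c d e :: f4
  shows "f4_line a b c \<or> f4_line a b d \<or> f4_line a b e \<or> f4_line a c d \<or> f4_line a c e \<or> f4_line a d e \<or> f4_line b c d \<or> f4_line b c e \<or> f4_line b d e \<or> f4_line c d e"
  unfolding f4_line_def by (cases a; cases b; cases c; cases d; cases e; simp)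

text \<open>Four values without a line are two values, each taken twice, and then the sum is
  zero.\<close>

lemma f4_four:
  fixes a b c d :: f4
  shows "f4_line a b c \<or> f4_line a b d \<or> f4_line a c d \<or> f4_line b c d \<or> a + b + c + d = 0"
  unfolding f4_line_def by (cases a; cases b; cases c; cases d; simp add: zero_f4_def)

lemma solv_A5:
  assumes A: "A \<subseteq> S" "card A \<ge> 5" and v: "\<And>i. i \<in> A \<Longrightarrow> v i = 1 + 2 * x i"
  shows "solv \<theta> v S"
proof -
  obtain a b c d e where *: "{a, b, c, d, e} \<subseteq> A" "distinct [a, b, c, d, e]"
    using five_elements[OF A(2)] by blast
  have 1: "solv \<theta> v S" if "i \<in> A" "j \<in> A" "k \<in> A" "distinct [i, j, k]"
    "f4_line (par (x i)) (par (x j)) (par (x k))" for i j k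
    using that A(1) v by (intro solv_A3'[of i S j k v "x i" "x j" "x k"]) auto
  have "a \<in> A" "b \<in> A" "c \<in> A" "d \<in> A" "e \<in> A" "distinct [a, b, c, d, e]" using * by auto
  then show ?thesis
    using f4_five[of "par (x a)" "par (x b)" "par (x c)" "par (x d)" "par (x e)"]
    by (elim disjE) (erule 1[rotated 4]; simp)+
qed

lemma solv_A4_C:
  assumes A: "A \<subseteq> S" "card A \<ge> 4" and v: "\<And>i. i \<in> A \<Longrightarrow> v i = 1 + 2 * x i"
    and k: "k \<in> S - A" "v k = 4 * t" "par t \<noteq> 0"
  shows "solv \<theta> v S"
proof -
  obtain a b c d where *: "{a, b, c, d} \<subseteq> A" "distinct [a, b, c, d]"
    using four_elements[OF A(2)] by blast
  have 1: "solv \<theta> v S" if "i \<in> A" "j \<in> A" "k \<in> A" "distinct [i, j, k]"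
    "f4_line (par (x i)) (par (x j)) (par (x k))" for i j k
    using that A(1) v by (intro solv_A3'[of i S j k v "x i" "x j" "x k"]) auto
  have 2: "solv \<theta> v S" if "par (x a) + par (x b) + par (x c) + par (x d) = 0"
  proof -
    have "par (x a + x b + x c + x d) = 0" using that by simp
    then obtain r where r: "x a + x b + x c + x d = 2 * r" unfolding par_eq_0_iff by (rule dvdE)
    have "v a + v b + v c + v d = 4 + 2 * (x a + x b + x c + x d)"
      using * v by (simp add: algebra_simps)
    then have "v a + v b + v c + v d = 4 * (1 + r)" unfolding r by simp
    moreover have "(\<Sum>i\<in>{a, b, c, d}. v i * \<theta> ^ 0) = v a + v b + v c + v d"
      using * by (simp add: add.assoc)
    moreover have "par (v a) = 1" using v * by simp
    ultimately show ?thesis using * A k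
      by (intro solv_with_C[of "{a, b, c, d}" S a v "\<lambda>_. 0" "1 + r" k t]) auto
  qed
  have "a \<in> A" "b \<in> A" "c \<in> A" "d \<in> A" "distinct [a, b, c, d]" using * by auto
  then show ?thesis
    using f4_four[of "par (x a)" "par (x b)" "par (x c)" "par (x d)"]
    by (elim disjE) ((erule 1[rotated 4] | erule 2); simp)+
qed

lemma f4_two_three_aux:
  fixes t q a c s :: f4
  assumes "t \<noteq> 0" "s = FW \<or> s = FV" "a \<noteq> c"
  defines "P \<equiv> \<lambda>x :: f4. x = 0 \<or> x = 1"
  shows "P (t + q + a * t) \<or> P (t + q + c * t) \<or> P (q + a * (t * s) + a * (t * s\<^sup>2))
    \<or> P (q + a * (t * s) + c * (t * s\<^sup>2)) \<or> P (q + c * (t * s) + a * (t * s\<^sup>2))"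
  using assms(2) unfolding P_def power2_eq_square
  by (elim disjE; use assms(1,3) in \<open>cases t; cases a; cases c; cases q; simp add: zero_f4_def one_f4_def\<close>)

text \<open>The expressions are the residues of the quarters of the sums tried in
  \<open>solv_A2_B3\<close>: t belongs to the power of \<open>\<theta>\<close> congruent to the
  half-sum of the two units, s to \<open>\<theta>\<close>, and a, b, c to the level-one
  coefficients. The values 0 and 1 are good since a unit of residue 1 takes part. Without a line
  exactly two of a, b, c agree, which leaves the finite check of the auxiliary lemma.\<close>

lemma f4_two_three:
  fixes t q a b c s :: f4
  assumes "t \<noteq> 0" "s = FW \<or> s = FV"
    and "\<not> f4_line a b c"
  defines "P \<equiv> \<lambda>x :: f4. x = 0 \<or> x = 1"
  shows "P (t + q + a * t) \<or> P (t + q + b * t) \<or> P (t + q + c * t)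
    \<or> P (q + a * (t * s) + b * (t * s\<^sup>2)) \<or> P (q + b * (t * s) + a * (t * s\<^sup>2))
    \<or> P (q + a * (t * s) + c * (t * s\<^sup>2)) \<or> P (q + c * (t * s) + a * (t * s\<^sup>2))
    \<or> P (q + b * (t * s) + c * (t * s\<^sup>2)) \<or> P (q + c * (t * s) + b * (t * s\<^sup>2))"
proof -
  consider "a = b" "b \<noteq> c" | "b = c" "a \<noteq> b" | "a = c" "a \<noteq> b" using assms(3) by (auto simp: f4_line_def)
  then show ?thesis
  proof cases
    case 1
    then show ?thesis using f4_two_three_aux[OF assms(1,2), of a c q] unfolding P_def by blast
  next
    case 2
    then show ?thesis using f4_two_three_aux[OF assms(1,2), of b a q] unfolding P_def by blast
  next
    case 3
    then show ?thesis using f4_two_three_aux[OF assms(1,2), of a b q] unfolding P_def by blast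
  qed
qed

end

context cube_root begin

text \<open>Two units sum to 2 p. An even p needs at most a correction by a multiple of 4, and an
  odd p has to be completed by one or two level-one coefficients.\<close>

lemma solv_A2_B3:
  assumes ij: "i \<in> S" "j \<in> S" "{a, b, c} \<subseteq> S" "distinct [i, j, a, b, c]"
    and v: "v i = 1 + 2 * x" "v j = 1 + 2 * y"
    and w: "v a = 2 * (1 + 2 * w a)" "v b = 2 * (1 + 2 * w b)" "v c = 2 * (1 + 2 * w c)"
    and not_level_1: "\<not> f4_line (par (w a)) (par (w b)) (par (w c))"
  shows "solv \<theta> v S"
proof -
  define p where "p = 1 + x + y"
  have p: "v i + v j = 2 * p" by (simp add: v p_def algebra_simps)
  show ?thesis
  proof (cases "par p = 0")
    case True
    then obtain p' where p': "p = 2 * p'" by (auto simp: par_eq_0_iff)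
    \<comment> \<open>With equal powers of \<open>\<theta>\<close>, two level-one coefficients add
      up to 4 (1 + w f + w g) times that power and act like one coefficient of level 2.\<close>
    have pair: "solv \<theta> v S" if B: "f \<in> {a, b, c}" "g \<in> {a, b, c}" "f \<noteq> g" "par (1 + w f + w g) \<noteq> 0" for f g
    proof (cases "par p' = 0")
      case True
      then show ?thesis using ij p p' v
        by (intro solvI[of "{i, j}" S "{}" i v \<theta> "\<lambda>_. 0" p']) auto
    next
      case False
      then obtain n where n: "par (1 + w f + w g) * par \<theta> ^ n = par p'"
        using f4_orbit[OF par_theta B(4)] by blast
      define e where "e = (\<lambda>_. 0 :: nat)(f := n, g := n)"
      have d: "distinct [i, j, f, g]" using ij B by auto
      have fg: "v f = 2 * (1 + 2 * w f)" "v g = 2 * (1 + 2 * w g)" using B w by auto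
      have "(\<Sum>i\<in>{i, j, f, g}. v i * \<theta> ^ e i) = (v i + v j) + (v f + v g) * \<theta> ^ n"
        using d by (auto simp: e_def add.assoc algebra_simps)
      also have "\<dots> = 4 * (p' + (1 + w f + w g) * \<theta> ^ n)"
        unfolding p p' fg by (simp add: algebra_simps)
      finally have sum: "(\<Sum>i\<in>{i, j, f, g}. v i * \<theta> ^ e i) = 4 * (p' + (1 + w f + w g) * \<theta> ^ n)" .
      have "par (p' + (1 + w f + w g) * \<theta> ^ n) = par (\<Sum>i\<in>{}. v i * \<theta> ^ e i)"
        using n unfolding par_add[of p'] par_mult[of "1 + w f + w g"] par_power by simp
      from solvI[OF _ _ _ _ _ sum this, of S i] show ?thesis using ij B v by auto
    qed
    \<comment> \<open>The three expressions add up to 1, so they do not all vanish.\<close>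
    have "1 + par (w a) + par (w b) \<noteq> 0 \<or> 1 + par (w a) + par (w c) \<noteq> 0 \<or> 1 + par (w b) + par (w c) \<noteq> 0"
      by (cases "par (w a)"; cases "par (w b)"; cases "par (w c)") (simp_all add: zero_f4_def one_f4_def)
    then show ?thesis using pair[of a b] pair[of a c] pair[of b c] ij by auto
  next
    case False
    \<comment> \<open>The half-sum p becomes \<theta>^n + 2 q. Then 2 p is completed to a multiple
      of 4 in two ways: by one level-one coefficient with the same root (\<open>one\<close>), or by
      two with the other two cube roots (\<open>two\<close>).\<close>
    then obtain n where n: "par \<theta> ^ n = par p" using f4_orbit[OF par_theta, of 1 "par p"] by auto
    then have "par (p - \<theta> ^ n) = 0" by simp
    then obtain q where "p - \<theta> ^ n = 2 * q" unfolding par_eq_0_iff by (rule dvdE)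
    then have q: "p = \<theta> ^ n + 2 * q" by (simp add: algebra_simps)
    obtain r where r: "1 + \<theta> + \<theta>\<^sup>2 = 4 * r" using four_dvd by (rule dvdE)
    have one: "solv \<theta> v S" if f: "f \<in> {a, b, c}"
      "par \<theta> ^ n + par q + par (w f) * par \<theta> ^ n = 0 \<or> par \<theta> ^ n + par q + par (w f) * par \<theta> ^ n = 1" for f
    proof -
      define e where "e = (\<lambda>_. 0 :: nat)(f := n)"
      have d: "distinct [i, j, f]" using ij f by auto
      have fg: "v f = 2 * (1 + 2 * w f)" using f w by auto
      have "(\<Sum>i\<in>{i, j, f}. v i * \<theta> ^ e i) = (v i + v j) + v f * \<theta> ^ n"
        using d by (auto simp: e_def add.assoc)
      also have "\<dots> = 4 * (\<theta> ^ n + q + w f * \<theta> ^ n)"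
        unfolding p q fg by (simp add: algebra_simps)
      finally have sum: "(\<Sum>i\<in>{i, j, f}. v i * \<theta> ^ e i) = 4 * (\<theta> ^ n + q + w f * \<theta> ^ n)" .
      have "par (v i * \<theta> ^ e i) = 1" using d v by (simp add: e_def)
      then show ?thesis using ij f v
          solvI[of "{i, j, f}" S "{}" i v \<theta> e, OF _ _ _ _ _ sum]
          solvI[of "{i, j, f}" S "{i}" i v \<theta> e, OF _ _ _ _ _ sum] by auto
    qed
    have two: "solv \<theta> v S" if f: "f \<in> {a, b, c}" "g \<in> {a, b, c}" "f \<noteq> g"
      "par q + par (w f) * (par \<theta> ^ n * par \<theta>) + par (w g) * (par \<theta> ^ n * par \<theta> ^ 2) = 0 \<or>
       par q + par (w f) * (par \<theta> ^ n * par \<theta>) + par (w g) * (par \<theta> ^ n * par \<theta> ^ 2) = 1" for f g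
    proof -
      define e where "e = (\<lambda>_. 0 :: nat)(f := n + 1, g := n + 2)"
      have d: "distinct [i, j, f, g]" using ij f by auto
      have fg: "v f = 2 * (1 + 2 * w f)" "v g = 2 * (1 + 2 * w g)" using f w by auto
      have "(\<Sum>i\<in>{i, j, f, g}. v i * \<theta> ^ e i) = (v i + v j) + (v f * (\<theta> ^ n * \<theta>) + v g * (\<theta> ^ n * \<theta>\<^sup>2))"
        using d by (auto simp: e_def add.assoc power_add power2_eq_square mult_ac)
      also have "\<dots> = 2 * \<theta> ^ n * (1 + \<theta> + \<theta>\<^sup>2) + 4 * (q + w f * (\<theta> ^ n * \<theta>) + w g * (\<theta> ^ n * \<theta>\<^sup>2))"
        unfolding p q fg by (simp add: algebra_simps)
      also have "\<dots> = 4 * (2 * \<theta> ^ n * r + (q + w f * (\<theta> ^ n * \<theta>) + w g * (\<theta> ^ n * \<theta>\<^sup>2)))"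
        unfolding r by (simp add: algebra_simps)
      finally have sum: "(\<Sum>i\<in>{i, j, f, g}. v i * \<theta> ^ e i)
        = 4 * (2 * \<theta> ^ n * r + (q + w f * (\<theta> ^ n * \<theta>) + w g * (\<theta> ^ n * \<theta>\<^sup>2)))" .
      have "par (v i * \<theta> ^ e i) = 1" using d v by (simp add: e_def)
      then show ?thesis using ij f v
          solvI[of "{i, j, f, g}" S "{}" i v \<theta> e, OF _ _ _ _ _ sum]
          solvI[of "{i, j, f, g}" S "{i}" i v \<theta> e, OF _ _ _ _ _ sum] by auto
    qed
    have "par \<theta> ^ n \<noteq> 0" using n False by simp
    from f4_two_three[OF this par_theta_cases not_level_1, of "par q"]
    show ?thesis using one[of a] one[of b] one[of c] two[of a b] two[of b a] two[of a c] two[of c a]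
        two[of b c] two[of c b] ij by auto
  qed
qed

end

lemma unit_dvd_cancel:
  assumes "4 dvd a * b" "par a \<noteq> 0"
  shows "4 dvd (b :: o2)"
proof -
  have even: "2 dvd y" if "2 dvd a * y" for y
    using that assms(2) unfolding par_eq_0_iff [symmetric] by simp
  have "2 dvd a * b" using assms(1) by (rule dvd_trans[rotated]) (rule dvdI[of _ _ 2], simp)
  then obtain c where c: "b = 2 * c" using even by blast
  obtain e where "a * b = 4 * e" using assms(1) by (rule dvdE)
  then have "2 * (a * c) = 2 * (2 * e)" by (simp add: c mult.left_commute)
  then have "a * c = 2 * e" by (simp only: o2_two_cancel)
  then have "2 dvd c" using even by simp
  then show ?thesis by (auto simp: c)
qed

text \<open>The counts 2, 4, 5 are the least integers above 3 t / 2 for t = 1, 2, 3. They force one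
  of the configurations A5, A4 C, A3 B, A2 B C, A2 B3.\<close>

lemma form_zero_not_3_dvd:
  assumes m: "odd m" and I: "finite I"
    and u: "\<And>i. i \<in> I \<Longrightarrow> par (u i) = 1"
    and count: "card {i\<in>I. l i < 1} \<ge> 2" "card {i\<in>I. l i < 2} \<ge> 4" "card {i\<in>I. l i < 3} \<ge> 5"
    and cube: "cube_root (phi ^ (2 * m))"
  shows "form_zero (2 * m) I (\<lambda>i. 2 ^ l i * u i)"
proof -
  interpret cube_root "phi ^ (2 * m)" by (rule cube)
  let ?\<theta> = "phi ^ (2 * m)"
  have phi: "par phi \<noteq> 0" by (simp add: zero_f4_def)
  have level: "solv ?\<theta> (\<lambda>i. 2 ^ (l i - b) * u i) {i\<in>I. b \<le> l i}
      \<Longrightarrow> form_zero (2 * m) I (\<lambda>i. 2 ^ l i * u i)" for b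
    by (rule form_zero_of_solv_at_level[OF m I phi])
  define v where "v i = 2 ^ l i * u i" for i
  have level0: "solv ?\<theta> v I \<Longrightarrow> form_zero (2 * m) I (\<lambda>i. 2 ^ l i * u i)"
    using level[of 0] by (simp add: v_def [abs_def])
  have "\<exists>x. u i = 1 + 2 * x" if "i \<in> I" for i
  proof -
    have "par (u i - 1) = 0" using u[OF that] by simp
    then obtain x where "u i - 1 = 2 * x" unfolding par_eq_0_iff by (rule dvdE)
    then show ?thesis by (intro exI[of _ x]) (simp add: algebra_simps)
  qed
  then obtain w where w: "\<And>i. i \<in> I \<Longrightarrow> u i = 1 + 2 * w i" by metis
  define A B C where "A = {i\<in>I. l i = 0}" and "B = {i\<in>I. l i = 1}" and "C = {i\<in>I. l i = 2}"
  have A: "v i = 1 + 2 * w i" "i \<in> I" "i \<notin> B" "i \<notin> C" if "i \<in> A" for i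
    using that w by (auto simp: v_def A_def B_def C_def)
  have B: "v i = 2 * (1 + 2 * w i)" "i \<in> I" "i \<notin> C" if "i \<in> B" for i
    using that w by (auto simp: v_def B_def C_def)
  have C: "v i = 4 * u i" "par (u i) \<noteq> 0" "i \<in> I" if "i \<in> C" for i
    using that u by (auto simp: v_def C_def)
  have fin: "finite A" "finite B" "finite C" using I by (simp_all add: A_def B_def C_def)
  have "{i\<in>I. l i < 1} = A" "{i\<in>I. l i < 2} = A \<union> B" "{i\<in>I. l i < 3} = A \<union> B \<union> C"
    by (auto simp: A_def B_def C_def)
  moreover have "card (A \<union> B) = card A + card B" "card (A \<union> B \<union> C) = card A + card B + card C"
    using fin A B by (subst card_Un_disjoint; auto simp: card_Un_disjoint)+
  ultimately have n: "card A \<ge> 2" "card A + card B \<ge> 4" "card A + card B + card C \<ge> 5"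
    using count by simp_all
  have nonempty: "\<exists>x. x \<in> X" if "card X \<noteq> 0" for X :: "'a set" using that by (metis all_not_in_conv card.empty)
  consider "card A \<ge> 5" | "card A = 4" "card B = 0" "card C \<noteq> 0" | "card A \<ge> 3" "card B \<noteq> 0"
    | "card A \<ge> 2" "card B \<noteq> 0" "card C \<noteq> 0" | "card A \<ge> 2" "card B \<ge> 3"
    using n by linarith
  then show ?thesis
  proof cases
    case 1
    then show ?thesis using A by (intro level0 solv_A5[of A I v w]) auto
  next
    case 2
    then obtain k where "k \<in> C" using nonempty by blast
    with 2 A C show ?thesis by (intro level0 solv_A4_C[of A I v w k "u k"]) auto
  next
    case 3
    obtain a b c where abc: "{a, b, c} \<subseteq> A" "distinct [a, b, c]" using three_elements[OF 3(1)] by blast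
    obtain k where "k \<in> B" using nonempty 3 by blast
    with abc A B show ?thesis
      by (intro level0 solv_A3_B[of a I b c k v "w a" "w b" "w c" "1 + 2 * w k"]) auto
  next
    case 4
    obtain a b where ab: "{a, b} \<subseteq> A" "distinct [a, b]" using two_elements[OF 4(1)] by blast
    obtain j where "j \<in> B" using nonempty 4 by blast
    moreover obtain k where "k \<in> C" using nonempty 4 by blast
    ultimately show ?thesis using ab A B C
      by (intro level0 solv_A2_B_C[of a I b j k v "w a" "w b" "1 + 2 * w j" "u k"]) auto
  next
    case 5
    obtain i j where ij: "{i, j} \<subseteq> A" "distinct [i, j]" using two_elements[OF 5(1)] by blast
    obtain a b c where abc: "{a, b, c} \<subseteq> B" "distinct [a, b, c]" using three_elements[OF 5(2)] by blast
    show ?thesis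
    \<comment> \<open>A line among the level-one coefficients already solves the form that starts at
      level 1.\<close>
    proof (cases "f4_line (par (w a)) (par (w b)) (par (w c))")
      case True
      have "l a = 1" "l b = 1" "l c = 1" using abc by (auto simp: B_def)
      then show ?thesis using abc B w True
        by (intro level[of 1] solv_A3'[of a _ b c _ "w a" "w b" "w c"]) auto
    next
      case False
      then show ?thesis using ij abc A B
        by (intro level0 solv_A2_B3[of i I j a b c v "w i" "w j" w]) auto
    qed
  qed
qed

text \<open>As phi^6 is 1 modulo 4 and n is even, x = phi^n satisfies x^3 = 1 modulo 4. Since 3 does
  not divide n, x - 1 is a unit and can be cancelled from x^3 - 1.\<close>

lemma cube_root_phi:
  assumes "\<not> 3 dvd n" "even n"
  shows "cube_root (phi ^ n)"
proof
  have phi2: "phi ^ 2 = phi + 1" using phi_square by (simp add: power2_eq_square)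
  have "4 dvd phi ^ 6 - 1"
  proof -
    have "phi ^ 3 = 2 * phi + 1"
      by (simp add: power3_eq_cube phi_square) (simp add: distrib_right phi_square)
    then have "phi ^ 6 = (2 * phi + 1) * (2 * phi + 1)"
      using power_add[of phi 3 3] by simp
    also have "\<dots> - 1 = 4 * (phi * phi + phi)" by (simp add: algebra_simps)
    finally show ?thesis by simp
  qed
  obtain k where k: "n = 2 * k" using assms(2) by blast
  have "phi ^ n * phi ^ n * phi ^ n - 1 = (phi ^ 6) ^ k - 1 ^ k"
    by (simp add: k flip: power_add power_mult)
  then have dvd: "4 dvd phi ^ n * phi ^ n * phi ^ n - 1"
    using \<open>4 dvd phi ^ 6 - 1\<close> dvd_power_diff dvd_trans by metis
  have "FW ^ n = FW ^ (n mod 3)"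
  proof -
    have "FW ^ 3 = (1::f4)" by (simp add: power3_eq_cube one_f4_def)
    then have "FW ^ (3 * (n div 3) + n mod 3) = FW ^ (n mod 3)"
      by (simp only: power_add power_mult power_one mult_1)
    then show ?thesis by simp
  qed
  moreover have "n mod 3 = 1 \<or> n mod 3 = 2" using assms(1) by presburger
  ultimately have par: "par (phi ^ n) = FW \<or> par (phi ^ n) = FV" by (auto simp: power2_eq_square)
  then show "par (phi ^ n) \<notin> {0, 1}" by (auto simp: zero_f4_def one_f4_def)
  have "phi ^ n * phi ^ n * phi ^ n - 1 = (phi ^ n - 1) * (1 + phi ^ n + (phi ^ n)\<^sup>2)"
    by (simp add: algebra_simps power2_eq_square)
  with dvd have "4 dvd (phi ^ n - 1) * (1 + phi ^ n + (phi ^ n)\<^sup>2)" by simp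
  moreover have "par (phi ^ n - 1) \<noteq> 0" using par by (auto simp: zero_f4_def one_f4_def)
  ultimately show "4 dvd 1 + phi ^ n + (phi ^ n)\<^sup>2" by (rule unit_dvd_cancel)
qed

lemma Gamma_star_upper_bound_1:
  assumes m: "odd m" "m \<ge> 3" and not3: "\<not> 3 dvd m"
  shows "Gamma_star (2 * m) TYPE(q2_sqrt5) \<le> enat (3 * m + 1)"
proof (rule Gamma_star_le)
  show "2 * m > 0" using m by simp
  fix s and a :: "nat \<Rightarrow> q2_sqrt5"
  assume s: "3 * m + 1 \<le> s" and a: "\<And>i. i < s \<Longrightarrow> a i \<noteq> 0"
  have cube: "cube_root (phi ^ (2 * m))"
    using not3 by (intro cube_root_phi) presburger+
  then interpret cube_root "phi ^ (2 * m)" .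
  have "2 * s > 3 * (2 * m)" "2 * m > 0" using s m by simp_all
  obtain l u where u: "\<And>i. i < s \<Longrightarrow> par (u i) \<noteq> 0"
    and count: "\<And>t. 1 \<le> t \<Longrightarrow> t \<le> 2 * m \<Longrightarrow> 2 * card {i\<in>{..<s}. l i < t} > 3 * t"
    and zero: "form_zero (2 * m) {..<s} (\<lambda>i. 2 ^ l i * u i) \<Longrightarrow> has_nontrivial_zero (2 * m) s a"
    by (rule normalized_levels[of s a "2 * m" 3 2, OF a \<open>2 * m > 0\<close> \<open>2 * s > 3 * (2 * m)\<close>])
      (assumption | rule that)+
  \<comment> \<open>Multiplication by a d-th power of phi makes every unit 1 modulo 2;
    \<open>form_zero_twist\<close> undoes this at the end.\<close>
  have "\<exists>k. par (u i) * par (phi ^ (2 * m)) ^ k = 1" if "i < s" for i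
    using f4_orbit[OF par_theta u[OF that]] by simp
  then obtain k where k: "\<And>i. i < s \<Longrightarrow> par (u i) * par (phi ^ (2 * m)) ^ k i = 1" by metis
  have "form_zero (2 * m) {..<s} (\<lambda>i. 2 ^ l i * (u i * (phi ^ (2 * m)) ^ k i))"
    using k count[of 1] count[of 2] count[of 3] m
    by (intro form_zero_not_3_dvd[OF m(1)]) (simp_all add: cube)
  then have "form_zero (2 * m) {..<s} (\<lambda>i. (2 ^ l i * u i) * (phi ^ k i) ^ (2 * m))"
    by (simp add: mult.assoc mult.commute[of _ "2 * m"] flip: power_mult)
  moreover have "phi ^ k i \<noteq> 0" for i
  proof -
    have "FW \<noteq> (0 :: f4)" by (simp add: zero_f4_def)
    then have "par (phi ^ k i) \<noteq> 0" by simp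
    then show ?thesis by (metis par_0)
  qed
  ultimately have "form_zero (2 * m) {..<s} (\<lambda>i. 2 ^ l i * u i)" by (rule form_zero_twist)
  then show "has_nontrivial_zero (2 * m) s a" by (rule zero)
qed

section \<open>The lattices \<open>2\<^sup>k (\<int> c + 2 O)\<close>\<close>

text \<open>\<open>N c k\<close> only depends on the residue class \<open>c\<close>. If \<open>c \<noteq> 0\<close> then \<open>2\<^sup>k O \<supset> N c k \<supset> 2\<^sup>k\<^sup>+\<^sup>1 O\<close>,
  both with index 2, and a sum containing units of class \<open>c\<close> can be completed to a zero as soon as
  it lies in \<open>N c 2\<close>.\<close>

definition N :: "f4 \<Rightarrow> nat \<Rightarrow> o2 set" where
  "N c k = {2 ^ k * x | x. par x = 0 \<or> par x = c}"

lemma pow2_mult_in_N [simp]: "2 ^ k * x \<in> N c k \<longleftrightarrow> par x = 0 \<or> par x = c"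
  by (auto simp: N_def)

lemma in_N0 [simp]: "x \<in> N c 0 \<longleftrightarrow> par x = 0 \<or> par x = c"
  using pow2_mult_in_N[of 0 x c] by simp

lemma two_mult_in_N1 [simp]: "2 * x \<in> N c 1 \<longleftrightarrow> par x = 0 \<or> par x = c"
  using pow2_mult_in_N[of 1 x c] by simp

lemma two_mult_in_N1' [simp]: "2 * x \<in> N c (Suc 0) \<longleftrightarrow> par x = 0 \<or> par x = c"
  using two_mult_in_N1 by simp

lemma four_mult_in_N2 [simp]: "4 * x \<in> N c 2 \<longleftrightarrow> par x = 0 \<or> par x = c"
  using pow2_mult_in_N[of 2 x c] by simp

lemma N_dvd: "x \<in> N c k \<Longrightarrow> 2 ^ k dvd x"
  by (auto simp: N_def)

lemma two_mult_in_N_Suc [simp]: "2 * x \<in> N c (Suc k) \<longleftrightarrow> x \<in> N c k"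
proof -
  have "2 * x = 2 ^ Suc k * y \<longleftrightarrow> x = 2 ^ k * y" for y by (simp only: power_Suc mult.assoc o2_two_cancel)
  then show ?thesis by (simp add: N_def del: power_Suc)
qed

lemma two_mult_in_N2 [simp]: "2 * x \<in> N c 2 \<longleftrightarrow> x \<in> N c 1"
  using two_mult_in_N_Suc[of x c 1] by (simp add: numeral_2_eq_2)

lemma N_add: "x \<in> N c k \<Longrightarrow> y \<in> N c k \<Longrightarrow> x + y \<in> N c k"
proof -
  assume "x \<in> N c k" "y \<in> N c k"
  then obtain a b where "x = 2 ^ k * a" "y = 2 ^ k * b" "par a = 0 \<or> par a = c" "par b = 0 \<or> par b = c"
    by (auto simp: N_def)
  then show ?thesis by (auto simp flip: distrib_left)
qed

lemma N_uminus: "x \<in> N c k \<Longrightarrow> - x \<in> N c k"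
proof -
  assume "x \<in> N c k"
  then obtain a where a: "x = 2 ^ k * a" "par (- a) = 0 \<or> par (- a) = c" by (auto simp: N_def)
  have "- x = 2 ^ k * (- a)" by (simp only: a(1) mult_minus_right)
  then show ?thesis using a(2) by (simp only: pow2_mult_in_N)
qed

lemma N_diff: "x \<in> N c k \<Longrightarrow> y \<in> N c k \<Longrightarrow> x - y \<in> N c k"
  using N_add[OF _ N_uminus, of x c k y] by simp

lemma f4_index_two: "p \<noteq> 0 \<Longrightarrow> p \<noteq> c \<Longrightarrow> q \<noteq> 0 \<Longrightarrow> q \<noteq> c \<Longrightarrow> c \<noteq> 0 \<Longrightarrow> p + q = 0 \<or> p + q = (c::f4)"
  by (cases p; cases q; cases c) (simp_all add: zero_f4_def)

lemma N_index_two: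
  assumes "2 ^ k dvd x" "2 ^ k dvd y" "x \<notin> N c k" "y \<notin> N c k" "c \<noteq> 0"
  shows "x + y \<in> N c k"
proof -
  obtain a b where "x = 2 ^ k * a" "y = 2 ^ k * b" using assms(1,2) by (auto elim!: dvdE)
  with assms(3-5) f4_index_two[of "par a" c "par b"] show ?thesis by (auto simp flip: distrib_left)
qed

lemma N_sum_dvd:
  assumes "x \<in> N c k" "y \<in> N c k" "\<not> 2 ^ Suc k dvd x" "\<not> 2 ^ Suc k dvd y"
  shows "2 ^ Suc k dvd x + y"
proof -
  obtain a b where ab: "x = 2 ^ k * a" "y = 2 ^ k * b" "par a = 0 \<or> par a = c" "par b = 0 \<or> par b = c"
    using assms(1,2) by (auto simp: N_def)
  have "2 ^ Suc k dvd 2 ^ k * z" if "par z = 0" for z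
    using that pow2_dvd_of_double[of z k] by (simp only: par_eq_0_iff)
  then have "par a = c" "par b = c" using ab assms(3,4) by blast+
  then have "par (a + b) = 0" by simp
  then have "2 ^ Suc k dvd 2 ^ k * (a + b)" using \<open>\<And>z. par z = 0 \<Longrightarrow> 2 ^ Suc k dvd 2 ^ k * z\<close> by blast
  then show ?thesis by (simp only: ab distrib_left)
qed

text \<open>\<open>N c k\<close> contains \<open>N c (Suc k)\<close> with index 4 and is mapped into
  it by doubling. The quotient is thus (Z/2)^2, with Davenport constant 3.\<close>

lemma N_three:
  assumes "x \<in> N c k" "y \<in> N c k" "z \<in> N c k" "c \<noteq> 0"
  shows "x \<in> N c (Suc k) \<or> y \<in> N c (Suc k) \<or> z \<in> N c (Suc k) \<or> x + y \<in> N c (Suc k) \<or>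
    x + z \<in> N c (Suc k) \<or> y + z \<in> N c (Suc k) \<or> x + (y + z) \<in> N c (Suc k)"
proof -
  let ?E = "\<lambda>x. (2::o2) ^ Suc k dvd x" and ?N = "N c (Suc k)"
  have idx: "p \<in> ?N \<or> q \<in> ?N \<or> p + q \<in> ?N" if "?E p" "?E q" for p q
    using N_index_two[OF that _ _ assms(4)] by blast
  have sum: "?E (p + q)" if "p \<in> N c k" "q \<in> N c k" "\<not> ?E p" "\<not> ?E q" for p q
    using N_sum_dvd[OF that] .
  have triple: "p + q \<in> ?N \<or> p + r \<in> ?N \<or> q + r \<in> ?N"
    if "p \<in> N c k" "q \<in> N c k" "r \<in> N c k" "\<not> ?E p" "\<not> ?E q" "\<not> ?E r" for p q r
  proof -
    have "p + q \<in> ?N \<or> p + r \<in> ?N \<or> (p + q) + (p + r) \<in> ?N" using that sum idx by blast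
    moreover have "(p + q) + (p + r) - 2 * p = q + r" by simp
    moreover have "2 * p \<in> ?N" using that by simp
    ultimately show ?thesis using N_diff by metis
  qed
  consider "?E x \<and> ?E y \<or> ?E x \<and> ?E z \<or> ?E y \<and> ?E z" | "?E x" "\<not> ?E y" "\<not> ?E z"
    | "?E y" "\<not> ?E x" "\<not> ?E z" | "?E z" "\<not> ?E x" "\<not> ?E y" | "\<not> ?E x" "\<not> ?E y" "\<not> ?E z" by blast
  then show ?thesis
  proof cases
    case 1 then show ?thesis using idx by blast
  next
    case 2 then show ?thesis using idx[OF 2(1) sum[OF assms(2,3) 2(2,3)]] by blast
  next
    case 3 then show ?thesis using idx[OF 3(1) sum[OF assms(1,3) 3(2,3)]] by (auto simp: ac_simps)
  next
    case 4 then show ?thesis using idx[OF 4(1) sum[OF assms(1,2) 4(2,3)]] by (auto simp: ac_simps)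
  next
    case 5 then show ?thesis using triple[of x y z] assms by blast
  qed
qed

section \<open>Zero sums\<close>

lemma f4_not_inj_on:
  fixes f :: "'i \<Rightarrow> f4"
  assumes "card A \<ge> 5"
  shows "\<not> inj_on f A"
proof
  assume "inj_on f A"
  moreover have "x \<in> {F0, F1, FW, FV}" for x by (cases x) simp_all
  then have "f ` A \<subseteq> {F0, F1, FW, FV}" by blast
  then have "card (f ` A) \<le> card {F0, F1, FW, FV}" by (rule card_mono[rotated]) simp
  ultimately show False using assms by (simp add: card_image)
qed

lemma f4_zero_sum_pair:
  fixes f :: "'i \<Rightarrow> f4"
  assumes "card F \<ge> 4"
  shows "\<exists>J\<subseteq>F. finite J \<and> J \<noteq> {} \<and> card J \<le> 2 \<and> sum f J = 0"
proof (cases "\<exists>i\<in>F. f i = 0")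
  case True
  then obtain i where "i \<in> F" "f i = 0" by blast
  then show ?thesis by (intro exI[of _ "{i}"]) auto
next
  case False
  have f4: "x = F0 \<or> x = F1 \<or> x = FW \<or> x = FV" for x by (cases x) auto
  have "f ` F \<subseteq> {F1, FW, FV}" using False f4 by (auto simp: zero_f4_def)
  then have "card (f ` F) \<le> card {F1, FW, FV}" by (rule card_mono[rotated]) simp
  then have "\<not> inj_on f F" using assms card_image[of f F] by auto
  then obtain i j where "i \<in> F" "j \<in> F" "i \<noteq> j" "f i = f j" by (auto simp: inj_on_def)
  then show ?thesis by (intro exI[of _ "{i, j}"]) auto
qed

lemma f4_zero_sum_triple:
  fixes f :: "'i \<Rightarrow> f4"
  assumes "card F \<ge> 3"
  shows "\<exists>J\<subseteq>F. finite J \<and> J \<noteq> {} \<and> sum f J = 0"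
proof -
  obtain i j k where ijk: "{i, j, k} \<subseteq> F" "distinct [i, j, k]" using three_elements[OF assms] by blast
  have "x = 0 \<or> y = 0 \<or> z = 0 \<or> x + y = 0 \<or> x + z = 0 \<or> y + z = 0 \<or> x + (y + z) = 0" for x y z :: f4
    by (cases x; cases y; cases z) (simp_all add: zero_f4_def)
  from this[of "f i" "f j" "f k"] ijk(2)
  have "\<exists>J\<in>{{i}, {j}, {k}, {i, j}, {i, k}, {j, k}, {i, j, k}}. sum f J = 0" by auto
  moreover have "J \<subseteq> F \<and> finite J \<and> J \<noteq> {}" if "J \<in> {{i}, {j}, {k}, {i, j}, {i, k}, {j, k}, {i, j, k}}" for J
    using that ijk(1) by auto
  ultimately show ?thesis by blast
qed

text \<open>Four elements contain a zero sum of length at most 2; the three remaining ones contain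
  another, as (Z/2)^2 has Davenport constant 3.\<close>

lemma f4_two_zero_sums:
  fixes f :: "'i \<Rightarrow> f4"
  assumes "card F \<ge> 5"
  shows "\<exists>J K. J \<subseteq> F \<and> K \<subseteq> F \<and> finite J \<and> finite K \<and> J \<inter> K = {} \<and> J \<noteq> {} \<and> K \<noteq> {} \<and>
    sum f J = 0 \<and> sum f K = 0"
proof -
  obtain J where J: "J \<subseteq> F" "finite J" "J \<noteq> {}" "card J \<le> 2" "sum f J = 0"
    using f4_zero_sum_pair[of F f] assms by auto
  have "card (F - J) \<ge> 3" using J assms by (simp add: card_Diff_subset)
  from f4_zero_sum_triple[OF this, of f] J show ?thesis by blast
qed

text \<open>Two disjoint subsets have even sums. As \<open>N c 1\<close> has index 2 in 2 O, one of
  them or their union lands in \<open>N c 1\<close>.\<close>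

lemma zero_sum_mod_N1:
  assumes "card F \<ge> 5" "c \<noteq> 0"
  shows "\<exists>J\<subseteq>F. finite J \<and> J \<noteq> {} \<and> sum v J \<in> N c 1"
proof -
  obtain J K where JK: "J \<subseteq> F" "K \<subseteq> F" "finite J" "finite K" "J \<inter> K = {}" "J \<noteq> {}" "K \<noteq> {}"
    and sums: "(\<Sum>i\<in>J. par (v i)) = 0" "(\<Sum>i\<in>K. par (v i)) = 0"
    using f4_two_zero_sums[OF assms(1), of "\<lambda>i. par (v i)"] by blast
  have "par (sum v J) = 0" "par (sum v K) = 0" using sums by simp_all
  then have "2 ^ 1 dvd sum v J" "2 ^ 1 dvd sum v K" by (simp_all only: par_eq_0_iff power_one_right)
  then have "sum v J \<in> N c 1 \<or> sum v K \<in> N c 1 \<or> sum v J + sum v K \<in> N c 1"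
    using N_index_two assms(2) by blast
  moreover have "sum v (J \<union> K) = sum v J + sum v K" using JK by (simp add: sum.union_disjoint)
  ultimately have "\<exists>L\<in>{J, K, J \<union> K}. sum v L \<in> N c 1" by auto
  moreover have "L \<subseteq> F \<and> finite L \<and> L \<noteq> {}" if "L \<in> {J, K, J \<union> K}" for L
    using that JK by auto
  ultimately show ?thesis by blast
qed

text \<open>With \<open>par a = c\<close>, \<open>N c 1\<close> is 2 Z a + 4 O, so together with its
  translate by a it makes up Z a + 4 O.\<close>

lemma half_lattice_rep:
  assumes "par a = c" "x \<in> N c 1 \<or> x + a \<in> N c 1"
  shows "\<exists>n t. x = of_int n * a + 4 * t"
proof -
  have even: "\<exists>n t. x = of_int n * a + 4 * t" if x: "x \<in> N c 1" for x
  proof -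
    obtain y where y: "x = 2 * y" "par y = 0 \<or> par y = c" using x by (auto simp: N_def)
    show ?thesis
    proof (cases "par y = 0")
      case True
      then obtain t where "y = 2 * t" by (auto simp: par_eq_0_iff)
      then show ?thesis by (intro exI[of _ 0] exI[of _ t]) (simp add: y)
    next
      case False
      then have "par (y - a) = 0" using y assms(1) by simp
      then obtain t where "y - a = 2 * t" unfolding par_eq_0_iff by (rule dvdE)
      then have "y = a + 2 * t" by (simp add: algebra_simps)
      then show ?thesis by (intro exI[of _ 2] exI[of _ t]) (simp add: y algebra_simps)
    qed
  qed
  show ?thesis using assms(2)
  proof
    assume "x + a \<in> N c 1"
    then obtain n t where "x + a = of_int n * a + 4 * t" using even by blast
    then have "x = of_int (n - 1) * a + 4 * t" by (simp add: algebra_simps)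
    then show ?thesis by blast
  qed (rule even)
qed

text \<open>The elements of \<open>\<int> a + 4 O\<close> modulo \<open>N c 2\<close> form a group \<open>\<int>/4 \<times> \<int>/2\<close>, whose Davenport
  constant is 5.\<close>

lemma zero_sum_mod_N2:
  assumes F: "card F \<ge> 5" and c: "c \<noteq> 0" "par a = c"
    and v: "\<And>i. i \<in> F \<Longrightarrow> v i \<in> N c 1 \<or> v i + a \<in> N c 1"
  shows "\<exists>J\<subseteq>F. finite J \<and> J \<noteq> {} \<and> sum v J \<in> N c 2"
proof -
  have "\<forall>i\<in>F. \<exists>n t. v i = of_int n * a + 4 * t" using half_lattice_rep[OF c(2) v] by blast
  then obtain n t where nt: "\<And>i. i \<in> F \<Longrightarrow> v i = of_int (n i) * a + 4 * t i" by metis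
  \<comment> \<open>\<open>\<chi>\<close> is the quotient map of F_4 by {0, c}, with values in {0,
    \<open>FW\<close>}. As 1 and \<open>FW\<close> are independent over F_2,
    \<open>of_int n + \<chi> p\<close> encodes the parity of n and the class of p in one element of
    F_4.\<close>
  define \<chi> where "\<chi> p = (if p = 0 \<or> p = c then 0 else FW)" for p
  have \<chi>_add: "\<chi> (p + q) = \<chi> p + \<chi> q" for p q
    using c(1) by (cases p; cases q; cases c) (simp_all add: \<chi>_def zero_f4_def)
  have \<chi>_sum: "\<chi> (sum f J) = (\<Sum>i\<in>J. \<chi> (f i))" for f :: "'a \<Rightarrow> f4" and J
    by (induction J rule: infinite_finite_induct) (simp_all add: \<chi>_add, simp_all add: \<chi>_def)
  have of_int: "of_int m = (if even m then 0 else 1 :: f4)" for m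
    by (auto elim!: evenE oddE)
  obtain J K where JK: "J \<subseteq> F" "K \<subseteq> F" "finite J" "finite K" "J \<inter> K = {}" "J \<noteq> {}" "K \<noteq> {}"
    and sums: "(\<Sum>i\<in>J. of_int (n i) + \<chi> (par (t i))) = 0" "(\<Sum>i\<in>K. of_int (n i) + \<chi> (par (t i))) = 0"
    using f4_two_zero_sums[OF F, of "\<lambda>i. of_int (n i) + \<chi> (par (t i))"] by blast
  have *: "\<exists>k. sum v L = of_int (2 * k) * a + 4 * sum t L \<and> (par (sum t L) = 0 \<or> par (sum t L) = c)"
    if L: "L \<subseteq> F" and zero: "(\<Sum>i\<in>L. of_int (n i) + \<chi> (par (t i))) = 0" for L
  proof -
    have "of_int (sum n L) + \<chi> (par (sum t L)) = 0"
      using zero by (simp add: sum.distrib \<chi>_sum)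
    then have "even (sum n L)" "\<chi> (par (sum t L)) = 0"
      unfolding of_int by (auto simp: \<chi>_def zero_f4_def one_f4_def split: if_splits)
    then obtain k where "sum n L = 2 * k" "par (sum t L) = 0 \<or> par (sum t L) = c"
      by (auto simp: \<chi>_def zero_f4_def split: if_splits elim!: evenE)
    moreover have "sum v L = of_int (sum n L) * a + 4 * sum t L"
      using L nt by (simp add: sum.distrib sum_distrib_left sum_distrib_right subset_iff)
    ultimately show ?thesis by metis
  qed
  obtain j where j: "sum v J = of_int (2 * j) * a + 4 * sum t J" "par (sum t J) = 0 \<or> par (sum t J) = c"
    using *[OF JK(1) sums(1)] by blast
  obtain k where k: "sum v K = of_int (2 * k) * a + 4 * sum t K" "par (sum t K) = 0 \<or> par (sum t K) = c"
    using *[OF JK(2) sums(2)] by blast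
  have quarter: "of_int (2 * m) * a + 4 * s \<in> N c 2" if m: "even m" and s: "par s = 0 \<or> par s = c" for m s
  proof -
    obtain l where "m = 2 * l" using m by (rule evenE)
    then have "of_int (2 * m) * a + 4 * s = 4 * (of_int l * a + s)" by (simp add: algebra_simps)
    moreover have "par (of_int l * a + s) = 0 \<or> par (of_int l * a + s) = c"
      using s c(2) by (cases "even l") (auto elim!: evenE oddE)
    ultimately show ?thesis by (simp only: four_mult_in_N2)
  qed
  have "\<exists>L\<in>{J, K, J \<union> K}. sum v L \<in> N c 2"
  proof (cases "even j \<or> even k")
    case True
    then show ?thesis using j k quarter by auto
  next
    case False
    then have even: "even (j + k)" by simp
    have "par (sum t J + sum t K) = 0 \<or> par (sum t J + sum t K) = c"
      using j(2) k(2) unfolding par_add by auto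
    from quarter[OF even this] have "sum v (J \<union> K) \<in> N c 2"
      using JK j(1) k(1) by (simp add: sum.union_disjoint algebra_simps)
    then show ?thesis by blast
  qed
  moreover have "L \<subseteq> F \<and> finite L \<and> L \<noteq> {}" if "L \<in> {J, K, J \<union> K}" for L
    using that JK by auto
  ultimately show ?thesis by blast
qed

section \<open>Criteria for solvability with d-th powers 1 and 5 only\<close>

lemma solv1I:
  assumes "J \<subseteq> S" "finite J" "J' \<subseteq> J" "i \<in> J" "par (v i) \<noteq> 0"
    and "sum v J = 4 * y" "par y = (\<Sum>i\<in>J'. par (v i))"
  shows "solv 1 v S"
  using assms by (intro solvI[of J S J' i v 1 "\<lambda>_. 0" y]) auto

lemma solv_N2:
  assumes "J \<subseteq> S" "finite J" "i \<in> J" "par (v i) = c" "c \<noteq> 0" "sum v J \<in> N c 2"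
  shows "solv 1 v S"
proof -
  obtain y where y: "sum v J = 4 * y" "par y = 0 \<or> par y = c" using assms(6) by (auto simp: N_def)
  show ?thesis using y(2)
  proof
    assume "par y = 0"
    then show ?thesis using assms y(1) by (intro solv1I[of J S "{}" i v y]) auto
  next
    assume "par y = c"
    then show ?thesis using assms y(1) by (intro solv1I[of J S "{i}" i v y]) auto
  qed
qed

text \<open>The residues of the two units form a basis of F_4 over F_2, so a suitable J' inside {i,
  j} corrects any quarter of the sum.\<close>

lemma solv_two_classes:
  assumes J: "J \<subseteq> S" "finite J" "i \<in> J" "j \<in> J" and ij: "par (v i) \<noteq> 0" "par (v j) \<noteq> 0" "par (v i) \<noteq> par (v j)"
    and dvd: "4 dvd sum v J"
  shows "solv 1 v S"
proof -
  obtain y where y: "sum v J = 4 * y" using dvd by (rule dvdE)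
  have ne: "i \<noteq> j" using ij by blast
  have "par y = 0 \<or> par y = par (v i) \<or> par y = par (v j) \<or> par y = par (v i) + par (v j)"
    using ij by (cases "par y"; cases "par (v i)"; cases "par (v j)") (simp_all add: zero_f4_def)
  moreover have "solv 1 v S" if "par y = (\<Sum>i\<in>J'. par (v i))" "J' \<subseteq> J" for J'
    using J(1,2) that(2) J(3) ij(1) y that(1) by (rule solv1I)
  from this[of "{}"] this[of "{i}"] this[of "{j}"] this[of "{i, j}"]
  have "par y = 0 \<Longrightarrow> solv 1 v S" "par y = par (v i) \<Longrightarrow> solv 1 v S" "par y = par (v j) \<Longrightarrow> solv 1 v S"
    "par y = par (v i) + par (v j) \<Longrightarrow> solv 1 v S"
    using J ne by (auto split: if_splits)
  ultimately show ?thesis by blast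
qed

text \<open>By \<open>N_three\<close> some union of the blocks has its sum in \<open>N c 2\<close>.
  The last three hypotheses ensure that such a union contains a unit of class c, also when it avoids
  J1.\<close>

lemma solv_three_blocks:
  assumes J: "J1 \<subseteq> S" "J2 \<subseteq> S" "J3 \<subseteq> S" "finite J1" "finite J2" "finite J3"
    "J1 \<inter> J2 = {}" "J1 \<inter> J3 = {}" "J2 \<inter> J3 = {}"
    and N: "sum v J1 \<in> N c 1" "sum v J2 \<in> N c 1" "sum v J3 \<in> N c 1" and c: "c \<noteq> 0"
    and i: "i \<in> J1" "par (v i) = c"
    and "(\<exists>j\<in>J2. par (v j) = c) \<or> sum v J2 \<notin> N c 2"
    and "(\<exists>j\<in>J3. par (v j) = c) \<or> sum v J3 \<notin> N c 2"
    and "(\<exists>j\<in>J2 \<union> J3. par (v j) = c) \<or> sum v J2 + sum v J3 \<notin> N c 2"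
  shows "solv 1 v S"
proof -
  have *: "solv 1 v S" if "K \<subseteq> S" "finite K" "j \<in> K" "par (v j) = c" "sum v K \<in> N c 2" for K j
    using that c by (intro solv_N2[of K S j v c])
  have sums: "sum v (J1 \<union> J2) = sum v J1 + sum v J2" "sum v (J1 \<union> J3) = sum v J1 + sum v J3"
    "sum v (J2 \<union> J3) = sum v J2 + sum v J3" "sum v (J1 \<union> (J2 \<union> J3)) = sum v J1 + (sum v J2 + sum v J3)"
    using J by (simp_all add: sum.union_disjoint Int_Un_distrib)
  have N2: "N c (Suc 1) = N c 2" by (simp add: numeral_2_eq_2)
  have in1: "solv 1 v S" if "K \<subseteq> S" "finite K" "J1 \<subseteq> K" "sum v K \<in> N c 2" for K
    using *[of K i] that i by blast
  consider "sum v J1 \<in> N c 2" | "sum v J2 \<in> N c 2" | "sum v J3 \<in> N c 2"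
    | "sum v (J1 \<union> J2) \<in> N c 2" | "sum v (J1 \<union> J3) \<in> N c 2" | "sum v (J2 \<union> J3) \<in> N c 2"
    | "sum v (J1 \<union> (J2 \<union> J3)) \<in> N c 2"
    using N_three[OF N c] unfolding N2 sums by blast
  then show ?thesis
  proof cases
    case 1 then show ?thesis using in1[of J1] J by blast
  next
    case 2 then show ?thesis using *[of J2] J assms(16) by blast
  next
    case 3 then show ?thesis using *[of J3] J assms(17) by blast
  next
    case 4 then show ?thesis using in1[of "J1 \<union> J2"] J by blast
  next
    case 5 then show ?thesis using in1[of "J1 \<union> J3"] J by blast
  next
    case 6 then show ?thesis using *[of "J2 \<union> J3"] J assms(18) unfolding sums by blast
  next
    case 7 then show ?thesis using in1[of "J1 \<union> (J2 \<union> J3)"] J by blast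
  qed
qed

lemma even_class_sum: "par x = c \<Longrightarrow> par y = c \<Longrightarrow> 2 ^ 1 dvd x + y"
  by (simp add: par_eq_0_iff [symmetric])

text \<open>On units of class c, having a sum in \<open>N c 1\<close> is an equivalence relation
  with at most two classes: 2 v lies in \<open>N c 1\<close>, and sums of pairs lie in 2 O, where
  \<open>N c 1\<close> has index 2. Among three units two are equivalent.\<close>

lemma class_pair_in_N1:
  assumes A: "card A \<ge> 3" "\<And>i. i \<in> A \<Longrightarrow> par (v i) = c" and c: "c \<noteq> 0"
  shows "\<exists>i j. {i, j} \<subseteq> A \<and> i \<noteq> j \<and> v i + v j \<in> N c 1"
proof -
  obtain i j k where ijk: "{i, j, k} \<subseteq> A" "distinct [i, j, k]" using three_elements[OF A(1)] by blast
  then have par: "par (v i) = c" "par (v j) = c" "par (v k) = c" using A(2) by auto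
  show ?thesis
  proof (cases "v i + v j \<in> N c 1 \<or> v i + v k \<in> N c 1")
    case False
    then have "(v i + v j) + (v i + v k) \<in> N c 1"
      using par c by (intro N_index_two even_class_sum) auto
    moreover have "2 * v i \<in> N c 1" using par by simp
    moreover have "(v i + v j) + (v i + v k) - 2 * v i = v j + v k" by simp
    ultimately have "v j + v k \<in> N c 1" using N_diff by metis
    then show ?thesis using ijk by (intro exI[of _ j] exI[of _ k]) auto
  qed (use ijk in auto)
qed

lemma solv_two_pairs:
  assumes "{i, j, k, l} \<subseteq> S - K" "distinct [i, j, k, l]" "v i + v j \<in> N c 1" "v k + v l \<in> N c 1"
    and "par (v i) = c" "par (v k) = c" "c \<noteq> 0"
    and K: "K \<subseteq> S" "finite K" "sum v K \<in> N c 1" "(\<exists>q\<in>K. par (v q) = c) \<or> sum v K \<notin> N c 2"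
  shows "solv 1 v S"
proof (rule solv_three_blocks[of "{i, j}" S "{k, l}" K v c i])
  show "sum v {i, j} \<in> N c 1" "sum v {k, l} \<in> N c 1" using assms(2-4) by simp_all
  show "(\<exists>j\<in>{k, l}. par (v j) = c) \<or> sum v {k, l} \<notin> N c 2" using assms(6) by blast
  show "(\<exists>j\<in>{k, l} \<union> K. par (v j) = c) \<or> sum v {k, l} + sum v K \<notin> N c 2" using assms(6) by blast
  show "{i, j} \<subseteq> S" "{k, l} \<subseteq> S" "{i, j} \<inter> K = {}" "{k, l} \<inter> K = {}" using assms(1) by blast+
  show "{i, j} \<inter> {k, l} = {}" using assms(2) by auto
qed (use assms in simp_all)

lemma card_minus_pair: "{i, j} \<subseteq> A \<Longrightarrow> i \<noteq> j \<Longrightarrow> card (A - {i, j}) = card A - 2"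
  by (subst card_Diff_subset) auto

lemma class_two_pairs:
  assumes A: "card A \<ge> 5" "\<And>i. i \<in> A \<Longrightarrow> par (v i) = c" and c: "c \<noteq> 0"
  obtains i j k l where "{i, j, k, l} \<subseteq> A" "distinct [i, j, k, l]" "v i + v j \<in> N c 1" "v k + v l \<in> N c 1"
    "card (A - {i, j, k, l}) = card A - 4"
proof -
  have "card A \<ge> 3" using A(1) by simp
  then obtain i j where ij: "{i, j} \<subseteq> A" "i \<noteq> j" "v i + v j \<in> N c 1"
    using class_pair_in_N1[of A v c, OF _ A(2) c] by blast
  define A' where "A' = A - {i, j}"
  have A': "card A' = card A - 2" "A' \<subseteq> A" using card_minus_pair[OF ij(1,2)] by (auto simp: A'_def)
  have cls: "par (v i) = c" if "i \<in> A'" for i using that A A' by blast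
  have "card A' \<ge> 3" using A'(1) A(1) by simp
  then obtain k l where kl: "{k, l} \<subseteq> A'" "k \<noteq> l" "v k + v l \<in> N c 1"
    using class_pair_in_N1[of A' v c, OF _ cls c] by blast
  have "A - {i, j, k, l} = A' - {k, l}" by (auto simp: A'_def)
  then have "card (A - {i, j, k, l}) = card A - 4" using card_minus_pair[OF kl(1,2)] A'(1) by simp
  moreover have "{i, j, k, l} \<subseteq> A" "distinct [i, j, k, l]" using ij kl by (auto simp: A'_def)
  ultimately show thesis using ij(3) kl(3) by (intro that)
qed

text \<open>Every three units contain a pair with sum in \<open>N c 1\<close>, so 7 = 2 + 2 + 3
  units contain three disjoint pairs, the blocks needed.\<close>

lemma solv_class_7:
  assumes A: "card A \<ge> 7" "A \<subseteq> S" "\<And>i. i \<in> A \<Longrightarrow> par (v i) = c" and c: "c \<noteq> 0"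
  shows "solv 1 v S"
proof -
  have "card A \<ge> 5" using A(1) by simp
  then obtain i j k l where ijkl: "{i, j, k, l} \<subseteq> A" "distinct [i, j, k, l]"
    "v i + v j \<in> N c 1" "v k + v l \<in> N c 1" "card (A - {i, j, k, l}) = card A - 4"
    using class_two_pairs[of A v c, OF _ A(3) c] by blast
  define A' where "A' = A - {i, j, k, l}"
  have cls: "par (v i) = c" if "i \<in> A'" for i using that A by (auto simp: A'_def)
  have "card A' \<ge> 3" using ijkl(5) A(1) by (simp add: A'_def)
  then obtain p q where pq: "{p, q} \<subseteq> A'" "p \<noteq> q" "v p + v q \<in> N c 1"
    using class_pair_in_N1[of A' v c, OF _ cls c] by blast
  show ?thesis
  proof (rule solv_two_pairs[of i j k l S "{p, q}" v c])
    show "{i, j, k, l} \<subseteq> S - {p, q}" using ijkl(1) pq(1) A(2) by (auto simp: A'_def)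
    show "{p, q} \<subseteq> S" using pq(1) A(2) by (auto simp: A'_def)
    show "(\<exists>q\<in>{p, q}. par (v q) = c) \<or> sum v {p, q} \<notin> N c 2" using cls pq(1) by blast
  qed (use ijkl pq A(3) c in simp_all)
qed

text \<open>The blocks are a pair from \<open>class_pair_in_N1\<close>, the other two units, and K.
  If the second sum is not in \<open>N c 1\<close>, adding b moves it there.\<close>

lemma solv_class_4_rich:
  assumes A: "card A \<ge> 4" "A \<subseteq> S" "\<And>i. i \<in> A \<Longrightarrow> par (v i) = c" and c: "c \<noteq> 0"
    and b: "b \<in> S - A" "2 ^ 1 dvd v b" "v b \<notin> N c 1"
    and K: "K \<subseteq> S - A" "finite K" "b \<notin> K" "sum v K \<in> N c 1" "sum v K \<notin> N c 2"
  shows "solv 1 v S"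
proof -
  have "card A \<ge> 3" using A(1) by simp
  then obtain i j where ij: "{i, j} \<subseteq> A" "i \<noteq> j" "v i + v j \<in> N c 1"
    using class_pair_in_N1[of A v c, OF _ A(3) c] by blast
  then have "card (A - {i, j}) \<ge> 2" using card_minus_pair[OF ij(1,2)] A by auto
  then obtain k l where kl: "{k, l} \<subseteq> A - {i, j}" "distinct [k, l]" using two_elements by blast
  have par: "par (v i) = c" "par (v j) = c" "par (v k) = c" "par (v l) = c" using ij kl A(3) by auto
  have d: "distinct [i, j, k, l]" "{i, j, k, l} \<subseteq> A" using ij kl by auto
  show ?thesis
  proof (cases "v k + v l \<in> N c 1")
    case True
    show ?thesis
    proof (rule solv_two_pairs[of i j k l S K v c])
      show "{i, j, k, l} \<subseteq> S - K" using d(2) K(1) A(2) by blast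
    qed (use d ij True par c K in auto)
  next
    case False
    then have "(v k + v l) + v b \<in> N c 1"
      using b c by (intro N_index_two even_class_sum[OF par(3,4)])
    moreover have ne: "b \<notin> {i, j, k, l}" using b(1) d(2) by blast
    ultimately have sum: "sum v {k, l, b} \<in> N c 1" using kl by (auto simp: add.assoc)
    show ?thesis
    proof (rule solv_three_blocks[of "{i, j}" S "{k, l, b}" K v c i])
      show "{i, j} \<subseteq> S" "{k, l, b} \<subseteq> S" "K \<subseteq> S" using d(2) A(2) b(1) K(1) by blast+
      show "{i, j} \<inter> {k, l, b} = {}" using d(1) ne by auto
      show "{i, j} \<inter> K = {}" "{k, l, b} \<inter> K = {}" using d(2) K(1,3) by blast+
      show "sum v {i, j} \<in> N c 1" using ij by simp
      show "(\<exists>j\<in>{k, l, b}. par (v j) = c) \<or> sum v {k, l, b} \<notin> N c 2" using par by blast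
      show "(\<exists>j\<in>{k, l, b} \<union> K. par (v j) = c) \<or> sum v {k, l, b} + sum v K \<notin> N c 2" using par by blast
    qed (use sum K par c in simp_all)
  qed
qed

lemma level_one_in_N:
  assumes "v = 2 * t" "par t \<noteq> 0"
  shows "v \<in> N c 1 \<longleftrightarrow> par t = c" "v \<notin> N c 2" "2 ^ 1 dvd v"
proof -
  show "v \<in> N c 1 \<longleftrightarrow> par t = c" using assms by simp
  have "v \<in> N c 2 \<Longrightarrow> t \<in> N c 1" by (simp add: assms(1))
  then show "v \<notin> N c 2" using N_dvd[of t c 1] assms(2) by (auto simp: par_eq_0_iff)
qed (simp add: assms(1))

text \<open>Two pairs leave p and q; the third block is b, {p, q} or {p, q, b}, according to which
  sum lies in \<open>N c 1\<close>.\<close>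

lemma solv_class_6:
  assumes A: "card A \<ge> 6" "A \<subseteq> S" "\<And>i. i \<in> A \<Longrightarrow> par (v i) = c" and c: "c \<noteq> 0"
    and b: "b \<in> S - A" "v b = 2 * t" "par t \<noteq> 0"
  shows "solv 1 v S"
proof -
  have "card A \<ge> 5" using A(1) by simp
  then obtain i j k l where ijkl: "{i, j, k, l} \<subseteq> A" "distinct [i, j, k, l]"
    "v i + v j \<in> N c 1" "v k + v l \<in> N c 1" "card (A - {i, j, k, l}) = card A - 4"
    using class_two_pairs[of A v c, OF _ A(3) c] by blast
  have "card (A - {i, j, k, l}) \<ge> 2" using ijkl(5) A(1) by simp
  then obtain p q where pq: "{p, q} \<subseteq> A - {i, j, k, l}" "distinct [p, q]" using two_elements by blast
  have par: "par (v i) = c" "par (v k) = c" "par (v p) = c" "par (v q) = c" using ijkl(1) pq A(3) by auto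
  have block: "solv 1 v S" if "K \<subseteq> S - {i, j, k, l}" "finite K" "sum v K \<in> N c 1"
    "(\<exists>q\<in>K. par (v q) = c) \<or> sum v K \<notin> N c 2" for K
  proof (rule solv_two_pairs[of i j k l S K v c])
    show "{i, j, k, l} \<subseteq> S - K" "K \<subseteq> S" using that(1) ijkl(1) A(2) by blast+
  qed (use that ijkl par c in simp_all)
  have lev: "v b \<in> N c 1 \<longleftrightarrow> par t = c" "v b \<notin> N c 2" "2 ^ 1 dvd v b"
    using level_one_in_N[OF b(2,3)] by blast+
  have pqS: "{p, q} \<subseteq> S - {i, j, k, l}" "b \<in> S - {i, j, k, l}" "b \<noteq> p" "b \<noteq> q"
    using pq(1) A(2) b(1) ijkl(1) by blast+
  consider "par t = c" | "v p + v q \<in> N c 1" | "par t \<noteq> c" "v p + v q \<notin> N c 1" by blast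
  then show ?thesis
  proof cases
    case 1
    then show ?thesis using block[of "{b}"] lev pqS by simp
  next
    case 2
    then show ?thesis using block[of "{p, q}"] pq pqS par by simp
  next
    case 3
    then have "(v p + v q) + v b \<in> N c 1"
      using lev c by (intro N_index_two even_class_sum[OF par(3,4)]) auto
    then show ?thesis using block[of "{p, q, b}"] pq pqS par by (simp add: add.assoc)
  qed
qed

lemma solv_half_lattice:
  assumes F: "F \<subseteq> S" "finite F" "card F \<ge> 5" and c: "c \<noteq> 0" "par a = c"
    and v: "\<And>i. i \<in> F \<Longrightarrow> v i \<in> N c 1 \<or> v i + a \<in> N c 1"
    and K: "\<And>K. K \<subseteq> F \<Longrightarrow> K \<noteq> {} \<Longrightarrow> (\<And>i. i \<in> K \<Longrightarrow> par (v i) \<noteq> c) \<Longrightarrow> sum v K \<notin> N c 2"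
  shows "solv 1 v S"
proof -
  obtain J where J: "J \<subseteq> F" "finite J" "J \<noteq> {}" "sum v J \<in> N c 2"
    using zero_sum_mod_N2[of F c a v, OF F(3) c v] by blast
  then obtain i where "i \<in> J" "par (v i) = c" using K[of J] by blast
  then show ?thesis using J F c by (intro solv_N2[of J S i v c]) auto
qed

text \<open>All units lie in Z a + 4 O for any one of them as a, and any zero sum found there
  contains a unit.\<close>

lemma solv_half_class:
  assumes A: "card A \<ge> 5" "A \<subseteq> S" "finite A" "\<And>i. i \<in> A \<Longrightarrow> par (v i) = c" and c: "c \<noteq> 0"
    and half: "\<And>i j. i \<in> A \<Longrightarrow> j \<in> A \<Longrightarrow> i \<noteq> j \<Longrightarrow> v i + v j \<in> N c 1"
  shows "solv 1 v S"
proof -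
  have "A \<noteq> {}" using A(1) by auto
  then obtain i where i: "i \<in> A" by blast
  have "v j + v i \<in> N c 1" if "j \<in> A" for j
  proof (cases "j = i")
    case True
    then have "v j + v i = 2 * v i" by simp
    then show ?thesis using A(4)[OF i] by (simp only: two_mult_in_N1 simp_thms)
  qed (use half i that in auto)
  then show ?thesis
    using A c i by (intro solv_half_lattice[of A S c "v i" v]) blast+
qed

section \<open>Sums modulo 4\<close>

text \<open>The type of an even sum is the residue of its half, that is, the sum modulo 4. Types add
  over disjoint index sets, and type 0 means divisibility by 4.\<close>

definition ty :: "('i \<Rightarrow> o2) \<Rightarrow> 'i set \<Rightarrow> f4 \<Rightarrow> bool" where
  "ty v J x \<longleftrightarrow> (\<exists>y. sum v J = 2 * y \<and> par y = x)"

definition reach :: "('i \<Rightarrow> o2) \<Rightarrow> 'i set \<Rightarrow> f4 set" where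
  "reach v A = {x. \<exists>J\<subseteq>A. finite J \<and> J \<noteq> {} \<and> ty v J x}"

definition unit_class :: "('i \<Rightarrow> o2) \<Rightarrow> f4 \<Rightarrow> 'i set \<Rightarrow> bool" where
  "unit_class v c A \<longleftrightarrow> finite A \<and> c \<noteq> 0 \<and> (\<forall>i\<in>A. par (v i) = c)"

lemma unit_classD: "unit_class v c A \<Longrightarrow> i \<in> A \<Longrightarrow> par (v i) = c" "unit_class v c A \<Longrightarrow> c \<noteq> 0"
  "unit_class v c A \<Longrightarrow> finite A"
  by (auto simp: unit_class_def)

lemma unit_class_disjoint: "unit_class v c A \<Longrightarrow> unit_class v c' A' \<Longrightarrow> c \<noteq> c' \<Longrightarrow> A \<inter> A' = {}"
  by (auto simp: unit_class_def)

lemma reachI: "J \<subseteq> A \<Longrightarrow> finite J \<Longrightarrow> J \<noteq> {} \<Longrightarrow> ty v J x \<Longrightarrow> x \<in> reach v A"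
  by (auto simp: reach_def)

lemma ty_union:
  assumes "finite J" "finite K" "J \<inter> K = {}" "ty v J x" "ty v K y"
  shows "ty v (J \<union> K) (x + y)"
proof -
  obtain a b where "sum v J = 2 * a" "par a = x" "sum v K = 2 * b" "par b = y"
    using assms(4,5) by (auto simp: ty_def)
  then have "sum v (J \<union> K) = 2 * (a + b)" "par (a + b) = x + y"
    using assms(1-3) by (simp_all add: sum.union_disjoint distrib_left)
  then show ?thesis unfolding ty_def by blast
qed

lemma ty_four_dvd: "ty v J 0 \<Longrightarrow> 4 dvd sum v J"
  by (auto simp: ty_def par_eq_0_iff)

lemma ty_in_N1: "ty v J x \<Longrightarrow> sum v J \<in> N c 1 \<longleftrightarrow> x = 0 \<or> x = c"
  by (auto simp: ty_def)

lemma ty_of_par_0: "par (sum v J) = 0 \<Longrightarrow> \<exists>x. ty v J x"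
  unfolding par_eq_0_iff by (auto simp: ty_def)

text \<open>With v i = a + 2 z i for a fixed a of class c, the types depend only on the residues
  \<open>\<zeta>\<close> of the z i. A pair keeps the term a, while in a quadruple 4 a drops
  out.\<close>

lemma unit_class_types:
  assumes "unit_class v c A"
  obtains \<zeta> where "\<And>i j. i \<in> A \<Longrightarrow> j \<in> A \<Longrightarrow> i \<noteq> j \<Longrightarrow> ty v {i, j} (c + \<zeta> i + \<zeta> j)"
    and "\<And>i j k l. {i, j, k, l} \<subseteq> A \<Longrightarrow> distinct [i, j, k, l] \<Longrightarrow> ty v {i, j, k, l} (\<zeta> i + \<zeta> j + \<zeta> k + \<zeta> l)"
proof -
  obtain a where a: "par a = c" using par_surj by blast
  have "\<exists>z. v i = a + 2 * z" if "i \<in> A" for i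
  proof -
    have "par (v i - a) = 0" using unit_classD(1)[OF assms that] a by simp
    then obtain z where "v i - a = 2 * z" unfolding par_eq_0_iff by (rule dvdE)
    then show ?thesis by (intro exI[of _ z]) (simp add: algebra_simps)
  qed
  then obtain z where z: "\<And>i. i \<in> A \<Longrightarrow> v i = a + 2 * z i" by metis
  show thesis
  proof
    fix i j assume "i \<in> A" "j \<in> A" "i \<noteq> j"
    then have "sum v {i, j} = 2 * (a + z i + z j)" by (simp add: z algebra_simps)
    moreover have "par (a + z i + z j) = c + par (z i) + par (z j)" using a by simp
    ultimately show "ty v {i, j} (c + par (z i) + par (z j))" unfolding ty_def by blast
  next
    fix i j k l assume "{i, j, k, l} \<subseteq> A" "distinct [i, j, k, l]"
    then have "sum v {i, j, k, l} = 2 * (2 * a + (z i + z j + z k + z l))"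
      by (simp add: z algebra_simps)
    moreover have "par (2 * a + (z i + z j + z k + z l)) = par (z i) + par (z j) + par (z k) + par (z l)"
      by simp
    ultimately show "ty v {i, j, k, l} (par (z i) + par (z j) + par (z k) + par (z l))"
      unfolding ty_def by blast
  qed
qed

lemma f4_all: "(\<forall>x. P x) \<longleftrightarrow> P F0 \<and> P F1 \<and> P FW \<and> P FV"
  by (metis f4.exhaust)

text \<open>The pairwise sums of three distinct elements of F_4 are its three nonzero
  elements.\<close>

lemma f4_three_distinct:
  assumes "a \<noteq> b" "a \<noteq> d" "b \<noteq> d" "x \<noteq> c"
  shows "x = c + a + b \<or> x = c + a + d \<or> x = c + b + (d::f4)"
proof -
  have "y = a + b \<or> y = a + d \<or> y = b + d" if "y \<noteq> 0" for y
    using assms(1-3) that by (cases a; cases b; cases d; cases y) (simp_all add: zero_f4_def)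
  from this[of "x + c"] assms(4) show ?thesis
    by (metis add.assoc add.commute add.left_neutral f4_add_eq_0_iff f4_double)
qed

lemma reach_distinct:
  assumes "unit_class v c A"
    and \<zeta>: "\<And>i j. i \<in> A \<Longrightarrow> j \<in> A \<Longrightarrow> i \<noteq> j \<Longrightarrow> ty v {i, j} (c + \<zeta> i + \<zeta> j)"
    and "inj_on \<zeta> A" "card A \<ge> 3" "x \<noteq> c"
  shows "x \<in> reach v A"
proof -
  obtain i j k where ijk: "{i, j, k} \<subseteq> A" "distinct [i, j, k]" using three_elements[OF assms(4)] by blast
  then have "\<zeta> i \<noteq> \<zeta> j" "\<zeta> i \<noteq> \<zeta> k" "\<zeta> j \<noteq> \<zeta> k" using assms(3) by (auto simp: inj_on_def)
  from f4_three_distinct[OF this assms(5)] show ?thesis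
  proof (elim disjE)
    assume "x = c + \<zeta> i + \<zeta> j" with ijk \<zeta>[of i j] show ?thesis by (intro reachI[of "{i, j}"]) auto
  next
    assume "x = c + \<zeta> i + \<zeta> k" with ijk \<zeta>[of i k] show ?thesis by (intro reachI[of "{i, k}"]) auto
  next
    assume "x = c + \<zeta> j + \<zeta> k" with ijk \<zeta>[of j k] show ?thesis by (intro reachI[of "{j, k}"]) auto
  qed
qed

lemma reach_class_3:
  assumes A: "unit_class v c A" "card A \<ge> 3"
  shows "(\<exists>i j k. {i, j, k} \<subseteq> A \<and> distinct [i, j, k] \<and> ty v {i, j} c) \<or> (\<forall>x. x \<noteq> c \<longrightarrow> x \<in> reach v A)"
proof -
  obtain \<zeta> where \<zeta>: "\<And>i j. i \<in> A \<Longrightarrow> j \<in> A \<Longrightarrow> i \<noteq> j \<Longrightarrow> ty v {i, j} (c + \<zeta> i + \<zeta> j)"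
    using unit_class_types[OF A(1)] by metis
  show ?thesis
  proof (cases "inj_on \<zeta> A")
    case True
    then show ?thesis using reach_distinct[of v c A \<zeta>, OF A(1) \<zeta> _ A(2)] by blast
  next
    case False
    then obtain i j where ij: "i \<in> A" "j \<in> A" "i \<noteq> j" "\<zeta> i = \<zeta> j" by (auto simp: inj_on_def)
    then have "ty v {i, j} c" using \<zeta>[of i j] by (simp add: add.assoc)
    moreover have "card (A - {i, j}) \<noteq> 0" using card_minus_pair[of i j A] ij A(2) by simp
    then obtain k where "k \<in> A - {i, j}" by (metis all_not_in_conv card.empty)
    ultimately show ?thesis using ij by (intro disjI1 exI[of _ i] exI[of _ j] exI[of _ k]) auto
  qed
qed

text \<open>P will be membership in \<open>reach\<close>, and a a value of \<open>\<zeta>\<close>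
  taken twice; the hypotheses list the types of the pairs and of the quadruple.\<close>

lemma f4_reach_4:
  fixes a d e c :: f4
  assumes "c \<noteq> 0" "P c" "P (c + a + d)" "P (c + a + e)" "P (c + d + e)" "P (a + a + d + e)"
  shows "P 0 \<and> (P c \<or> (\<forall>x. x \<noteq> 0 \<longrightarrow> x \<noteq> c \<longrightarrow> P x)) \<or> (\<forall>x. x \<noteq> 0 \<longrightarrow> P x)"
  using assms by (cases a; cases d; cases e; cases c) (simp_all add: zero_f4_def f4_all)

lemma reach_class_4:
  assumes A: "unit_class v c A" "card A \<ge> 4"
  shows "0 \<in> reach v A \<and> (c \<in> reach v A \<or> (\<forall>x. x \<noteq> 0 \<longrightarrow> x \<noteq> c \<longrightarrow> x \<in> reach v A))
    \<or> (\<forall>x. x \<noteq> 0 \<longrightarrow> x \<in> reach v A)"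
proof -
  obtain \<zeta> where \<zeta>: "\<And>i j. i \<in> A \<Longrightarrow> j \<in> A \<Longrightarrow> i \<noteq> j \<Longrightarrow> ty v {i, j} (c + \<zeta> i + \<zeta> j)"
    and \<zeta>4: "\<And>i j k l. {i, j, k, l} \<subseteq> A \<Longrightarrow> distinct [i, j, k, l] \<Longrightarrow> ty v {i, j, k, l} (\<zeta> i + \<zeta> j + \<zeta> k + \<zeta> l)"
    using unit_class_types[OF A(1)] by metis
  have c: "c \<noteq> 0" using A(1) by (rule unit_classD(2))
  show ?thesis
  proof (cases "inj_on \<zeta> A")
    case True
    then have "x \<noteq> c \<Longrightarrow> x \<in> reach v A" for x
      using reach_distinct[of v c A \<zeta>, OF A(1) \<zeta>] A(2) by simp
    then show ?thesis using c by (intro disjI1 conjI disjI2 allI impI) simp_all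
  next
    case False
    then obtain i j where ij: "i \<in> A" "j \<in> A" "i \<noteq> j" "\<zeta> i = \<zeta> j" by (auto simp: inj_on_def)
    have "card (A - {i, j}) \<ge> 2" using card_minus_pair[of i j A] ij A(2) by simp
    then obtain k l where kl: "{k, l} \<subseteq> A - {i, j}" "distinct [k, l]" using two_elements by blast
    have pair: "c + \<zeta> p + \<zeta> q \<in> reach v A" if "p \<in> A" "q \<in> A" "p \<noteq> q" for p q
      using that \<zeta>[OF that] by (intro reachI[of "{p, q}"]) auto
    have "c \<in> reach v A" using pair[of i j] ij by (simp add: add.assoc)
    moreover have "c + \<zeta> i + \<zeta> k \<in> reach v A" "c + \<zeta> i + \<zeta> l \<in> reach v A" "c + \<zeta> k + \<zeta> l \<in> reach v A"
      using pair ij kl by auto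
    moreover have "\<zeta> i + \<zeta> i + \<zeta> k + \<zeta> l \<in> reach v A"
      using \<zeta>4[of i j k l] ij kl by (intro reachI[of "{i, j, k, l}"]) auto
    ultimately show ?thesis using f4_reach_4[OF c, of "\<lambda>x. x \<in> reach v A"] by blast
  qed
qed

lemma f4_reach_5_aux:
  fixes d e f c :: f4
  assumes "c \<noteq> 0" "P c" "P (c + d)" "P (c + e)" "P (c + f)" "P (c + d + e)" "P (c + d + f)"
    "P (c + e + f)" "P (d + e)" "P (d + f)" "P (e + f)" "P (d + e + f)"
  shows "(\<forall>x. P x) \<or> (d = 0 \<or> d = c) \<and> (e = 0 \<or> e = c) \<and> (f = 0 \<or> f = c)"
  using assms by (cases c; cases d; cases e; cases f) (simp_all add: zero_f4_def f4_all)

text \<open>Only sums of two or four values of \<open>\<zeta>\<close> occur, so translating all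
  values by a changes nothing and reduces the claim to a = 0. The exceptional case is that all
  values agree modulo {0, c}.\<close>

lemma f4_reach_5:
  fixes a d e f c :: f4
  assumes "c \<noteq> 0" "P c" "P (c + a + d)" "P (c + a + e)" "P (c + a + f)" "P (c + d + e)" "P (c + d + f)"
    "P (c + e + f)" "P (a + a + d + e)" "P (a + a + d + f)" "P (a + a + e + f)" "P (a + d + e + f)"
  shows "(\<forall>x. P x) \<or> (\<forall>x\<in>{a, d, e, f}. \<forall>y\<in>{a, d, e, f}. c + x + y = 0 \<or> c + x + y = c)"
proof -
  have cancel: "a + (a + x) = x" for x by (simp flip: add.assoc)
  have eqs: "c + (a + x) + (a + y) = c + x + y" "(a + x) + (a + y) = a + a + x + y"
    "(a + x) + (a + y) + (a + z) = a + x + y + z" for x y z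
    using cancel by (simp_all add: ac_simps)
  have "P (c + (a + d))" "P (c + (a + e))" "P (c + (a + f))"
    using assms(3-5) by (simp_all only: add.assoc)
  moreover have "P (c + (a + d) + (a + e))" "P (c + (a + d) + (a + f))" "P (c + (a + e) + (a + f))"
    using assms(6-8) by (simp_all only: eqs(1))
  moreover have "P ((a + d) + (a + e))" "P ((a + d) + (a + f))" "P ((a + e) + (a + f))"
    using assms(9-11) by (simp_all only: eqs(2))
  moreover have "P ((a + d) + (a + e) + (a + f))"
    using assms(12) by (simp only: eqs(3))
  ultimately have "(\<forall>x. P x) \<or> (a + d = 0 \<or> a + d = c) \<and> (a + e = 0 \<or> a + e = c) \<and> (a + f = 0 \<or> a + f = c)"
    using assms(1,2) by (intro f4_reach_5_aux[of c P "a + d" "a + e" "a + f"])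
  then show ?thesis
  proof
    assume *: "(a + d = 0 \<or> a + d = c) \<and> (a + e = 0 \<or> a + e = c) \<and> (a + f = 0 \<or> a + f = c)"
    have "a + x = 0 \<or> a + x = c" if "x \<in> {a, d, e, f}" for x using * that f4_double[of a] by blast
    moreover have "c + x + y = 0 \<or> c + x + y = c" if "a + x = 0 \<or> a + x = c" "a + y = 0 \<or> a + y = c" for x y
      using that assms(1) by (cases a; cases x; cases y; cases c) (simp_all add: zero_f4_def)
    ultimately show ?thesis by blast
  qed blast
qed

text \<open>By pigeonhole some value of \<open>\<zeta>\<close> is repeated. If a type is missed, the
  values agree modulo {0, c}, which is the situation of \<open>solv_half_class\<close>.\<close>

lemma reach_class_5:
  assumes A: "unit_class v c A" "card A \<ge> 5" "A \<subseteq> S"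
  shows "solv 1 v S \<or> reach v A = UNIV"
proof -
  obtain \<zeta> where \<zeta>: "\<And>i j. i \<in> A \<Longrightarrow> j \<in> A \<Longrightarrow> i \<noteq> j \<Longrightarrow> ty v {i, j} (c + \<zeta> i + \<zeta> j)"
    and \<zeta>4: "\<And>i j k l. {i, j, k, l} \<subseteq> A \<Longrightarrow> distinct [i, j, k, l] \<Longrightarrow> ty v {i, j, k, l} (\<zeta> i + \<zeta> j + \<zeta> k + \<zeta> l)"
    using unit_class_types[OF A(1)] by metis
  have c: "c \<noteq> 0" using A(1) by (rule unit_classD(2))
  have "\<not> inj_on \<zeta> A" using A(2) by (rule f4_not_inj_on)
  then obtain i j where ij: "i \<in> A" "j \<in> A" "i \<noteq> j" "\<zeta> i = \<zeta> j" by (auto simp: inj_on_def)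
  have "card (A - {i, j}) \<ge> 3" using card_minus_pair[of i j A] ij A(2) by simp
  then obtain k l p where klp: "{k, l, p} \<subseteq> A - {i, j}" "distinct [k, l, p]" using three_elements by blast
  have pair: "c + \<zeta> p + \<zeta> q \<in> reach v A" if "p \<in> A" "q \<in> A" "p \<noteq> q" for p q
    using that \<zeta>[OF that] by (intro reachI[of "{p, q}"]) auto
  have quad: "\<zeta> i + \<zeta> j + \<zeta> k + \<zeta> l \<in> reach v A" if "{i, j, k, l} \<subseteq> A" "distinct [i, j, k, l]" for i j k l
    using that \<zeta>4[OF that] by (intro reachI[of "{i, j, k, l}"]) auto
  have "c \<in> reach v A" using pair[of i j] ij by (simp add: add.assoc)
  moreover have "c + \<zeta> i + \<zeta> k \<in> reach v A" "c + \<zeta> i + \<zeta> l \<in> reach v A" "c + \<zeta> i + \<zeta> p \<in> reach v A"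
    "c + \<zeta> k + \<zeta> l \<in> reach v A" "c + \<zeta> k + \<zeta> p \<in> reach v A" "c + \<zeta> l + \<zeta> p \<in> reach v A"
    using pair ij klp by auto
  moreover have "\<zeta> i + \<zeta> i + \<zeta> k + \<zeta> l \<in> reach v A" "\<zeta> i + \<zeta> i + \<zeta> k + \<zeta> p \<in> reach v A"
    "\<zeta> i + \<zeta> i + \<zeta> l + \<zeta> p \<in> reach v A" "\<zeta> i + \<zeta> k + \<zeta> l + \<zeta> p \<in> reach v A"
    using quad[of i j k l] quad[of i j k p] quad[of i j l p] quad[of i k l p] ij klp by auto
  ultimately have "(\<forall>x. x \<in> reach v A) \<or>
    (\<forall>x\<in>{\<zeta> i, \<zeta> k, \<zeta> l, \<zeta> p}. \<forall>y\<in>{\<zeta> i, \<zeta> k, \<zeta> l, \<zeta> p}. c + x + y = 0 \<or> c + x + y = c)"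
    using f4_reach_5[OF c, of "\<lambda>x. x \<in> reach v A" "\<zeta> i" "\<zeta> k" "\<zeta> l" "\<zeta> p"] by blast
  then show ?thesis
  proof
    assume half: "\<forall>x\<in>{\<zeta> i, \<zeta> k, \<zeta> l, \<zeta> p}. \<forall>y\<in>{\<zeta> i, \<zeta> k, \<zeta> l, \<zeta> p}. c + x + y = 0 \<or> c + x + y = c"
    define F where "F = {i, j, k, l, p}"
    have F: "card F = 5" "F \<subseteq> A" "finite F" using ij klp by (auto simp: F_def)
    have "\<zeta> ` F = {\<zeta> i, \<zeta> k, \<zeta> l, \<zeta> p}" using ij(4) by (auto simp: F_def)
    then have "c + \<zeta> q + \<zeta> r = 0 \<or> c + \<zeta> q + \<zeta> r = c" if "q \<in> F" "r \<in> F" for q r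
      using half that by blast
    then have "sum v {q, r} \<in> N c 1" if "q \<in> F" "r \<in> F" "q \<noteq> r" for q r
      using ty_in_N1[OF \<zeta>[of q r], of c] that F(2) by blast
    then have "v q + v r \<in> N c 1" if "q \<in> F" "r \<in> F" "q \<noteq> r" for q r
      using that(1,2) \<open>\<And>r q. q \<in> F \<Longrightarrow> r \<in> F \<Longrightarrow> q \<noteq> r \<Longrightarrow> sum v {q, r} \<in> N c 1\<close>[OF that] that(3)
      by (simp only: sum.insert sum.empty finite.intros insert_iff empty_iff simp_thms add_0_right)
    then have "solv 1 v S"
      using F A(3) unit_classD(1)[OF A(1)] c by (intro solv_half_class[of F S v c]) (blast | simp)+
    then show ?thesis ..
  qed auto
qed

lemma solv_ty_zero:
  assumes "J \<subseteq> S" "finite J" "i \<in> J" "j \<in> J" "par (v i) = c" "par (v j) = c'" "c \<noteq> c'" "c \<noteq> 0" "c' \<noteq> 0" "ty v J 0"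
  shows "solv 1 v S"
  using assms ty_four_dvd[OF assms(10)] by (intro solv_two_classes[of J S i j v]) auto

text \<open>Equal types cancel in characteristic 2, and units of two classes take part. So in an
  unsolvable configuration different classes reach disjoint sets of types.\<close>

lemma solv_reach_2:
  assumes A: "unit_class v c A" "A \<subseteq> S" and A': "unit_class v c' A'" "A' \<subseteq> S" and "c \<noteq> c'"
    and x: "x \<in> reach v A" "x \<in> reach v A'"
  shows "solv 1 v S"
proof -
  obtain J where J: "J \<subseteq> A" "finite J" "J \<noteq> {}" "ty v J x" using x(1) by (auto simp: reach_def)
  obtain K where K: "K \<subseteq> A'" "finite K" "K \<noteq> {}" "ty v K x" using x(2) by (auto simp: reach_def)
  have "ty v (J \<union> K) 0"
    using ty_union[of J K v x x] J K unit_class_disjoint[OF A(1) A'(1) assms(5)] by auto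
  moreover obtain i j where "i \<in> J" "j \<in> K" using J K by blast
  ultimately show ?thesis
    using J K A(2) A'(2) unit_classD(1,2)[OF A(1)] unit_classD(1,2)[OF A'(1)] assms(5)
    by (intro solv_ty_zero[of "J \<union> K" S i j v c c']) blast+
qed

lemma solv_reach_3:
  assumes A: "unit_class v c A" "A \<subseteq> S" and A': "unit_class v c' A'" "A' \<subseteq> S"
    and A'': "unit_class v c'' A''" "A'' \<subseteq> S" and ne: "c \<noteq> c'" "c \<noteq> c''" "c' \<noteq> c''"
    and x: "x \<in> reach v A" "y \<in> reach v A'" "z \<in> reach v A''" "x + y = z"
  shows "solv 1 v S"
proof -
  obtain J where J: "J \<subseteq> A" "finite J" "J \<noteq> {}" "ty v J x" using x(1) by (auto simp: reach_def)
  obtain K where K: "K \<subseteq> A'" "finite K" "K \<noteq> {}" "ty v K y" using x(2) by (auto simp: reach_def)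
  obtain L where L: "L \<subseteq> A''" "finite L" "L \<noteq> {}" "ty v L z" using x(3) by (auto simp: reach_def)
  have "ty v (J \<union> K) z"
    using ty_union[of J K v x y] J K x(4) unit_class_disjoint[OF A(1) A'(1) ne(1)] by auto
  moreover have "(J \<union> K) \<inter> L = {}"
    using J(1) K(1) L(1) unit_class_disjoint[OF A(1) A''(1) ne(2)]
      unit_class_disjoint[OF A'(1) A''(1) ne(3)] by blast
  ultimately have "ty v (J \<union> K \<union> L) 0"
    using ty_union[of "J \<union> K" L v z z] J K L by simp
  moreover obtain i j where "i \<in> J" "j \<in> K" using J K by blast
  ultimately show ?thesis
    using J K L A(2) A'(2) A''(2) unit_classD(1,2)[OF A(1)] unit_classD(1,2)[OF A'(1)] ne(1)
    by (intro solv_ty_zero[of "J \<union> K \<union> L" S i j v c c']) blast+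
qed

lemma reach_class_2:
  assumes A: "unit_class v c A" "card A \<ge> 2"
  shows "\<exists>x. x \<in> reach v A"
proof -
  obtain i j where ij: "{i, j} \<subseteq> A" "distinct [i, j]" using two_elements[OF A(2)] by blast
  moreover have "par (sum v {i, j}) = 0" using ij unit_classD(1)[OF A(1)] by simp
  then obtain x where "ty v {i, j} x" using ty_of_par_0 by blast
  ultimately show ?thesis using reachI[of "{i, j}" A v x] by auto
qed

lemma solv_classes_5_2:
  assumes A: "unit_class v c A" "A \<subseteq> S" "card A \<ge> 5" and A': "unit_class v c' A'" "A' \<subseteq> S" "card A' \<ge> 2"
    and "c \<noteq> c'"
  shows "solv 1 v S"
  using reach_class_5[OF A(1,3,2)] reach_class_2[OF A'(1,3)] solv_reach_2[OF A(1,2) A'(1,2) assms(7)] by auto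

text \<open>Without the pair of type c, A reaches every type but c. The other class reaches c' or 0,
  both different from c, so a type is shared.\<close>

lemma reach_classes_3_3:
  assumes A: "unit_class v c A" "A \<subseteq> S" "card A \<ge> 3" and A': "unit_class v c' A'" "A' \<subseteq> S" "card A' \<ge> 3"
    and ne: "c \<noteq> c'"
  shows "solv 1 v S \<or> (\<exists>i j k. {i, j, k} \<subseteq> A \<and> distinct [i, j, k] \<and> ty v {i, j} c)"
proof (rule disjCI)
  assume "\<not> (\<exists>i j k. {i, j, k} \<subseteq> A \<and> distinct [i, j, k] \<and> ty v {i, j} c)"
  then have all: "x \<noteq> c \<Longrightarrow> x \<in> reach v A" for x using reach_class_3[OF A(1,3)] by blast
  have "c' \<in> reach v A' \<or> 0 \<in> reach v A'"
    using reach_class_3[OF A'(1,3)]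
  proof
    assume "\<exists>i j k. {i, j, k} \<subseteq> A' \<and> distinct [i, j, k] \<and> ty v {i, j} c'"
    then obtain i j where "{i, j} \<subseteq> A'" "ty v {i, j} c'" by blast
    then show ?thesis using reachI[of "{i, j}" A' v c'] by auto
  next
    assume "\<forall>x. x \<noteq> c' \<longrightarrow> x \<in> reach v A'"
    then show ?thesis using unit_classD(2)[OF A'(1)] by metis
  qed
  then show "solv 1 v S"
    using all[of c'] all[of 0] ne unit_classD(2)[OF A(1)] solv_reach_2[OF A(1,2) A'(1,2) ne] by metis
qed

lemma pair_reach: "{i, j, k} \<subseteq> A \<Longrightarrow> ty v {i, j} c \<Longrightarrow> c \<in> reach v A"
  using reachI[of "{i, j}" A v c] by auto

lemma f4_sum_of_others: "a \<noteq> b \<Longrightarrow> a \<noteq> c \<Longrightarrow> b \<noteq> c \<Longrightarrow> a \<noteq> 0 \<Longrightarrow> b \<noteq> 0 \<Longrightarrow> c \<noteq> 0 \<Longrightarrow> a + b = (c::f4)"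
  by (cases a; cases b; cases c) (simp_all add: zero_f4_def)

lemma f4_nonzero_cases: "a \<noteq> b \<Longrightarrow> a \<noteq> c \<Longrightarrow> b \<noteq> c \<Longrightarrow> a \<noteq> 0 \<Longrightarrow> b \<noteq> 0 \<Longrightarrow> c \<noteq> 0 \<Longrightarrow> x = 0 \<or> x = a \<or> x = b \<or> x = (c::f4)"
  by (cases a; cases b; cases c; cases x) (simp_all add: zero_f4_def)

section \<open>Configurations on two consecutive levels\<close>

lemma sorted_unit_classes:
  assumes A: "finite A" "\<And>i. i \<in> A \<Longrightarrow> par (v i) \<noteq> 0"
  obtains a b c A1 A2 A3 where "unit_class v a A1" "unit_class v b A2" "unit_class v c A3"
    "a \<noteq> b" "a \<noteq> c" "b \<noteq> c" "A1 \<subseteq> A" "A2 \<subseteq> A" "A3 \<subseteq> A"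
    "card A1 \<ge> card A2" "card A2 \<ge> card A3" "card A = card A1 + card A2 + card A3"
proof -
  define C where "C x = {i\<in>A. par (v i) = x}" for x
  have "\<exists>(a, b, c)\<in>{(F1, FW, FV), (F1, FV, FW), (FW, F1, FV), (FW, FV, F1), (FV, F1, FW), (FV, FW, F1)}.
      card (C a) \<ge> card (C b) \<and> card (C b) \<ge> card (C c)"
    by simp linarith
  then obtain a b c where abc: "(a, b, c) \<in> {(F1, FW, FV), (F1, FV, FW), (FW, F1, FV), (FW, FV, F1), (FV, F1, FW), (FV, FW, F1)}"
    and le: "card (C a) \<ge> card (C b)" "card (C b) \<ge> card (C c)" by blast
  have ne: "a \<noteq> b" "a \<noteq> c" "b \<noteq> c" "a \<noteq> 0" "b \<noteq> 0" "c \<noteq> 0" using abc by (auto simp: zero_f4_def)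
  have "A = C a \<union> (C b \<union> C c)"
    using A(2) f4_nonzero_cases[OF ne(1-6)] unfolding C_def by blast
  moreover have "C a \<inter> (C b \<union> C c) = {}" "C b \<inter> C c = {}" using ne by (auto simp: C_def)
  moreover have fin: "finite (C x)" for x using A(1) by (simp add: C_def)
  ultimately have "card A = card (C a) + (card (C b) + card (C c))"
    by (metis card_Un_disjoint finite_UnI)
  moreover have "unit_class v x (C x)" if "x \<noteq> 0" for x
    using that fin by (simp add: unit_class_def C_def)
  moreover have "C x \<subseteq> A" for x by (auto simp: C_def)
  ultimately show thesis using ne le by (intro that[of a "C a" b "C b" c "C c"]) auto
qed

lemma unit_class_solv_7:
  assumes "unit_class v c A" "A \<subseteq> S" "card A \<ge> 7" shows "solv 1 v S"
  by (rule solv_class_7[of A S v c, OF assms(3,2) unit_classD(1)[OF assms(1)] unit_classD(2)[OF assms(1)]])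

lemma solv_or_reach_class:
  assumes "unit_class v c A" "A \<subseteq> S" "card A \<ge> 3" "unit_class v c' A'" "A' \<subseteq> S" "card A' \<ge> 3" "c \<noteq> c'"
  shows "solv 1 v S \<or> c \<in> reach v A"
  using reach_classes_3_3[OF assms]
proof
  assume "\<exists>i j k. {i, j, k} \<subseteq> A \<and> distinct [i, j, k] \<and> ty v {i, j} c"
  then obtain i j k where "{i, j, k} \<subseteq> A" "ty v {i, j} c" by (elim exE conjE)
  from pair_reach[OF this] show ?thesis ..
qed simp

text \<open>A class of five or more is settled directly, which leaves the sizes 4+4, 4+3+2 and
  3+3+3. If there is no solution, classes reach disjoint sets of types, equal pairs give a and b,
  and a fourth unit adds 0. Two classes cannot share 0, and since a + b = c, the third class cannot
  reach c either.\<close>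

lemma solv_units_9:
  assumes A: "A \<subseteq> S" "finite A" "card A \<ge> 9" "\<And>i. i \<in> A \<Longrightarrow> par (v i) \<noteq> 0"
  shows "solv 1 v S"
proof -
  obtain a b c A1 A2 A3 where cls: "unit_class v a A1" "unit_class v b A2" "unit_class v c A3"
    and ne: "a \<noteq> b" "a \<noteq> c" "b \<noteq> c" and sub: "A1 \<subseteq> A" "A2 \<subseteq> A" "A3 \<subseteq> A"
    and le: "card A1 \<ge> card A2" "card A2 \<ge> card A3" and card: "card A = card A1 + card A2 + card A3"
    by (rule sorted_unit_classes[of A v, OF A(2) A(4)])
  have sub: "A1 \<subseteq> S" "A2 \<subseteq> S" "A3 \<subseteq> S" using sub A(1) by auto
  note nz = unit_classD(2)[OF cls(1)] unit_classD(2)[OF cls(2)] unit_classD(2)[OF cls(3)]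
  note two12 = solv_reach_2[OF cls(1) sub(1) cls(2) sub(2) ne(1)]
  note two13 = solv_reach_2[OF cls(1) sub(1) cls(3) sub(3) ne(2)]
  note two23 = solv_reach_2[OF cls(2) sub(2) cls(3) sub(3) ne(3)]
  note three = solv_reach_3[OF cls(1) sub(1) cls(2) sub(2) cls(3) sub(3) ne]
  have abc: "a + b = c" using f4_sum_of_others[OF ne nz] .
  show ?thesis
  proof (cases "card A1 \<ge> 5")
    case True
    then have "card A1 \<ge> 7 \<or> card A2 \<ge> 2" using le card A(3) by linarith
    then show ?thesis
      using unit_class_solv_7[OF cls(1) sub(1)] solv_classes_5_2[OF cls(1) sub(1) True cls(2) sub(2) _ ne(1)] by blast
  next
    case False
    then have n: "card A1 \<ge> 3" "card A2 \<ge> 3" using le card A(3) by linarith+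
    show ?thesis
    proof (rule ccontr)
      assume no: "\<not> ?thesis"
      have a: "a \<in> reach v A1"
        using solv_or_reach_class[OF cls(1) sub(1) n(1) cls(2) sub(2) n(2) ne(1)] no by blast
      have b: "b \<in> reach v A2"
        using solv_or_reach_class[OF cls(2) sub(2) n(2) cls(1) sub(1) n(1) ne(1)[symmetric]] no by blast
      have zero1: "0 \<in> reach v A1" if "card A1 \<ge> 4"
        using reach_class_4[OF cls(1) that] two12[of b] b nz no by blast
      have zero2: "0 \<in> reach v A2" if "card A2 \<ge> 4"
        using reach_class_4[OF cls(2) that] two12[of a] a nz no by blast
      consider "card A2 \<ge> 4" | "card A1 \<ge> 4" "card A3 \<ge> 2" | "card A3 \<ge> 3"
        using le card A(3) False by linarith
      then show False
      proof cases
        case 1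
        then show False using zero1 zero2 le two12[of 0] no by auto
      next
        case 2
        obtain w where w: "w \<in> reach v A3" using reach_class_2[OF cls(3) 2(2)] by blast
        have "w \<noteq> 0" using two13[OF zero1[OF 2(1)]] w no by blast
        moreover have "w \<noteq> a" using two13[OF a] w no by blast
        moreover have "w \<noteq> b" using two23[OF b] w no by blast
        ultimately have "w = c" using f4_nonzero_cases[OF ne nz] by blast
        then show False using three[OF a b w] abc no by blast
      next
        case 3
        have "c \<in> reach v A3"
          using solv_or_reach_class[OF cls(3) sub(3) 3 cls(1) sub(1) n(1) ne(2)[symmetric]] no by blast
        then show False using three[OF a b _ abc] no by blast
      qed
    qed
  qed
qed

section \<open>Units of level 0 together with elements of level 1\<close>

lemma ty_singleton: "v b = 2 * t \<Longrightarrow> ty v {b} (par t)"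
  by (auto simp: ty_def)

text \<open>An element 2 t of level 1 can add its residue to a type, so types matter only modulo {0,
  \<open>par t\<close>}.\<close>

lemma solv_ty_level_one:
  assumes J: "J \<subseteq> S" "finite J" "i \<in> J" "j \<in> J" "par (v i) = c" "par (v j) = c'" "c \<noteq> c'" "c \<noteq> 0" "c' \<noteq> 0"
    and ty: "ty v J x" "x = 0 \<or> x = par t" and b: "b \<in> S - J" "v b = 2 * t"
  shows "solv 1 v S"
  using ty(2)
proof
  assume "x = 0"
  then show ?thesis using solv_ty_zero[of J S i j v c c'] J ty(1) by blast
next
  assume "x = par t"
  then have "ty v (J \<union> {b}) 0"
    using ty_union[of J "{b}" v x "par t"] J(2) b(1) ty(1) ty_singleton[of v b t] b(2) by auto
  then show ?thesis using J b(1) by (intro solv_ty_zero[of "J \<union> {b}" S i j v c c']) auto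
qed

lemma solv_reach_2_level_one:
  assumes A: "unit_class v c A" "A \<subseteq> S" and A': "unit_class v c' A'" "A' \<subseteq> S" and "c \<noteq> c'"
    and x: "x \<in> reach v A" "y \<in> reach v A'" "x + y = 0 \<or> x + y = par t"
    and b: "b \<in> S - (A \<union> A')" "v b = 2 * t"
  shows "solv 1 v S"
proof -
  obtain J where J: "J \<subseteq> A" "finite J" "J \<noteq> {}" "ty v J x" using x(1) by (auto simp: reach_def)
  obtain K where K: "K \<subseteq> A'" "finite K" "K \<noteq> {}" "ty v K y" using x(2) by (auto simp: reach_def)
  have "ty v (J \<union> K) (x + y)"
    using ty_union[of J K v x y] J K unit_class_disjoint[OF A(1) A'(1) assms(5)] by auto
  moreover obtain i j where "i \<in> J" "j \<in> K" using J K by blast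
  ultimately show ?thesis
    using J K A(2) A'(2) unit_classD(1,2)[OF A(1)] unit_classD(1,2)[OF A'(1)] assms(5) x(3) b
    by (intro solv_ty_level_one[of "J \<union> K" S i j v c c' "x + y" t b]) blast+
qed

text \<open>One unit of each class together with a pair of type \<open>c \<notin> {0, par t}\<close>: the types of the
  triple and of the triple with the pair added differ modulo \<open>{0, par t}\<close>.\<close>

lemma solv_triple_pair_level_one:
  assumes p: "{p, q, r} \<subseteq> S" "distinct [p, q, r]" "par (v p) = a" "par (v q) = b" "par (v r) = c"
    and ne: "a \<noteq> b" "a \<noteq> c" "b \<noteq> c" "a \<noteq> 0" "b \<noteq> 0" "c \<noteq> 0"
    and K: "K \<subseteq> S - {p, q, r}" "finite K" "ty v K x" "x \<noteq> 0" "x \<noteq> par t"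
    and e: "e \<in> S - ({p, q, r} \<union> K)" "v e = 2 * t" "par t \<noteq> 0"
  shows "solv 1 v S"
proof -
  have "a + b + c = 0" using f4_sum_of_others[OF ne] by simp
  then have "par (sum v {p, q, r}) = 0" using p by (simp add: add.assoc)
  then obtain y where y: "ty v {p, q, r} y" using ty_of_par_0 by blast
  have yx: "ty v ({p, q, r} \<union> K) (y + x)" using ty_union[OF _ K(2) _ y K(3)] K(1) by blast
  have "(y = 0 \<or> y = par t) \<or> (y + x = 0 \<or> y + x = par t)"
    using f4_index_two[of y "par t" x] K(4,5) e(3) by blast
  then show ?thesis
  proof
    assume "y = 0 \<or> y = par t"
    then show ?thesis using solv_ty_level_one[of "{p, q, r}" S p q v a b y t e] p ne e y by auto
  next
    assume "y + x = 0 \<or> y + x = par t"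
    then show ?thesis
      using solv_ty_level_one[of "{p, q, r} \<union> K" S p q v a b "y + x" t e] p ne e yx K by auto
  qed
qed

lemma unit_class_equal_pair:
  assumes A: "unit_class v c A" "card A \<ge> 5"
  shows "\<exists>i j k. {i, j, k} \<subseteq> A \<and> distinct [i, j, k] \<and> ty v {i, j} c"
proof -
  obtain \<zeta> where \<zeta>: "\<And>i j. i \<in> A \<Longrightarrow> j \<in> A \<Longrightarrow> i \<noteq> j \<Longrightarrow> ty v {i, j} (c + \<zeta> i + \<zeta> j)"
    using unit_class_types[OF A(1)] by metis
  have "\<not> inj_on \<zeta> A" using A(2) by (rule f4_not_inj_on)
  then obtain i j where ij: "i \<in> A" "j \<in> A" "i \<noteq> j" "\<zeta> i = \<zeta> j" by (auto simp: inj_on_def)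
  then have "ty v {i, j} c" using \<zeta>[of i j] by (simp add: add.assoc)
  moreover have "card (A - {i, j}) \<noteq> 0" using card_minus_pair[of i j A] ij A(2) by simp
  then obtain k where "k \<in> A - {i, j}" by (metis all_not_in_conv card.empty)
  ultimately show ?thesis using ij by (intro exI[of _ i] exI[of _ j] exI[of _ k]) auto
qed

lemma solv_class_5_level_one:
  assumes A: "card A \<ge> 5" "A \<subseteq> S" "\<And>i. i \<in> A \<Longrightarrow> par (v i) = c" and c: "c \<noteq> 0"
    and b: "b \<in> S - A" "v b = 2 * t" "par t = c"
  shows "solv 1 v S"
proof -
  obtain i j k l where ijkl: "{i, j, k, l} \<subseteq> A" "distinct [i, j, k, l]"
    "v i + v j \<in> N c 1" "v k + v l \<in> N c 1" "card (A - {i, j, k, l}) = card A - 4"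
    using class_two_pairs[of A v c, OF A(1) A(3) c] by blast
  have "par t \<noteq> 0" using b c by simp
  have lev: "v b \<in> N c 1 \<longleftrightarrow> par t = c" "v b \<notin> N c 2"
    by (rule level_one_in_N[OF b(2) \<open>par t \<noteq> 0\<close>])+
  show ?thesis
  proof (rule solv_two_pairs[of i j k l S "{b}" v c])
    show "{i, j, k, l} \<subseteq> S - {b}" "{b} \<subseteq> S" using ijkl(1) A(2) b(1) by blast+
  qed (use ijkl lev b(3) A(3) c in simp_all)
qed

text \<open>B and E together lie in Z a + 4 O, with a taken from B. The last hypothesis on E forces
  the zero sum found there to use a unit of B.\<close>

lemma solv_half_class_with:
  assumes B: "unit_class v c B" "B \<subseteq> S" "B \<noteq> {}"
    and half: "\<And>i j. i \<in> B \<Longrightarrow> j \<in> B \<Longrightarrow> i \<noteq> j \<Longrightarrow> v i + v j \<in> N c 1"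
    and E: "E \<subseteq> S - B" "finite E" "card B + card E \<ge> 5" "\<And>e. e \<in> E \<Longrightarrow> v e \<in> N c 1"
      "\<And>K. K \<subseteq> E \<Longrightarrow> K \<noteq> {} \<Longrightarrow> sum v K \<notin> N c 2"
  shows "solv 1 v S"
proof -
  have c: "c \<noteq> 0" and fin: "finite B" using unit_classD(2,3)[OF B(1)] .
  have par: "par (v i) = c" if "i \<in> B" for i using unit_classD(1)[OF B(1) that] .
  obtain i where i: "i \<in> B" using B(3) by blast
  show ?thesis
  proof (rule solv_half_lattice[of "B \<union> E" S c "v i" v])
    show "B \<union> E \<subseteq> S" using B(2) E(1) by blast
    have "B \<inter> E = {}" using E(1) by blast
    then show "5 \<le> card (B \<union> E)" using E(2,3) fin by (simp add: card_Un_disjoint)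
    fix j assume "j \<in> B \<union> E"
    then consider "j \<in> E" | "j = i" | "j \<in> B" "j \<noteq> i" by blast
    then show "v j \<in> N c 1 \<or> v j + v i \<in> N c 1"
    proof cases
      case 2
      have "2 * v i \<in> N c 1" using par[OF i] by (simp only: two_mult_in_N1 simp_thms)
      then show ?thesis using 2 by (simp only: mult_2 simp_thms)
    qed (use E(4) half i in auto)
  next
    fix K assume K: "K \<subseteq> B \<union> E" "K \<noteq> {}" "\<And>i. i \<in> K \<Longrightarrow> par (v i) \<noteq> c"
    then have "K \<subseteq> E" using par by blast
    then show "sum v K \<notin> N c 2" using E(5) K(2) by blast
  qed (use fin E(2) c par[OF i] in simp_all)
qed

lemma solv_class_4_half:
  assumes A: "unit_class v c A" "A \<subseteq> S" "card A \<ge> 4"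
    and half: "\<And>i j. i \<in> A \<Longrightarrow> j \<in> A \<Longrightarrow> i \<noteq> j \<Longrightarrow> v i + v j \<in> N c 1"
    and b: "b \<in> S - A" "v b = 2 * t" "par t = c"
  shows "solv 1 v S"
proof -
  have "par t \<noteq> 0" using unit_classD(2)[OF A(1)] b(3) by simp
  then have "v b \<in> N c 1 \<longleftrightarrow> par t = c" and vb: "v b \<notin> N c 2"
    by (rule level_one_in_N[OF b(2)])+
  moreover have "sum v K \<notin> N c 2" if "K \<subseteq> {b}" "K \<noteq> {}" for K
  proof -
    have "K = {b}" using that by blast
    then show ?thesis using vb by simp
  qed
  moreover have "A \<noteq> {}" using A(3) by auto
  ultimately show ?thesis
    using A b(1,3) half by (intro solv_half_class_with[of v c A S "{b}"]) simp_all
qed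

lemma f4_mod_sum: "x0 = 0 \<or> x0 = b \<Longrightarrow> x1 \<noteq> 0 \<Longrightarrow> x1 \<noteq> b \<Longrightarrow> b \<noteq> 0 \<Longrightarrow>
    x0 + w = 0 \<or> x0 + w = b \<or> x1 + w = 0 \<or> x1 + w = (b::f4)"
  by (cases x0; cases x1; cases b; cases w) (simp_all add: zero_f4_def)

lemma f4_mod_three: "b \<noteq> 0 \<Longrightarrow> x + y = 0 \<or> x + y = b \<or> x + z = 0 \<or> x + z = b \<or> y + z = 0 \<or> y + z = (b::f4)"
  by (cases b; cases x; cases y; cases z) (simp_all add: zero_f4_def)

text \<open>The two witnesses represent both classes of F_4 modulo {0, \<open>par t\<close>}. If
  \<open>par t = c\<close> and only one of them is reached, all pair sums lie in
  \<open>N c 1\<close> and b is a fifth element of Z a + 4 O.\<close>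

lemma reach_4_mod:
  assumes A: "unit_class v c A" "A \<subseteq> S" "card A \<ge> 4" and b: "b \<in> S - A" "v b = 2 * t" "par t \<noteq> 0"
  shows "solv 1 v S \<or> (\<exists>x0\<in>reach v A. \<exists>x1\<in>reach v A. (x0 = 0 \<or> x0 = par t) \<and> x1 \<noteq> 0 \<and> x1 \<noteq> par t)"
proof (cases "par t = c")
  case True
  have c: "c \<noteq> 0" using unit_classD(2)[OF A(1)] .
  have par: "par (v i) = c" if "i \<in> A" for i using unit_classD(1)[OF A(1) that] .
  show ?thesis
  proof (cases "\<forall>i\<in>A. \<forall>j\<in>A. i \<noteq> j \<longrightarrow> v i + v j \<in> N c 1")
    case True
    then show ?thesis using solv_class_4_half[OF A _ b(1,2) \<open>par t = c\<close>] by blast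
  next
    case False
    have ty: "\<exists>x. ty v {i, j} x \<and> x \<in> reach v A \<and> (v i + v j \<in> N c 1 \<longleftrightarrow> x = 0 \<or> x = c)"
      if "i \<in> A" "j \<in> A" "i \<noteq> j" for i j
    proof -
      have "par (sum v {i, j}) = 0" using that par by simp
      then obtain x where x: "ty v {i, j} x" using ty_of_par_0 by blast
      then have "sum v {i, j} \<in> N c 1 \<longleftrightarrow> x = 0 \<or> x = c" by (rule ty_in_N1)
      moreover have "sum v {i, j} = v i + v j" using that by simp
      moreover have "x \<in> reach v A" using that x by (intro reachI[of "{i, j}"]) auto
      ultimately show ?thesis using x by auto
    qed
    obtain i j where "i \<in> A" "j \<in> A" "i \<noteq> j" "v i + v j \<notin> N c 1" using False by blast
    then obtain x1 where x1: "x1 \<in> reach v A" "x1 \<noteq> 0" "x1 \<noteq> c" using ty by blast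
    have "card A \<ge> 3" using A(3) by simp
    then obtain k l where kl: "{k, l} \<subseteq> A" "k \<noteq> l" "v k + v l \<in> N c 1"
      using class_pair_in_N1[of A v c, OF _ par c] by blast
    then obtain x0 where "x0 \<in> reach v A" "x0 = 0 \<or> x0 = c" using ty[of k l] by blast
    with x1 True show ?thesis by blast
  qed
next
  case False
  have c: "c \<noteq> 0" using unit_classD(2)[OF A(1)] .
  consider "0 \<in> reach v A" "c \<in> reach v A" | "0 \<in> reach v A" "\<forall>x. x \<noteq> 0 \<longrightarrow> x \<noteq> c \<longrightarrow> x \<in> reach v A"
    | "\<forall>x. x \<noteq> 0 \<longrightarrow> x \<in> reach v A"
    using reach_class_4[OF A(1,3)] by blast
  then show ?thesis
  proof cases
    case 1
    then show ?thesis using c False by blast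
  next
    case 2
    have "par t + c \<noteq> 0" "par t + c \<noteq> c" "par t + c \<noteq> par t"
      using b(3) c False by (simp_all add: f4_add_eq_0_iff)
    then show ?thesis using 2 by blast
  next
    case 3
    then show ?thesis using c False b(3) by blast
  qed
qed

text \<open>With e available, types count in a group of order 2, so two of three types agree, and
  four units of one class can match any type of another class. The remaining cases use one unit of
  each class, together with a pair.\<close>

lemma solv_units_7_level_one:
  assumes A: "A \<subseteq> S" "finite A" "card A \<ge> 7" "\<And>i. i \<in> A \<Longrightarrow> par (v i) \<noteq> 0"
    and e: "e \<in> S - A" "v e = 2 * t" "par t \<noteq> 0"
  shows "solv 1 v S"
proof -
  obtain a b c A1 A2 A3 where cls: "unit_class v a A1" "unit_class v b A2" "unit_class v c A3"
    and ne: "a \<noteq> b" "a \<noteq> c" "b \<noteq> c" and sub': "A1 \<subseteq> A" "A2 \<subseteq> A" "A3 \<subseteq> A"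
    and le: "card A1 \<ge> card A2" "card A2 \<ge> card A3" and card: "card A = card A1 + card A2 + card A3"
    by (rule sorted_unit_classes[of A v, OF A(2) A(4)])
  have sub: "A1 \<subseteq> S" "A2 \<subseteq> S" "A3 \<subseteq> S" using sub' A(1) by auto
  note nz = unit_classD(2)[OF cls(1)] unit_classD(2)[OF cls(2)] unit_classD(2)[OF cls(3)]
  note p1 = unit_classD(1)[OF cls(1)] note p2 = unit_classD(1)[OF cls(2)] note p3 = unit_classD(1)[OF cls(3)]
  have disj: "A1 \<inter> A2 = {}" "A1 \<inter> A3 = {}" "A2 \<inter> A3 = {}"
    using unit_class_disjoint[OF cls(1,2) ne(1)] unit_class_disjoint[OF cls(1,3) ne(2)]
      unit_class_disjoint[OF cls(2,3) ne(3)] .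
  have e1: "e \<in> S - A1" using e(1) sub' by blast
  have triple: "solv 1 v S" if pqr: "p \<in> A1" "q \<in> A2" "r \<in> A3" and K: "K \<subseteq> A - {p, q, r}" "ty v K x" "x \<noteq> 0" "x \<noteq> par t"
    for p q r K x
  proof (rule solv_triple_pair_level_one[of p q r S v a b c K x t e])
    show "{p, q, r} \<subseteq> S" "e \<in> S - ({p, q, r} \<union> K)" "K \<subseteq> S - {p, q, r}" using pqr sub sub' e(1) K(1) A(1) by blast+
    show "distinct [p, q, r]" using pqr disj by auto
    show "finite K" using K(1) A(2) by (meson Diff_subset finite_subset)
  qed (use pqr p1 p2 p3 ne nz K e in simp_all)
  have nonempty: "\<exists>x. x \<in> X" if "card X \<ge> 1" for X :: "'a set" using that by (cases "X = {}") auto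
  consider "card A1 \<ge> 6" | "card A1 \<ge> 5" "card A2 \<ge> 2" | "card A1 \<ge> 5" "card A2 \<ge> 1" "card A3 \<ge> 1"
    | "card A1 \<ge> 4" "card A2 \<ge> 2" | "card A1 \<ge> 3" "card A2 \<ge> 3" "card A3 \<ge> 1"
    | "card A1 \<ge> 2" "card A2 \<ge> 2" "card A3 \<ge> 2"
    using le card A(3) by linarith
  then show ?thesis
  proof cases
    case 1
    show ?thesis using solv_class_6[of A1 S v a e t, OF 1 sub(1) p1 nz(1) e1 e(2,3)] .
  next
    case 2
    then show ?thesis using solv_classes_5_2[OF cls(1) sub(1) _ cls(2) sub(2) _ ne(1)] by blast
  next
    case 3
    show ?thesis
    proof (cases "par t = a")
      case True
      then show ?thesis using solv_class_5_level_one[of A1 S v a e t, OF 3(1) sub(1) p1 nz(1) e1 e(2)] by blast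
    next
      case False
      obtain i j k where ijk: "{i, j, k} \<subseteq> A1" "distinct [i, j, k]" "ty v {i, j} a"
        using unit_class_equal_pair[OF cls(1) 3(1)] by blast
      obtain q where q: "q \<in> A2" using nonempty[OF 3(2)] by blast
      obtain r where r: "r \<in> A3" using nonempty[OF 3(3)] by blast
      have "{i, j} \<subseteq> A - {k, q, r}" using ijk(1,2) q r disj sub' by auto
      then show ?thesis using triple[of k q r "{i, j}" a] ijk q r nz False by auto
    qed
  next
    case 4
    obtain w where w: "w \<in> reach v A2" using reach_class_2[OF cls(2) 4(2)] by blast
    from reach_4_mod[OF cls(1) sub(1) 4(1) e1 e(2,3)] show ?thesis
    proof
      assume "\<exists>x0\<in>reach v A1. \<exists>x1\<in>reach v A1. (x0 = 0 \<or> x0 = par t) \<and> x1 \<noteq> 0 \<and> x1 \<noteq> par t"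
      then obtain x0 x1 where x: "x0 \<in> reach v A1" "x1 \<in> reach v A1" "x0 = 0 \<or> x0 = par t" "x1 \<noteq> 0" "x1 \<noteq> par t"
        by blast
      have "e \<in> S - (A1 \<union> A2)" using e(1) sub' by blast
      then have "solv 1 v S" if "x \<in> reach v A1" "x + w = 0 \<or> x + w = par t" for x
        using solv_reach_2_level_one[OF cls(1) sub(1) cls(2) sub(2) ne(1) that(1) w that(2)] e(2) by blast
      then show ?thesis using f4_mod_sum[OF x(3-5) e(3), of w] x(1,2) by blast
    qed
  next
    case 5
    show ?thesis
    proof (rule ccontr)
      assume no: "\<not> ?thesis"
      obtain i j k where ijk: "{i, j, k} \<subseteq> A1" "distinct [i, j, k]" "ty v {i, j} a"
        using reach_classes_3_3[OF cls(1) sub(1) 5(1) cls(2) sub(2) 5(2) ne(1)] no by blast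
      obtain i' j' k' where ijk': "{i', j', k'} \<subseteq> A2" "distinct [i', j', k']" "ty v {i', j'} b"
        using reach_classes_3_3[OF cls(2) sub(2) 5(2) cls(1) sub(1) 5(1) ne(1)[symmetric]] no by blast
      obtain r where r: "r \<in> A3" using nonempty[OF 5(3)] by blast
      \<comment> \<open>At least one of the types a and b of the two pairs differs from
        \<open>par t\<close>.\<close>
      have "{i, j} \<subseteq> A - {k, k', r}" "{i', j'} \<subseteq> A - {k, k', r}" using ijk(1,2) ijk'(1,2) r disj sub' by auto
      then show False using triple[of k k' r "{i, j}" a] triple[of k k' r "{i', j'}" b] ijk ijk' r nz ne no by auto
    qed
  next
    case 6
    obtain x where x: "x \<in> reach v A1" using reach_class_2[OF cls(1) 6(1)] by blast
    obtain y where y: "y \<in> reach v A2" using reach_class_2[OF cls(2) 6(2)] by blast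
    obtain z where z: "z \<in> reach v A3" using reach_class_2[OF cls(3) 6(3)] by blast
    have eS: "e \<in> S - (A1 \<union> A2)" "e \<in> S - (A1 \<union> A3)" "e \<in> S - (A2 \<union> A3)" using e(1) sub' by blast+
    from f4_mod_three[OF e(3), of x y z] show ?thesis
      using solv_reach_2_level_one[OF cls(1) sub(1) cls(2) sub(2) ne(1) x y _ eS(1) e(2)]
        solv_reach_2_level_one[OF cls(1) sub(1) cls(3) sub(3) ne(2) x z _ eS(2) e(2)]
        solv_reach_2_level_one[OF cls(2) sub(2) cls(3) sub(3) ne(3) y z _ eS(3) e(2)] by blast
  qed
qed

text \<open>Level-one elements of two different classes span F_4 and correct any type.\<close>

lemma solv_ty_rich:
  assumes J: "J \<subseteq> S" "finite J" "i \<in> J" "j \<in> J" "par (v i) = c" "par (v j) = c'" "c \<noteq> c'" "c \<noteq> 0" "c' \<noteq> 0"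
    and ty: "ty v J x" and b: "b \<in> S - J" "v b = 2 * s" "b' \<in> S - J" "v b' = 2 * t"
    and st: "par s \<noteq> 0" "par t \<noteq> 0" "par s \<noteq> par t"
  shows "solv 1 v S"
proof (cases "x = 0 \<or> x = par t")
  case True
  then show ?thesis using solv_ty_level_one[OF J ty _ b(3,4)] by blast
next
  case False
  have "b \<noteq> b'" using st(3) b(2,4) by auto
  have "x + par s = 0 \<or> x + par s = par t"
    using f4_index_two[of x "par t" "par s"] False st by blast
  moreover have "ty v (J \<union> {b}) (x + par s)"
    using ty_union[of J "{b}" v x "par s"] J(2) b(1) ty ty_singleton[of v b s] b(2) by auto
  ultimately show ?thesis
    using J b \<open>b \<noteq> b'\<close> by (intro solv_ty_level_one[of "J \<union> {b}" S i j v c c' "x + par s" t b']) auto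
qed

text \<open>Either two classes of units combine to an even sum, which \<open>solv_ty_rich\<close>
  completes, or four units share a class a and \<open>solv_class_4_rich\<close> needs a level-one
  block of class a and a further element of another class.\<close>

lemma solv_units_5_rich:
  assumes A: "A \<subseteq> S" "finite A" "card A \<ge> 5" "\<And>i. i \<in> A \<Longrightarrow> par (v i) \<noteq> 0"
    and B: "B \<subseteq> S - A" "card B \<ge> 3" "\<And>b. b \<in> B \<Longrightarrow> v b = 2 * u b" "\<And>b. b \<in> B \<Longrightarrow> par (u b) \<noteq> 0"
    and rich: "p \<in> B" "q \<in> B" "par (u p) \<noteq> par (u q)"
  shows "solv 1 v S"
proof -
  obtain a b c A1 A2 A3 where cls: "unit_class v a A1" "unit_class v b A2" "unit_class v c A3"
    and ne: "a \<noteq> b" "a \<noteq> c" "b \<noteq> c" and sub: "A1 \<subseteq> A" "A2 \<subseteq> A" "A3 \<subseteq> A"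
    and le: "card A1 \<ge> card A2" "card A2 \<ge> card A3" and card: "card A = card A1 + card A2 + card A3"
    by (rule sorted_unit_classes[of A v, OF A(2) A(4)])
  note nz = unit_classD(2)[OF cls(1)] unit_classD(2)[OF cls(2)] unit_classD(2)[OF cls(3)]
  note p1 = unit_classD(1)[OF cls(1)] note p2 = unit_classD(1)[OF cls(2)] note p3 = unit_classD(1)[OF cls(3)]
  have two: "solv 1 v S" if J: "J \<subseteq> A" "finite J" "i \<in> J" "j \<in> J" "i \<in> A1" "j \<in> A2" "ty v J x" for J i j x
  proof (rule solv_ty_rich[of J S i j v a b x p "u p" q "u q"])
    show "J \<subseteq> S" "p \<in> S - J" "q \<in> S - J" using J(1) A(1) B(1) rich(1,2) by blast+
  qed (use J p1 p2 ne nz B(3,4) rich in simp_all)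
  have nonempty: "\<exists>x. x \<in> X" if "card X \<ge> 1" for X :: "'a set" using that by (cases "X = {}") auto
  consider "card A1 \<ge> 2" "card A2 \<ge> 2" | "card A1 \<ge> 1" "card A2 \<ge> 1" "card A3 \<ge> 1" | "card A1 \<ge> 4"
    using le card A(3) by linarith
  then show ?thesis
  proof cases
    case 1
    obtain x where "x \<in> reach v A1" using reach_class_2[OF cls(1) 1(1)] by blast
    then obtain J where J: "J \<subseteq> A1" "finite J" "J \<noteq> {}" "ty v J x" by (auto simp: reach_def)
    obtain y where "y \<in> reach v A2" using reach_class_2[OF cls(2) 1(2)] by blast
    then obtain K where K: "K \<subseteq> A2" "finite K" "K \<noteq> {}" "ty v K y" by (auto simp: reach_def)
    have "ty v (J \<union> K) (x + y)"
      using ty_union[of J K v x y] J K unit_class_disjoint[OF cls(1,2) ne(1)] by auto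
    moreover obtain i j where "i \<in> J" "j \<in> K" using J K by blast
    ultimately show ?thesis using two[of "J \<union> K" i j "x + y"] J K sub by blast
  next
    case 2
    obtain i where i: "i \<in> A1" using nonempty[OF 2(1)] by blast
    obtain j where j: "j \<in> A2" using nonempty[OF 2(2)] by blast
    obtain k where k: "k \<in> A3" using nonempty[OF 2(3)] by blast
    have "distinct [i, j, k]" using i j k p1 p2 p3 ne by auto
    moreover have "a + b + c = 0" using f4_sum_of_others[OF ne nz] by simp
    ultimately have "par (sum v {i, j, k}) = 0" using p1[OF i] p2[OF j] p3[OF k] by (simp add: add.assoc)
    then obtain x where "ty v {i, j, k} x" using ty_of_par_0 by blast
    then show ?thesis using two[of "{i, j, k}" i j x] i j k sub by blast
  next
    case 3
    have BA: "B \<subseteq> S - A1" using B(1) sub by blast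
    have lev: "v b \<in> N a 1 \<longleftrightarrow> par (u b) = a" "v b \<notin> N a 2" "2 ^ 1 dvd v b" if "b \<in> B" for b
      by (rule level_one_in_N[OF B(3)[OF that] B(4)[OF that]])+
    have win: "solv 1 v S" if "e \<in> B" "par (u e) \<noteq> a" "K \<subseteq> B" "finite K" "e \<notin> K" "sum v K \<in> N a 1" "sum v K \<notin> N a 2" for e K
    proof (rule solv_class_4_rich[of A1 S v a e K, OF 3 _ p1 nz(1)])
      show "A1 \<subseteq> S" "e \<in> S - A1" "K \<subseteq> S - A1" using sub A(1) BA that by blast+
    qed (use that lev in simp_all)
    show ?thesis
    proof (cases "\<exists>b1\<in>B. par (u b1) = a")
      case True
      then obtain b1 where b1: "b1 \<in> B" "par (u b1) = a" by blast
      obtain e where "e \<in> B" "par (u e) \<noteq> a" using rich by metis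
      then show ?thesis using win[of e "{b1}"] b1 lev by auto
    next
      case False
      have pq: "p \<noteq> q" using rich(3) by auto
      then have "card (B - {p, q}) \<ge> 1" using card_minus_pair[of p q B] rich B(2) by simp
      then obtain e where e: "e \<in> B - {p, q}" using nonempty by blast
      \<comment> \<open>No level-one element has class a, but the two other nonzero residues add up
        to a.\<close>
      have "par (u p + u q) = a"
        using f4_sum_of_others[of "par (u p)" "par (u q)" a] rich B(4) nz False by simp
      moreover have "sum v {p, q} = 2 * (u p + u q)" using pq rich B(3) by (simp add: distrib_left)
      ultimately have "sum v {p, q} \<in> N a 1" "sum v {p, q} \<notin> N a 2"
        using level_one_in_N(1)[of "sum v {p, q}" "u p + u q" a] level_one_in_N(2)[of "sum v {p, q}" "u p + u q" a]
          nz(1) by simp_all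
      then show ?thesis using win[of e "{p, q}"] e rich False by auto
    qed
  qed
qed

section \<open>The case of a single residue class on level 1\<close>

text \<open>The aim is a quarter in {0, c}. If x is even, the quarters y1, y2, y3 of the pairs from
  B add up to residue \<open>\<beta>\<close>, so one of them lies outside {0, c} and can correct. If
  x has residue \<open>\<beta>\<close>, the quarters are w1, w2, w3 for one element and w1 + y3 for
  all three. Since y3 = w2 + w3 + \<open>\<beta>\<close> in residues, not all four lie outside {0,
  c}.\<close>

lemma solv_with_other_class:
  assumes J: "J \<subseteq> S" "finite J" "i \<in> J" "par (v i) = c" and c: "c \<noteq> 0" "\<beta> \<noteq> 0" "\<beta> \<noteq> c"
    and sum: "sum v J \<in> N \<beta> 1"
    and B: "B \<subseteq> S - J" "card B \<ge> 3" "\<And>b. b \<in> B \<Longrightarrow> v b = 2 * u b" "\<And>b. b \<in> B \<Longrightarrow> par (u b) = \<beta>"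
  shows "solv 1 v S"
proof -
  obtain x where x: "sum v J = 2 * x" "par x = 0 \<or> par x = \<beta>" using sum by (auto simp: N_def)
  obtain p q r where pqr: "{p, q, r} \<subseteq> B" "distinct [p, q, r]" using three_elements[OF B(2)] by blast
  have half: "\<exists>y. s + t = 2 * y" if "par s = \<beta>" "par t = \<beta>" for s t
  proof -
    have "par (s + t) = 0" using that by simp
    then show ?thesis unfolding par_eq_0_iff by (auto elim!: dvdE)
  qed
  have win: "solv 1 v S" if K: "K \<subseteq> {p, q, r}" "sum v J + sum v K = 4 * y" "par y = 0 \<or> par y = c" for K y
  proof (rule solv_N2[of "J \<union> K" S i v c])
    have "finite K" using K(1) by (rule finite_subset) simp
    then have "sum v (J \<union> K) = 4 * y"
      using J(2) K pqr(1) B(1) by (subst sum.union_disjoint) auto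
    then show "sum v (J \<union> K) \<in> N c 2" using K(3) by simp
    show "J \<union> K \<subseteq> S" using J(1) K(1) pqr(1) B(1) by blast
    show "finite (J \<union> K)" using \<open>finite K\<close> J(2) by simp
  qed (use J c in simp_all)
  have u: "v p = 2 * u p" "v q = 2 * u q" "v r = 2 * u r" "par (u p) = \<beta>" "par (u q) = \<beta>" "par (u r) = \<beta>"
    using pqr(1) B(3,4) by auto
  obtain y1 where y1: "u p + u q = 2 * y1" using half u by metis
  obtain y2 where y2: "u p + u r = 2 * y2" using half u by metis
  obtain y3 where y3: "u q + u r = 2 * y3" using half u by metis
  show ?thesis
  proof (cases "par x = 0")
    case True
    then obtain z where z: "x = 2 * z" by (auto simp: par_eq_0_iff)
    have "2 * (y1 + y2 + y3) = 2 * (u p + u q + u r)"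
      by (simp only: distrib_left y1[symmetric] y2[symmetric] y3[symmetric]) simp
    then have "y1 + y2 + y3 = u p + u q + u r" by (simp only: o2_two_cancel)
    then have "par (y1 + y2 + y3) = \<beta>" by (simp add: u)
    then have "par y1 \<notin> {0, c} \<or> par y2 \<notin> {0, c} \<or> par y3 \<notin> {0, c}" using c by auto
    moreover have pair: "solv 1 v S" if "par y \<notin> {0, c}" "par z \<notin> {0, c}" "sum v K = 4 * y" "K \<subseteq> {p, q, r}" for K y
    proof (rule win[of K "z + y"])
      show "par (z + y) = 0 \<or> par (z + y) = c" using f4_index_two[of "par z" c "par y"] that(1,2) c(1) by simp
    qed (use that x z in simp_all)
    moreover have "sum v {p, q} = 2 * (u p + u q)" "sum v {p, r} = 2 * (u p + u r)" "sum v {q, r} = 2 * (u q + u r)"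
      using pqr(2) u by (simp_all add: distrib_left)
    then have "sum v {p, q} = 4 * y1" "sum v {p, r} = 4 * y2" "sum v {q, r} = 4 * y3"
      unfolding y1 y2 y3 by simp_all
    moreover have "solv 1 v S" if "par z \<in> {0, c}" using win[of "{}" z] that x z by auto
    ultimately show ?thesis by blast
  next
    case False
    then have px: "par x = \<beta>" using x(2) by simp
    obtain w1 where w1: "x + u p = 2 * w1" using half px u by metis
    obtain w2 where w2: "x + u q = 2 * w2" using half px u by metis
    obtain w3 where w3: "x + u r = 2 * w3" using half px u by metis
    have one: "solv 1 v S" if "par w = 0 \<or> par w = c" "x + u b = 2 * w" "v b = 2 * u b" "b \<in> {p, q, r}" for b w
    proof (rule win[of "{b}" w])
      have "sum v J + sum v {b} = 2 * (x + u b)" using x that(3) by (simp add: distrib_left)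
      then show "sum v J + sum v {b} = 4 * w" unfolding that(2) by simp
    qed (use that in simp_all)
    have "2 * (w2 + w3) = 2 * (y3 + x)"
      by (simp only: distrib_left w2[symmetric] w3[symmetric] y3[symmetric]) simp
    then have "w2 + w3 = y3 + x" by (simp only: o2_two_cancel)
    then have "par w2 + par w3 = par y3 + \<beta>" using px by (metis par_add)
    then have y3': "par y3 = par w2 + par w3 + \<beta>" by (metis add.assoc add.right_neutral f4_double)
    have all: "solv 1 v S" if "par (w1 + y3) = 0 \<or> par (w1 + y3) = c"
    proof (rule win[of "{p, q, r}" "w1 + y3"])
      have "sum v J + sum v {p, q, r} = 2 * (x + u p) + 2 * (u q + u r)"
        using x pqr(2) u by (simp add: distrib_left)
      then show "sum v J + sum v {p, q, r} = 4 * (w1 + y3)" unfolding w1 y3 by simp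
    qed (use that in simp_all)
    show ?thesis
    proof (rule ccontr)
      assume no: "\<not> ?thesis"
      have w: "par w1 \<noteq> 0" "par w1 \<noteq> c" "par w2 \<noteq> 0" "par w2 \<noteq> c" "par w3 \<noteq> 0" "par w3 \<noteq> c"
        using one[OF _ w1 u(1)] one[OF _ w2 u(2)] one[OF _ w3 u(3)] no by blast+
      have "par w2 + par w3 = 0 \<or> par w2 + par w3 = c" using f4_index_two[OF w(3-6) c(1)] .
      then have "par y3 \<noteq> 0" "par y3 \<noteq> c"
        using c y3' by (auto simp: f4_add_eq_0_iff)
      then have "par w1 + par y3 = 0 \<or> par w1 + par y3 = c" using f4_index_two[OF w(1,2) _ _ c(1)] by blast
      then show False using all no by simp
    qed
  qed
qed

lemma solv_with_level_two:
  assumes J: "J \<subseteq> S" "finite J" "i \<in> J" "par (v i) = c" "c \<noteq> 0" "4 dvd sum v J"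
    and k: "k \<in> S - J" "v k = 4 * t" "par t \<noteq> 0" "par t \<noteq> c"
  shows "solv 1 v S"
proof -
  obtain y where y: "sum v J = 4 * y" using J(6) by (rule dvdE)
  show ?thesis
  proof (cases "par y = 0 \<or> par y = c")
    case True
    then show ?thesis using J y by (intro solv_N2[of J S i v c]) auto
  next
    case False
    then have "par (y + t) = 0 \<or> par (y + t) = c"
      using f4_index_two[of "par y" c "par t"] k J(5) by simp
    moreover have "sum v (insert k J) = 4 * (y + t)" using J(2) k y by (simp add: distrib_left)
    ultimately have "sum v (insert k J) \<in> N c 2" by (simp only: four_mult_in_N2)
    then show ?thesis using J k by (intro solv_N2[of "insert k J" S i v c]) auto
  qed
qed

text \<open>Five units contain a subset J with sum in \<open>N \<beta> 1\<close>. It has one class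
  only, or else a level-one element completes it, and this class is \<open>\<beta>\<close> by
  \<open>solv_with_other_class\<close>. A level-two coefficient of another class would then solve
  the form, and so would two elements of B in different halves, as three blocks with J.\<close>

lemma nonrich_structure:
  assumes no: "\<not> solv 1 v S"
    and A: "A \<subseteq> S" "card A \<ge> 5" "\<And>i. i \<in> A \<Longrightarrow> par (v i) \<noteq> 0"
    and B: "B \<subseteq> S" "card B \<ge> 3" "\<And>b. b \<in> B \<Longrightarrow> v b = 2 * u b" "\<And>b. b \<in> B \<Longrightarrow> par (u b) = \<beta>" "\<beta> \<noteq> 0"
  shows "k \<in> S \<Longrightarrow> v k = 4 * u k \<Longrightarrow> par (u k) \<noteq> 0 \<Longrightarrow> par (u k) = \<beta>"
    and "b \<in> B \<Longrightarrow> b' \<in> B \<Longrightarrow> b \<noteq> b' \<Longrightarrow> u b + u b' \<in> N \<beta> 1"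
proof -
  have BA: "i \<notin> A" if "i \<in> B" for i using that A(3) B(3) by (metis mult_zero_left par_mult par_two)
  obtain J where J: "J \<subseteq> A" "finite J" "J \<noteq> {}" "sum v J \<in> N \<beta> 1"
    using zero_sum_mod_N1[OF A(2) B(5), of v] by blast
  have JS: "J \<subseteq> S" "B \<subseteq> S - J" using J(1) A(1) B(1) BA by blast+
  obtain x where x: "sum v J = 2 * x" "par x = 0 \<or> par x = \<beta>" using J(4) by (auto simp: N_def)
  obtain b0 where b0: "b0 \<in> B" using B(2) by (cases "B = {}") auto
  obtain i where i: "i \<in> J" using J(3) by blast
  define c where "c = par (v i)"
  have c: "c \<noteq> 0" using i J(1) A(3) by (auto simp: c_def)
  have same: "par (v j) = c" if "j \<in> J" for j
  proof (rule ccontr)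
    assume ne: "par (v j) \<noteq> c"
    have "ty v J (par x)" using x(1) by (auto simp: ty_def)
    moreover have "par x = 0 \<or> par x = par (u b0)" using x(2) B(4)[OF b0] by simp
    moreover have "par (v j) \<noteq> 0" using that J(1) A(3) by blast
    ultimately have "solv 1 v S"
      using solv_ty_level_one[of J S i j v c "par (v j)" "par x" "u b0" b0] JS J(2) i that c ne B(3)[OF b0] b0
      by (auto simp: c_def)
    then show False using no by blast
  qed
  have cb: "c = \<beta>"
  proof (rule ccontr)
    assume "c \<noteq> \<beta>"
    then have "solv 1 v S"
      using solv_with_other_class[of J S i v c \<beta> B u] JS J i c B by (auto simp: c_def)
    then show False using no by blast
  qed
  show "par (u k) = \<beta>" if k: "k \<in> S" "v k = 4 * u k" "par (u k) \<noteq> 0"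
  proof (rule ccontr)
    assume ne: "par (u k) \<noteq> \<beta>"
    have kJ: "k \<notin> J" using same k(2) c by force
    have kB: "k \<noteq> b0"
    proof
      assume "k = b0"
      then have "2 * u b0 = 2 * (2 * u b0)" using k(2) B(3)[OF b0] by simp
      then have "u b0 = 2 * u b0" by (simp only: o2_two_cancel)
      then have "par (u b0) = par (2 * u b0)" by (rule arg_cong)
      then show False using B(4)[OF b0] B(5) by simp
    qed
    have "solv 1 v S" using x(2)
    proof
      assume "par x = 0"
      then have "4 dvd sum v J" using x(1) by (auto simp: par_eq_0_iff)
      then show ?thesis
        using solv_with_level_two[of J S i v c k "u k"] JS J(2) i c k kJ ne cb by (auto simp: c_def)
    next
      assume "par x = \<beta>"
      then have "par (x + u b0) = 0" using B(4)[OF b0] by simp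
      then obtain y where y: "x + u b0 = 2 * y" unfolding par_eq_0_iff by (rule dvdE)
      have "sum v (insert b0 J) = 2 * (x + u b0)"
        using J(2) JS(2) b0 x(1) B(3)[OF b0] by (subst sum.insert) (auto simp: distrib_left)
      then have "4 dvd sum v (insert b0 J)" unfolding y by simp
      then show ?thesis
        using solv_with_level_two[of "insert b0 J" S i v c k "u k"] JS J(2) i c k kJ kB b0 B(1) ne cb
        by (auto simp: c_def)
    qed
    then show False using no by blast
  qed
  show "u b + u b' \<in> N \<beta> 1" if b: "b \<in> B" "b' \<in> B" "b \<noteq> b'"
  proof (rule ccontr)
    assume nh: "u b + u b' \<notin> N \<beta> 1"
    have lev: "v b \<in> N \<beta> 1 \<longleftrightarrow> par (u b) = \<beta>" "v b \<notin> N \<beta> 2" if "b \<in> B" for b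
      using level_one_in_N(1,2)[OF B(3)[OF that], of \<beta>] B(4)[OF that] B(5) by simp_all
    have "v b + v b' = 2 * (u b + u b')" using b B(3) by (simp add: distrib_left)
    then have "v b + v b' \<notin> N \<beta> 2" using nh by (simp only: two_mult_in_N2 simp_thms)
    moreover have bJ: "b \<notin> J" "b' \<notin> J" using JS(2) b by blast+
    ultimately have "solv 1 v S"
      using b JS B J i c cb lev
      by (intro solv_three_blocks[of J S "{b}" "{b'}" v \<beta> i]) (auto simp: c_def)
    then show False using no by blast
  qed
qed

section \<open>The case \<open>3 | d\<close>\<close>

text \<open>The counts 5, 9, 13, 17 are the least integers above 4 t. Without a zero, level 0 has at
  most 6 variables and levels 1 and 2 are of one class \<open>\<beta>\<close>, inside one set Z a +
  4 O each. Five elements of such a set are too many, which fixes \<open>card B = 3\<close> and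
  \<open>card C = 4\<close>. Level 3 is then nonempty and supplies the fifth element.\<close>

lemma form_zero_of_large_levels:
  assumes m: "odd m" and I: "finite I" and u: "\<And>i. i \<in> I \<Longrightarrow> par (u i) \<noteq> 0"
    and count: "card {i\<in>I. l i < 1} \<ge> 5" "card {i\<in>I. l i < 2} \<ge> 9" "card {i\<in>I. l i < 3} \<ge> 13"
      "card {i\<in>I. l i < 4} \<ge> 17"
  shows "form_zero (2 * m) I (\<lambda>i. 2 ^ l i * u i)"
proof (rule ccontr)
  assume no: "\<not> ?thesis"
  define v where "v b i = 2 ^ (l i - b) * u i" for b i
  define S where "S b = {i\<in>I. b \<le> l i}" for b
  have solv: "\<not> solv 1 (v b) (S b)" for b
    using form_zero_of_solv_at_level[of m I 1 l b u] m I no by (auto simp: v_def [abs_def] S_def)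
  define A B C D where "A = {i\<in>I. l i = 0}" and "B = {i\<in>I. l i = 1}" and "C = {i\<in>I. l i = 2}"
    and "D = {i\<in>I. l i = 3}"
  note defs = A_def B_def C_def D_def
  have fin: "finite A" "finite B" "finite C" "finite D" using I by (simp_all add: defs)
  have "{i\<in>I. l i < 1} = A" "{i\<in>I. l i < 2} = A \<union> B" "{i\<in>I. l i < 3} = (A \<union> B) \<union> C"
    "{i\<in>I. l i < 4} = ((A \<union> B) \<union> C) \<union> D"
    by (auto simp: defs)
  moreover have "card (A \<union> B) = card A + card B"
    using fin by (intro card_Un_disjoint) (auto simp: defs)
  moreover have "card ((A \<union> B) \<union> C) = card (A \<union> B) + card C"
    using fin by (intro card_Un_disjoint) (auto simp: defs)
  moreover have "card (((A \<union> B) \<union> C) \<union> D) = card ((A \<union> B) \<union> C) + card D"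
    using fin by (intro card_Un_disjoint) (auto simp: defs)
  ultimately have n: "card A \<ge> 5" "card A + card B \<ge> 9" "card A + card B + card C \<ge> 13"
    "card A + card B + card C + card D \<ge> 17"
    using count by (simp_all only:)
  have S: "A \<subseteq> S 0" "B \<subseteq> S 0 - A" "C \<subseteq> S 0" "B \<subseteq> S 1" "C \<subseteq> S 1 - B" "D \<subseteq> S 1 - B" "C \<subseteq> S 2" "D \<subseteq> S 2 - C"
    by (auto simp: S_def defs)
  have vA: "v 0 i = u i" "par (v 0 i) \<noteq> 0" if "i \<in> A" for i using that u by (auto simp: v_def A_def)
  have vB: "v 0 i = 2 * u i" "v 1 i = u i" "par (u i) \<noteq> 0" if "i \<in> B" for i
    using that u by (auto simp: v_def B_def)
  have vC: "v 0 i = 4 * u i" "v 1 i = 2 * u i" "v 2 i = u i" "par (u i) \<noteq> 0" if "i \<in> C" for i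
    using that u by (auto simp: v_def C_def)
  have vD: "v 1 i = 4 * u i" "v 2 i = 2 * u i" "par (u i) \<noteq> 0" if "i \<in> D" for i
    using that u by (auto simp: v_def D_def numeral_3_eq_3 numeral_2_eq_2)
  have nonempty: "\<exists>x. x \<in> X" if "card X \<ge> 1" for X :: "'a set" using that by (cases "X = {}") auto
  have A9: "card A < 9"
    using solv_units_9[of A "S 0" "v 0", OF S(1) fin(1) _ vA(2)] solv by (meson not_le)
  then obtain b0 where b0: "b0 \<in> B" using nonempty[of B] n(2) by force
  have A7: "card A < 7"
  proof (rule ccontr)
    assume "\<not> card A < 7"
    then have "card A \<ge> 7" by simp
    from solv_units_7_level_one[of A "S 0" "v 0" b0 "u b0", OF S(1) fin(1) this vA(2) _ vB(1,3)[OF b0]]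
    show False using b0 S(2) solv by blast
  qed
  then have B3: "card B \<ge> 3" using n(2) by simp
  define \<beta> where "\<beta> = par (u b0)"
  have \<beta>: "\<beta> \<noteq> 0" using vB(3)[OF b0] by (simp add: \<beta>_def)
  have parB: "par (u b) = \<beta>" if "b \<in> B" for b
    using solv_units_5_rich[of A "S 0" "v 0" B u b b0, OF S(1) fin(1) n(1) vA(2) S(2) B3 vB(1,3) that b0]
      solv by (auto simp: \<beta>_def)
  have BS0: "B \<subseteq> S 0" using S(2) by blast
  note nonrich = nonrich_structure[of "v 0" "S 0" A B u \<beta>, OF solv S(1) n(1) vA(2) BS0 B3 vB(1) parB \<beta>]
  have parC: "par (u k) = \<beta>" if "k \<in> C" for k
    using nonrich(1)[of k] that S(3) vC[OF that] by blast
  have halfB: "u b + u b' \<in> N \<beta> 1" if "b \<in> B" "b' \<in> B" "b \<noteq> b'" for b b'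
    using nonrich(2) that by blast
  have clsB: "unit_class (v 1) \<beta> B" using fin \<beta> parB vB(2) by (simp add: unit_class_def)
  have clsC: "unit_class (v 2) \<beta> C" using fin \<beta> parC vC(3) by (simp add: unit_class_def)
  have oddN: "2 * x \<in> N \<beta> 1" "2 * x \<notin> N \<beta> 2" if "par x = \<beta>" for x
    using level_one_in_N(1,2)[of "2 * x" x \<beta>] that \<beta> by simp_all
  have level1: "card B + card E < 5"
    if E: "E \<subseteq> S 1 - B" "finite E" "\<And>e. e \<in> E \<Longrightarrow> v 1 e \<in> N \<beta> 1"
      "\<And>K. K \<subseteq> E \<Longrightarrow> K \<noteq> {} \<Longrightarrow> sum (v 1) K \<notin> N \<beta> 2" for E
  proof (rule ccontr)
    assume "\<not> card B + card E < 5"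
    then have "card B + card E \<ge> 5" by simp
    moreover have "v 1 i + v 1 j \<in> N \<beta> 1" if "i \<in> B" "j \<in> B" "i \<noteq> j" for i j
      using halfB[OF that] that vB(2) by simp
    moreover have "B \<noteq> {}" using b0 by blast
    ultimately have "solv 1 (v 1) (S 1)"
      using solv_half_class_with[of "v 1" \<beta> B "S 1" E, OF clsB S(4) _ _ E(1,2) _ E(3,4)] by blast
    then show False using solv by blast
  qed
  have B5: "card B < 5" using level1[of "{}"] by simp
  \<comment> \<open>Once \<open>card B = 3\<close> is known, this says that no such e and f
    exist.\<close>
  have pairE: "card B + 2 < 5"
    if "e \<noteq> f" "{e, f} \<subseteq> S 1 - B" "v 1 e \<in> N \<beta> 1" "v 1 f \<in> N \<beta> 1"
      "v 1 e \<notin> N \<beta> 2" "v 1 f \<notin> N \<beta> 2" "v 1 e + v 1 f \<notin> N \<beta> 2" for e f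
  proof -
    have "sum (v 1) K \<notin> N \<beta> 2" if K: "K \<subseteq> {e, f}" "K \<noteq> {}" for K
    proof -
      have "K = {e} \<or> K = {f} \<or> K = {e, f}" using K by blast
      then show ?thesis using \<open>e \<noteq> f\<close> \<open>v 1 e \<notin> N \<beta> 2\<close> \<open>v 1 f \<notin> N \<beta> 2\<close> \<open>v 1 e + v 1 f \<notin> N \<beta> 2\<close> by auto
    qed
    then show ?thesis using level1[of "{e, f}"] that by auto
  qed
  have "card C \<ge> 1" using n(3) A7 B5 by simp
  then obtain k0 where k0: "k0 \<in> C" using nonempty by blast
  have v1C: "v 1 k \<in> N \<beta> 1" "v 1 k \<notin> N \<beta> 2" if "k \<in> C" for k
    using oddN[OF parC[OF that]] vC(2)[OF that] by simp_all
  have B4: "card B = 3"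
  proof -
    have "sum (v 1) K \<notin> N \<beta> 2" if K: "K \<subseteq> {k0}" "K \<noteq> {}" for K
    proof -
      have "K = {k0}" using K by blast
      then show ?thesis using v1C[OF k0] by simp
    qed
    then have "card B + 1 < 5" using level1[of "{k0}"] k0 v1C S(5) by auto
    then show ?thesis using B3 by simp
  qed
  \<comment> \<open>Seen from level 1, j and k would otherwise complete B to five elements.\<close>
  have halfC: "v 2 j + v 2 k \<in> N \<beta> 1" if jk: "j \<in> C" "k \<in> C" "j \<noteq> k" for j k
  proof (rule ccontr)
    assume "v 2 j + v 2 k \<notin> N \<beta> 1"
    moreover have "v 1 j + v 1 k = 2 * (v 2 j + v 2 k)" using jk vC by (simp add: distrib_left)
    ultimately have "v 1 j + v 1 k \<notin> N \<beta> 2" by (simp only: two_mult_in_N2 simp_thms)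
    then show False using pairE[of j k] jk v1C S(5) B4 by auto
  qed
  have level2: "card C + card E < 5"
    if E: "E \<subseteq> S 2 - C" "finite E" "\<And>e. e \<in> E \<Longrightarrow> v 2 e \<in> N \<beta> 1"
      "\<And>K. K \<subseteq> E \<Longrightarrow> K \<noteq> {} \<Longrightarrow> sum (v 2) K \<notin> N \<beta> 2" for E
  proof (rule ccontr)
    assume "\<not> card C + card E < 5"
    then have "card C + card E \<ge> 5" by simp
    moreover have "C \<noteq> {}" using k0 by blast
    ultimately have "solv 1 (v 2) (S 2)"
      using solv_half_class_with[of "v 2" \<beta> C "S 2" E, OF clsC S(7) _ _ E(1,2) _ E(3,4)] halfC by blast
    then show False using solv by blast
  qed
  have C5: "card C < 5" using level2[of "{}"] by simp
  have C4: "card C \<ge> 4" using n(3) A7 B4 by simp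
  have "card D \<ge> 1" using n(4) A7 B4 C5 by simp
  then obtain e where e: "e \<in> D" using nonempty by blast
  show False
  \<comment> \<open>An e of class \<open>\<beta>\<close> is the fifth element next to C, seen from
    level 2; an e of another class is the fifth next to B and \<open>k0\<close>, seen from level
    1.\<close>
  proof (cases "par (u e) = \<beta>")
    case True
    have "sum (v 2) K \<notin> N \<beta> 2" if K: "K \<subseteq> {e}" "K \<noteq> {}" for K
    proof -
      have "K = {e}" using K by blast
      then show ?thesis using oddN(2)[OF True] vD(2)[OF e] by simp
    qed
    moreover have "v 2 e \<in> N \<beta> 1" using oddN(1)[OF True] vD(2)[OF e] by simp
    ultimately have "card C + 1 < 5" using level2[of "{e}"] e S(8) by auto
    then show False using C4 by simp
  next
    case False
    have ve: "v 1 e = 2 * (2 * u e)" using vD(1)[OF e] by simp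
    have "v 1 e \<in> N \<beta> 1" unfolding ve two_mult_in_N1 by simp
    moreover have "v 1 e \<notin> N \<beta> 2" using vD(1,3)[OF e] False by simp
    moreover have "v 1 k0 + v 1 e \<notin> N \<beta> 2"
    proof -
      have "v 1 k0 + v 1 e = 2 * (u k0 + 2 * u e)" using ve vC(2)[OF k0] by (simp add: distrib_left)
      moreover have "par (u k0 + 2 * u e) = \<beta>" using parC[OF k0] by simp
      ultimately show ?thesis using oddN(2)[of "u k0 + 2 * u e"] by (simp only: simp_thms)
    qed
    moreover have "k0 \<noteq> e" using k0 e by (auto simp: defs)
    ultimately show False using pairE[of k0 e] k0 e v1C S(5,6) B4 by auto
  qed
qed

lemma Gamma_star_upper_bound_2:
  assumes m: "odd m" "m \<ge> 3"
  shows "Gamma_star (2 * m) TYPE(q2_sqrt5) \<le> enat (4 * (2 * m) + 1)"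
proof (rule Gamma_star_le)
  show "2 * m > 0" using m by simp
  fix s and a :: "nat \<Rightarrow> q2_sqrt5"
  assume s: "4 * (2 * m) + 1 \<le> s" and a: "\<And>i. i < s \<Longrightarrow> a i \<noteq> 0"
  have "1 * s > 4 * (2 * m)" "2 * m > 0" using s m by simp_all
  obtain l u where u: "\<And>i. i < s \<Longrightarrow> par (u i) \<noteq> 0"
    and count: "\<And>t. 1 \<le> t \<Longrightarrow> t \<le> 2 * m \<Longrightarrow> 1 * card {i\<in>{..<s}. l i < t} > 4 * t"
    and zero: "form_zero (2 * m) {..<s} (\<lambda>i. 2 ^ l i * u i) \<Longrightarrow> has_nontrivial_zero (2 * m) s a"
    by (rule normalized_levels[of s a "2 * m" 4 1, OF a \<open>2 * m > 0\<close> \<open>1 * s > 4 * (2 * m)\<close>]) (assumption | rule that)+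
  have "form_zero (2 * m) {..<s} (\<lambda>i. 2 ^ l i * u i)"
    using u count[of 1] count[of 2] count[of 3] count[of 4] m
    by (intro form_zero_of_large_levels[OF m(1)]) simp_all
  then show "has_nontrivial_zero (2 * m) s a" by (rule zero)
qed

theorem theorem1:
  fixes d m :: nat
  assumes "m \<ge> 3" and "odd m" and "d = 2 * m"
  shows "(\<not> 3 dvd d \<longrightarrow> Gamma_star d TYPE(q2_sqrt5) = enat (3 * d div 2 + 1)) \<and>
         (3 dvd d \<longrightarrow> enat (3 * d + 1) \<le> Gamma_star d TYPE(q2_sqrt5) \<and>
                    Gamma_star d TYPE(q2_sqrt5) \<le> enat (4 * d + 1))"
proof -
  have "3 dvd d \<longleftrightarrow> 3 dvd m" using assms(3) by presburger
  moreover have "3 * d div 2 = 3 * m" "3 * d = 6 * m" using assms(3) by simp_all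
  ultimately show ?thesis
    using Gamma_star_lower_bound_1[of m] Gamma_star_upper_bound_1[of m]
      Gamma_star_lower_bound_2[of m] Gamma_star_upper_bound_2[of m] assms
    by (auto intro!: antisym)
qed

end
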